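(* Let $A$ be a finite-dimensional vector space over $\mathbf{k}$ with a binary operation $\circ$ and a linear map $\Delta_A:A\to A\otimes A$, and let $(B=\oplus_{i\in\mathbb{Z}}B_i,\diamond,(\cdot,\cdot))$ be a quadratic $\mathbb{Z}$-graded right Novikov algebra. Put $L=A\otimes B$, graded by $L_i=A\otimes B_i$, with the bracket $$[a_1\otimes b_1,a_2\otimes b_2]=a_1\circ a_2\otimes b_1\diamond b_2-a_2\circ a_1\otimes b_2\diamond b_1\quad(a_1,a_2\in A,\ b_1,b_2\in B).$$ Let $\Delta_B:B\to B\,\widehat{\otimes}\,B$ be the linear map defined by $(\Delta_B(a),b\otimes c)=(a,b\diamond c)$ for all $a,b,c\in B$, and let $\delta:L\to L\,\widehat{\otimes}\,L$ be the linear map $$\delta(a\otimes b)=(\mathrm{id}_{L\widehat{\otimes}L}-\widehat{\tau})\big(\Delta_A(a)\bullet\Delta_B(b)\big)\quad(a\in A,\ b\in B).$$ (1) If $(A,\circ,\Delta_A)$ is a Novikov bialgebra, then $(L,[\cdot,\cdot],\delta)$ is a completed Lie bialgebra. (2) If $B=\mathbf{k}[t,t^{-1}]$ with $B_i=\mathbf{k}t^{i+1}$, $t^i\diamond t^j=it^{i+j-1}$ and $(t^i,t^j)=\delta_{i+j+1,0}$ for all $i,j\in\mathbb{Z}$, then the converse also holds: if $(L,[\cdot,\cdot],\delta)$ is a completed Lie bialgebra, then $(A,\circ,\Delta_A)$ is a Novikov bialgebra.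
   Context: $\mathbf{k}$ is a field of characteristic zero; $\tau(x\otimes y)=y\otimes x$. A Novikov algebra $(A,\circ)$: $(a\circ b)\circ c-a\circ(b\circ c)=(b\circ a)\circ c-b\circ(a\circ c)$ and $(a\circ b)\circ c=(a\circ c)\circ b$ for all $a,b,c$. A right Novikov algebra $(B,\diamond)$: $(a\diamond b)\diamond c-a\diamond(b\diamond c)=(a\diamond c)\diamond b-a\diamond(c\diamond b)$ and $a\diamond(b\diamond c)=b\diamond(a\diamond c)$. It is $\mathbb{Z}$-graded if $B=\oplus_{i\in\mathbb{Z}}B_i$ with each $B_i$ finite-dimensional and $B_i\diamond B_j\subset B_{i+j}$. A quadratic $\mathbb{Z}$-graded right Novikov algebra is a $\mathbb{Z}$-graded right Novikov algebra with a symmetric nondegenerate bilinear form $(\cdot,\cdot)$ that is graded (there is $m\in\mathbb{Z}$ with $(B_i,B_j)=0$ whenever $i+j+m\neq0$) and invariant: $(a\diamond b,c)=-(a,b\diamond c+c\diamond b)$. A Novikov coalgebra $(A,\Delta)$: $\Delta:A\to A\otimes A$ linear with $(\mathrm{id}\otimes\Delta)\Delta-(\tau\otimes\mathrm{id})(\mathrm{id}\otimes\Delta)\Delta=(\Delta\otimes\mathrm{id})\Delta-(\tau\otimes\mathrm{id})(\Delta\otimes\mathrm{id})\Delta$ and $(\tau\otimes\mathrm{id})(\mathrm{id}\otimes\Delta)\tau\Delta=(\Delta\otimes\mathrm{id})\Delta$. For a Novikov algebra put $L_A(a)b=a\circ b$, $R_A(a)b=b\circ a$, $L_{A,\star}=L_A+R_A$.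 A Novikov bialgebra is a triple $(A,\circ,\Delta)$ with $(A,\circ)$ a Novikov algebra, $(A,\Delta)$ a Novikov coalgebra and, for all $a,b\in A$, $$\Delta(a\circ b)=(R_A(b)\otimes\mathrm{id})\Delta(a)+(\mathrm{id}\otimes L_{A,\star}(a))(\Delta(b)+\tau\Delta(b)),$$ $$(L_{A,\star}(a)\otimes\mathrm{id})\Delta(b)-(\mathrm{id}\otimes L_{A,\star}(a))\tau\Delta(b)=(L_{A,\star}(b)\otimes\mathrm{id})\Delta(a)-(\mathrm{id}\otimes L_{A,\star}(b))\tau\Delta(a),$$ $$(\mathrm{id}\otimes R_A(a)-R_A(a)\otimes\mathrm{id})(\Delta(b)+\tau\Delta(b))=(\mathrm{id}\otimes R_A(b)-R_A(b)\otimes\mathrm{id})(\Delta(a)+\tau\Delta(a)).$$ Completed tensor products: for $\mathbb{Z}$-graded spaces, $C\,\widehat{\otimes}\,D:=\prod_{i,j\in\mathbb{Z}}C_i\otimes D_j$ (similarly for three factors); elements are formal sums $\sum_{i,j,\alpha}c_{i\alpha}\otimes d_{j\alpha}$ ($c_{i\alpha}\in C_i$, $d_{j\alpha}\in D_j$, finitely many $\alpha$ for each $(i,j)$). Maps $f\,\widehat{\otimes}\,g$, $\widehat{\tau}$ (the flip), and iterated coproducts are defined termwise on formal sums (understood to be well defined: only finitely many terms contribute in each multidegree). The pairing of $\sum a_{1i\alpha}\otimes a_{2j\alpha}\in B\,\widehat{\otimes}\,B$ with $b\otimes c\in B\otimes B$ is $\sum(a_{1i\alpha},b)(a_{2j\alpha},c)$.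 For $\Delta_A(a)=\sum_{(a)}a_{(1)}\otimes a_{(2)}$ and $\Delta_B(b)=\sum b_{1i\alpha}\otimes b_{2j\alpha}$, $\Delta_A(a)\bullet\Delta_B(b):=\sum_{(a)}\sum_{i,j,\alpha}(a_{(1)}\otimes b_{1i\alpha})\otimes(a_{(2)}\otimes b_{2j\alpha})$. A completed Lie coalgebra is a $\mathbb{Z}$-graded space $L$ with linear $\delta:L\to L\,\widehat{\otimes}\,L$ such that $\delta=-\widehat{\tau}\delta$ and $(\mathrm{id}\,\widehat{\otimes}\,\delta)\delta-(\widehat{\tau}\,\widehat{\otimes}\,\mathrm{id})(\mathrm{id}\,\widehat{\otimes}\,\delta)\delta=(\delta\,\widehat{\otimes}\,\mathrm{id})\delta$. A completed Lie bialgebra is $(L,[\cdot,\cdot],\delta)$ with $(L,[\cdot,\cdot])$ a Lie algebra, $(L,\delta)$ a completed Lie coalgebra, and $\delta([a,b])=(\mathrm{ad}_a\widehat{\otimes}\,\mathrm{id}+\mathrm{id}\,\widehat{\otimes}\,\mathrm{ad}_a)\delta(b)-(\mathrm{ad}_b\widehat{\otimes}\,\mathrm{id}+\mathrm{id}\,\widehat{\otimes}\,\mathrm{ad}_b)\delta(a)$ for all $a,b\in L$, where $\mathrm{ad}_a(b)=[a,b]$. *)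

theory Defs
  imports Complex_Main "HOL-Library.Function_Algebras" "HOL-Library.Groups_Big_Fun"
    "HOL-Library.Poly_Mapping"
begin

section \<open>Linear and multilinear maps on subspaces\<close>

text \<open>A vector space over \<open>'k\<close> is given by its scalar multiplication \<open>s\<close> and, when it is not a whole
  type, by a carrier set inside an ambient vector space (as for \<open>A \<otimes> B\<close> below).\<close>

definition linear_on ::
  "('k::field \<Rightarrow> 'u::ab_group_add \<Rightarrow> 'u) \<Rightarrow> 'u set \<Rightarrow> ('k \<Rightarrow> 'w::ab_group_add \<Rightarrow> 'w) \<Rightarrow> ('u \<Rightarrow> 'w) \<Rightarrow> bool"
  where "linear_on s U s' f \<longleftrightarrow>
    (\<forall>x\<in>U. \<forall>y\<in>U. f (x + y) = f x + f y) \<and> (\<forall>c. \<forall>x\<in>U. f (s c x) = s' c (f x))"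

definition bilinear_on ::
  "('k::field \<Rightarrow> 'u::ab_group_add \<Rightarrow> 'u) \<Rightarrow> 'u set \<Rightarrow> ('k \<Rightarrow> 'v::ab_group_add \<Rightarrow> 'v) \<Rightarrow> 'v set \<Rightarrow>
   ('k \<Rightarrow> 'w::ab_group_add \<Rightarrow> 'w) \<Rightarrow> ('u \<Rightarrow> 'v \<Rightarrow> 'w) \<Rightarrow> bool"
  where "bilinear_on s U s' V s'' f \<longleftrightarrow>
    (\<forall>v\<in>V. linear_on s U s'' (\<lambda>u. f u v)) \<and> (\<forall>u\<in>U. linear_on s' V s'' (f u))"

definition trilinear_form ::
  "('k::field \<Rightarrow> 'v::ab_group_add \<Rightarrow> 'v) \<Rightarrow> 'v set \<Rightarrow> ('v \<Rightarrow> 'v \<Rightarrow> 'v \<Rightarrow> 'k) \<Rightarrow> bool"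
  where "trilinear_form s V f \<longleftrightarrow>
    (\<forall>x\<in>V. bilinear_on s V s V (*) (f x)) \<and>
    (\<forall>y\<in>V. \<forall>z\<in>V. linear_on s V (*) (\<lambda>x. f x y z))"

definition fscale :: "'k::field \<Rightarrow> ('x \<Rightarrow> 'k) \<Rightarrow> 'x \<Rightarrow> 'k"
  where "fscale c f = (\<lambda>x. c * f x)"


section \<open>Tensor products\<close>

text \<open>The pure tensor \<open>u \<otimes> v\<close> is evaluation of bilinear forms at \<open>(u, v)\<close>, and \<open>U \<otimes> V\<close> is the span
  of the pure tensors in the space of functions on forms.  A function that is not bilinear on
  \<open>U \<times> V\<close> is sent to \<open>0\<close>, so that equality of tensors is equality of functions.  Over a field this
  is a tensor product: see \<open>tensor_space_universal\<close> and \<open>tensor_space_unique\<close>.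
  A tensor \<open>\<Sum> u\<^sub>\<alpha> \<otimes> v\<^sub>\<alpha>\<close> applied to a bilinear form \<open>\<beta>\<close> is \<open>\<Sum> \<beta> u\<^sub>\<alpha> v\<^sub>\<alpha>\<close>, and all the operations
  on tensors below are obtained by substituting a suitable form.  Three-fold tensors are
  functions on trilinear forms in the same way.\<close>

type_synonym ('k, 'u, 'v) tensor = "('u \<Rightarrow> 'v \<Rightarrow> 'k) \<Rightarrow> 'k"
type_synonym ('k, 'v) tensor3 = "('v \<Rightarrow> 'v \<Rightarrow> 'v \<Rightarrow> 'k) \<Rightarrow> 'k"

definition pure_tensor ::
  "('k::field \<Rightarrow> 'u::ab_group_add \<Rightarrow> 'u) \<Rightarrow> 'u set \<Rightarrow> ('k \<Rightarrow> 'v::ab_group_add \<Rightarrow> 'v) \<Rightarrow> 'v set \<Rightarrow>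
   'u \<Rightarrow> 'v \<Rightarrow> ('k, 'u, 'v) tensor"
  where "pure_tensor s U s' V u v = (\<lambda>\<beta>. if bilinear_on s U s' V (*) \<beta> then \<beta> u v else 0)"

definition tensor_space ::
  "('k::field \<Rightarrow> 'u::ab_group_add \<Rightarrow> 'u) \<Rightarrow> 'u set \<Rightarrow> ('k \<Rightarrow> 'v::ab_group_add \<Rightarrow> 'v) \<Rightarrow> 'v set \<Rightarrow>
   ('k, 'u, 'v) tensor set"
  where "tensor_space s U s' V = module.span fscale {pure_tensor s U s' V u v |u v. u \<in> U \<and> v \<in> V}"

definition tensor_flip :: "('k, 'v, 'v) tensor \<Rightarrow> ('k, 'v, 'v) tensor"
  where "tensor_flip T = (\<lambda>\<beta>. T (\<lambda>x y. \<beta> y x))"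

text \<open>\<open>f \<otimes> g\<close> on \<open>V \<otimes> V\<close> for endomorphisms \<open>f\<close>, \<open>g\<close> of \<open>V\<close>.\<close>

definition tensor_map ::
  "('k::field \<Rightarrow> 'v::ab_group_add \<Rightarrow> 'v) \<Rightarrow> 'v set \<Rightarrow> ('v \<Rightarrow> 'v) \<Rightarrow> ('v \<Rightarrow> 'v) \<Rightarrow>
   ('k, 'v, 'v) tensor \<Rightarrow> ('k, 'v, 'v) tensor"
  where "tensor_map s V f g T =
    (\<lambda>\<beta>. if bilinear_on s V s V (*) \<beta> then T (\<lambda>x y. \<beta> (f x) (g y)) else 0)"

text \<open>\<open>id \<otimes> D\<close>, \<open>D \<otimes> id\<close> for \<open>D : V \<rightarrow> V \<otimes> V\<close>, and \<open>\<tau> \<otimes> id\<close>.\<close>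

definition id_tensor_cop ::
  "('k::field \<Rightarrow> 'v::ab_group_add \<Rightarrow> 'v) \<Rightarrow> 'v set \<Rightarrow> ('v \<Rightarrow> ('k, 'v, 'v) tensor) \<Rightarrow>
   ('k, 'v, 'v) tensor \<Rightarrow> ('k, 'v) tensor3"
  where "id_tensor_cop s V D T =
    (\<lambda>\<gamma>. if trilinear_form s V \<gamma> then T (\<lambda>x y. D y (\<lambda>u v. \<gamma> x u v)) else 0)"

definition cop_tensor_id ::
  "('k::field \<Rightarrow> 'v::ab_group_add \<Rightarrow> 'v) \<Rightarrow> 'v set \<Rightarrow> ('v \<Rightarrow> ('k, 'v, 'v) tensor) \<Rightarrow>
   ('k, 'v, 'v) tensor \<Rightarrow> ('k, 'v) tensor3"
  where "cop_tensor_id s V D T =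
    (\<lambda>\<gamma>. if trilinear_form s V \<gamma> then T (\<lambda>x y. D x (\<lambda>u v. \<gamma> u v y)) else 0)"

definition flip_tensor_id :: "('k, 'v) tensor3 \<Rightarrow> ('k, 'v) tensor3"
  where "flip_tensor_id T = (\<lambda>\<gamma>. T (\<lambda>x y z. \<gamma> y x z))"


section \<open>Novikov bialgebras\<close>

definition novikov_algebra ::
  "('k::field \<Rightarrow> 'a::ab_group_add \<Rightarrow> 'a) \<Rightarrow> ('a \<Rightarrow> 'a \<Rightarrow> 'a) \<Rightarrow> bool"
  where "novikov_algebra s circ \<longleftrightarrow>
    vector_space s \<and> bilinear_on s UNIV s UNIV s circ \<and>
    (\<forall>a b c. circ (circ a b) c - circ a (circ b c) = circ (circ b a) c - circ b (circ a c)) \<and>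
    (\<forall>a b c. circ (circ a b) c = circ (circ a c) b)"

definition novikov_coalgebra ::
  "('k::field \<Rightarrow> 'a::ab_group_add \<Rightarrow> 'a) \<Rightarrow> ('a \<Rightarrow> ('k, 'a, 'a) tensor) \<Rightarrow> bool"
  where "novikov_coalgebra s D \<longleftrightarrow>
    vector_space s \<and> linear_on s UNIV fscale D \<and> (\<forall>a. D a \<in> tensor_space s UNIV s UNIV) \<and>
    (\<forall>a. id_tensor_cop s UNIV D (D a) - flip_tensor_id (id_tensor_cop s UNIV D (D a)) =
         cop_tensor_id s UNIV D (D a) - flip_tensor_id (cop_tensor_id s UNIV D (D a))) \<and>
    (\<forall>a. flip_tensor_id (id_tensor_cop s UNIV D (tensor_flip (D a))) = cop_tensor_id s UNIV D (D a))"

definition novikov_bialgebra ::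
  "('k::field \<Rightarrow> 'a::ab_group_add \<Rightarrow> 'a) \<Rightarrow> ('a \<Rightarrow> 'a \<Rightarrow> 'a) \<Rightarrow> ('a \<Rightarrow> ('k, 'a, 'a) tensor) \<Rightarrow> bool"
  where "novikov_bialgebra s circ D \<longleftrightarrow>
    novikov_algebra s circ \<and> novikov_coalgebra s D \<and>
    (let R = (\<lambda>a b. circ b a);
         Lstar = (\<lambda>a b. circ a b + circ b a);
         tm = tensor_map s UNIV
     in
      (\<forall>a b. D (circ a b) =
         tm (R b) id (D a) + tm id (Lstar a) (D b + tensor_flip (D b))) \<and>
      (\<forall>a b. tm (Lstar a) id (D b) - tm id (Lstar a) (tensor_flip (D b)) =
         tm (Lstar b) id (D a) - tm id (Lstar b) (tensor_flip (D a))) \<and>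
      (\<forall>a b. tm id (R a) (D b + tensor_flip (D b)) - tm (R a) id (D b + tensor_flip (D b)) =
         tm id (R b) (D a + tensor_flip (D a)) - tm (R b) id (D a + tensor_flip (D a))))"


section \<open>Graded spaces and completed tensor products\<close>

text \<open>\<open>V\<close> is the internal direct sum of the subspaces \<open>G i\<close>.\<close>

definition graded_space ::
  "('k::field \<Rightarrow> 'v::ab_group_add \<Rightarrow> 'v) \<Rightarrow> 'v set \<Rightarrow> (int \<Rightarrow> 'v set) \<Rightarrow> bool"
  where "graded_space s V G \<longleftrightarrow>
    vector_space s \<and> (\<forall>i. module.subspace s (G i)) \<and> V = module.span s (\<Union>i. G i) \<and>
    (\<forall>i. G i \<inter> module.span s (\<Union>j\<in>-{i}. G j) = {0})"

definition graded_part ::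
  "('k::field \<Rightarrow> 'v::ab_group_add \<Rightarrow> 'v) \<Rightarrow> (int \<Rightarrow> 'v set) \<Rightarrow> int \<Rightarrow> 'v \<Rightarrow> 'v"
  where "graded_part s G i x = (THE y. y \<in> G i \<and> x - y \<in> module.span s (\<Union>j\<in>-{i}. G j))"

text \<open>An element of the completed tensor square is the family of its components in bidegrees
  \<open>(i, j)\<close>; \<open>V\<^sub>i \<otimes> V\<^sub>j\<close> is regarded as a subspace of \<open>V \<otimes> V\<close>.\<close>

type_synonym ('k, 'v) ctensor = "int \<Rightarrow> int \<Rightarrow> ('k, 'v, 'v) tensor"
type_synonym ('k, 'v) ctensor3 = "int \<Rightarrow> int \<Rightarrow> int \<Rightarrow> ('k, 'v) tensor3"

definition completed_square ::
  "('k::field \<Rightarrow> 'v::ab_group_add \<Rightarrow> 'v) \<Rightarrow> 'v set \<Rightarrow> (int \<Rightarrow> 'v set) \<Rightarrow> ('k, 'v) ctensor set"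
  where "completed_square s V G =
    {T. \<forall>i j. T i j \<in> module.span fscale {pure_tensor s V s V x y |x y. x \<in> G i \<and> y \<in> G j}}"

definition cscale :: "'k::field \<Rightarrow> ('k, 'v) ctensor \<Rightarrow> ('k, 'v) ctensor"
  where "cscale c T = (\<lambda>i j. fscale c (T i j))"

definition cflip :: "('k, 'v) ctensor \<Rightarrow> ('k, 'v) ctensor"
  where "cflip T = (\<lambda>i j. tensor_flip (T j i))"

definition cflip_id :: "('k, 'v) ctensor3 \<Rightarrow> ('k, 'v) ctensor3"
  where "cflip_id T = (\<lambda>i j k. flip_tensor_id (T j i k))"

text \<open>The maps \<open>f \<otimes> id\<close>, \<open>id \<otimes> f\<close>, \<open>id \<otimes> \<delta>\<close>, \<open>\<delta> \<otimes> id\<close> on completed tensors.  The function with suffix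
  \<open>_term\<close> gives, for a fixed target multidegree, the contribution of the component of \<open>T\<close> whose
  degree in the tensor factor acted upon is \<open>q\<close>.  The map is well defined at \<open>T\<close> if
  for every multidegree only finitely many \<open>q\<close> contribute; this is made part of the structures
  below that use these maps.\<close>

definition finitely_many :: "('i \<Rightarrow> 'x::zero) \<Rightarrow> bool"
  where "finitely_many t \<longleftrightarrow> finite {q. t q \<noteq> 0}"

definition cmap_id_term where
  "cmap_id_term s V G f T i j q = tensor_map s V (\<lambda>x. graded_part s G i (f x)) id (T q j)"

definition cid_map_term where
  "cid_map_term s V G f T i j q = tensor_map s V id (\<lambda>y. graded_part s G j (f y)) (T i q)"

definition cid_cop_term where
  "cid_cop_term s V \<delta> T i j k q = id_tensor_cop s V (\<lambda>y. \<delta> y j k) (T i q)"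

definition ccop_id_term where
  "ccop_id_term s V \<delta> T i j k q = cop_tensor_id s V (\<lambda>x. \<delta> x i j) (T q k)"

definition cmap_id ::
  "('k::field \<Rightarrow> 'v::ab_group_add \<Rightarrow> 'v) \<Rightarrow> 'v set \<Rightarrow> (int \<Rightarrow> 'v set) \<Rightarrow> ('v \<Rightarrow> 'v) \<Rightarrow>
   ('k, 'v) ctensor \<Rightarrow> ('k, 'v) ctensor"
  where "cmap_id s V G f T = (\<lambda>i j. Sum_any (cmap_id_term s V G f T i j))"

definition cid_map ::
  "('k::field \<Rightarrow> 'v::ab_group_add \<Rightarrow> 'v) \<Rightarrow> 'v set \<Rightarrow> (int \<Rightarrow> 'v set) \<Rightarrow> ('v \<Rightarrow> 'v) \<Rightarrow>
   ('k, 'v) ctensor \<Rightarrow> ('k, 'v) ctensor"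
  where "cid_map s V G f T = (\<lambda>i j. Sum_any (cid_map_term s V G f T i j))"

definition cid_cop ::
  "('k::field \<Rightarrow> 'v::ab_group_add \<Rightarrow> 'v) \<Rightarrow> 'v set \<Rightarrow> ('v \<Rightarrow> ('k, 'v) ctensor) \<Rightarrow>
   ('k, 'v) ctensor \<Rightarrow> ('k, 'v) ctensor3"
  where "cid_cop s V \<delta> T = (\<lambda>i j k. Sum_any (cid_cop_term s V \<delta> T i j k))"

definition ccop_id ::
  "('k::field \<Rightarrow> 'v::ab_group_add \<Rightarrow> 'v) \<Rightarrow> 'v set \<Rightarrow> ('v \<Rightarrow> ('k, 'v) ctensor) \<Rightarrow>
   ('k, 'v) ctensor \<Rightarrow> ('k, 'v) ctensor3"
  where "ccop_id s V \<delta> T = (\<lambda>i j k. Sum_any (ccop_id_term s V \<delta> T i j k))"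


section \<open>Completed Lie bialgebras\<close>

definition lie_algebra_on ::
  "('k::field \<Rightarrow> 'v::ab_group_add \<Rightarrow> 'v) \<Rightarrow> 'v set \<Rightarrow> ('v \<Rightarrow> 'v \<Rightarrow> 'v) \<Rightarrow> bool"
  where "lie_algebra_on s L br \<longleftrightarrow>
    vector_space s \<and> module.subspace s L \<and>
    (\<forall>x\<in>L. \<forall>y\<in>L. br x y \<in> L) \<and> bilinear_on s L s L s br \<and>
    (\<forall>x\<in>L. br x x = 0) \<and>
    (\<forall>x\<in>L. \<forall>y\<in>L. \<forall>z\<in>L. br x (br y z) + br y (br z x) + br z (br x y) = 0)"

definition completed_lie_coalgebra ::
  "('k::field \<Rightarrow> 'v::ab_group_add \<Rightarrow> 'v) \<Rightarrow> 'v set \<Rightarrow> (int \<Rightarrow> 'v set) \<Rightarrow>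
   ('v \<Rightarrow> ('k, 'v) ctensor) \<Rightarrow> bool"
  where "completed_lie_coalgebra s L G \<delta> \<longleftrightarrow>
    graded_space s L G \<and>
    linear_on s L cscale \<delta> \<and> (\<forall>x\<in>L. \<delta> x \<in> completed_square s L G) \<and>
    (\<forall>x\<in>L. \<forall>i j k. finitely_many (cid_cop_term s L \<delta> (\<delta> x) i j k) \<and>
                   finitely_many (ccop_id_term s L \<delta> (\<delta> x) i j k)) \<and>
    (\<forall>x\<in>L. \<delta> x = - cflip (\<delta> x)) \<and>
    (\<forall>x\<in>L. cid_cop s L \<delta> (\<delta> x) - cflip_id (cid_cop s L \<delta> (\<delta> x)) = ccop_id s L \<delta> (\<delta> x))"

definition completed_lie_bialgebra ::
  "('k::field \<Rightarrow> 'v::ab_group_add \<Rightarrow> 'v) \<Rightarrow> 'v set \<Rightarrow> (int \<Rightarrow> 'v set) \<Rightarrow>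
   ('v \<Rightarrow> 'v \<Rightarrow> 'v) \<Rightarrow> ('v \<Rightarrow> ('k, 'v) ctensor) \<Rightarrow> bool"
  where "completed_lie_bialgebra s L G br \<delta> \<longleftrightarrow>
    lie_algebra_on s L br \<and> completed_lie_coalgebra s L G \<delta> \<and>
    (\<forall>a\<in>L. \<forall>b\<in>L. \<forall>i j. finitely_many (cmap_id_term s L G (br a) (\<delta> b) i j) \<and>
                        finitely_many (cid_map_term s L G (br a) (\<delta> b) i j)) \<and>
    (\<forall>a\<in>L. \<forall>b\<in>L. \<delta> (br a b) =
       (cmap_id s L G (br a) (\<delta> b) + cid_map s L G (br a) (\<delta> b)) -
       (cmap_id s L G (br b) (\<delta> a) + cid_map s L G (br b) (\<delta> a)))"


section \<open>Quadratic graded right Novikov algebras\<close>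

definition right_novikov_algebra ::
  "('k::field \<Rightarrow> 'b::ab_group_add \<Rightarrow> 'b) \<Rightarrow> ('b \<Rightarrow> 'b \<Rightarrow> 'b) \<Rightarrow> bool"
  where "right_novikov_algebra s dia \<longleftrightarrow>
    vector_space s \<and> bilinear_on s UNIV s UNIV s dia \<and>
    (\<forall>a b c. dia (dia a b) c - dia a (dia b c) = dia (dia a c) b - dia a (dia c b)) \<and>
    (\<forall>a b c. dia a (dia b c) = dia b (dia a c))"

definition graded_right_novikov_algebra ::
  "('k::field \<Rightarrow> 'b::ab_group_add \<Rightarrow> 'b) \<Rightarrow> (int \<Rightarrow> 'b set) \<Rightarrow> ('b \<Rightarrow> 'b \<Rightarrow> 'b) \<Rightarrow> bool"
  where "graded_right_novikov_algebra s G dia \<longleftrightarrow>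
    right_novikov_algebra s dia \<and> graded_space s UNIV G \<and>
    (\<forall>i. \<exists>S. finite S \<and> G i = module.span s S) \<and>
    (\<forall>i j. \<forall>x\<in>G i. \<forall>y\<in>G j. dia x y \<in> G (i + j))"

definition quadratic_graded_right_novikov_algebra ::
  "('k::field \<Rightarrow> 'b::ab_group_add \<Rightarrow> 'b) \<Rightarrow> (int \<Rightarrow> 'b set) \<Rightarrow> ('b \<Rightarrow> 'b \<Rightarrow> 'b) \<Rightarrow>
   ('b \<Rightarrow> 'b \<Rightarrow> 'k) \<Rightarrow> bool"
  where "quadratic_graded_right_novikov_algebra s G dia form \<longleftrightarrow>
    graded_right_novikov_algebra s G dia \<and>
    bilinear_on s UNIV s UNIV (*) form \<and>
    (\<forall>a b. form a b = form b a) \<and>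
    (\<forall>a. (\<forall>b. form a b = 0) \<longrightarrow> a = 0) \<and>
    (\<exists>m. \<forall>i j. i + j + m \<noteq> 0 \<longrightarrow> (\<forall>x\<in>G i. \<forall>y\<in>G j. form x y = 0)) \<and>
    (\<forall>a b c. form (dia a b) c = - form a (dia b c + dia c b))"

text \<open>The pairing of a completed tensor with \<open>b \<otimes> c\<close>; for a graded form only finitely many
  bidegrees contribute.\<close>

definition cpairing ::
  "('b \<Rightarrow> 'b \<Rightarrow> 'k::field) \<Rightarrow> ('k, 'b) ctensor \<Rightarrow> 'b \<Rightarrow> 'b \<Rightarrow> 'k"
  where "cpairing form T b c = Sum_any (\<lambda>(i, j). T i j (\<lambda>x y. form x b * form y c))"

text \<open>\<open>B\<close> is \<open>k[t, 1/t]\<close> (finitely supported functions on the integers, with \<open>single i 1\<close> as \<open>t\<^sup>i\<close>),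
  up to an identification \<open>\<phi>\<close> of the two spaces, with
  \<open>B\<^sub>i = k t\<^sup>i\<^sup>+\<^sup>1\<close>, \<open>t\<^sup>i \<diamond> t\<^sup>j = i t\<^sup>i\<^sup>+\<^sup>j\<^sup>-\<^sup>1\<close> and \<open>(t\<^sup>i, t\<^sup>j) = 1\<close> or \<open>0\<close> as \<open>i + j + 1\<close> is \<open>0\<close> or not.\<close>

definition is_laurent_algebra ::
  "('k::field \<Rightarrow> 'b::ab_group_add \<Rightarrow> 'b) \<Rightarrow> (int \<Rightarrow> 'b set) \<Rightarrow> ('b \<Rightarrow> 'b \<Rightarrow> 'b) \<Rightarrow>
   ('b \<Rightarrow> 'b \<Rightarrow> 'k) \<Rightarrow> bool"
  where "is_laurent_algebra s G dia form \<longleftrightarrow>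
    (\<exists>\<phi> :: (int \<Rightarrow>\<^sub>0 'k) \<Rightarrow> 'b.
      linear_on (\<lambda>c. Poly_Mapping.map ((*) c)) UNIV s \<phi> \<and> bij \<phi> \<and>
      (let t = (\<lambda>i. \<phi> (Poly_Mapping.single i 1)) in
        (\<forall>i. G i = module.span s {t (i + 1)}) \<and>
        (\<forall>i j. dia (t i) (t j) = s (of_int i) (t (i + j - 1))) \<and>
        (\<forall>i j. form (t i) (t j) = (if i + j + 1 = 0 then 1 else 0))))"


section \<open>The tensor product of the two algebras\<close>

abbreviation aff_tensor ::
  "('k::field \<Rightarrow> 'a::ab_group_add \<Rightarrow> 'a) \<Rightarrow> ('k \<Rightarrow> 'b::ab_group_add \<Rightarrow> 'b) \<Rightarrow>
   'a \<Rightarrow> 'b \<Rightarrow> ('k, 'a, 'b) tensor"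
  where "aff_tensor sA sB \<equiv> pure_tensor sA UNIV sB UNIV"

abbreviation aff_space ::
  "('k::field \<Rightarrow> 'a::ab_group_add \<Rightarrow> 'a) \<Rightarrow> ('k \<Rightarrow> 'b::ab_group_add \<Rightarrow> 'b) \<Rightarrow> ('k, 'a, 'b) tensor set"
  where "aff_space sA sB \<equiv> tensor_space sA UNIV sB UNIV"

definition aff_grading ::
  "('k::field \<Rightarrow> 'a::ab_group_add \<Rightarrow> 'a) \<Rightarrow> ('k \<Rightarrow> 'b::ab_group_add \<Rightarrow> 'b) \<Rightarrow> (int \<Rightarrow> 'b set) \<Rightarrow>
   int \<Rightarrow> ('k, 'a, 'b) tensor set"
  where "aff_grading sA sB G i = module.span fscale {aff_tensor sA sB a b |a b. b \<in> G i}"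

text \<open>\<open>P \<bullet> Q\<close> for \<open>P \<in> A \<otimes> A\<close> and \<open>Q\<close> in the completed tensor square of \<open>B\<close>.\<close>

definition bullet ::
  "('k::field \<Rightarrow> 'a::ab_group_add \<Rightarrow> 'a) \<Rightarrow> ('k \<Rightarrow> 'b::ab_group_add \<Rightarrow> 'b) \<Rightarrow>
   ('k, 'a, 'a) tensor \<Rightarrow> ('k, 'b) ctensor \<Rightarrow> ('k, ('k, 'a, 'b) tensor) ctensor"
  where "bullet sA sB P Q = (\<lambda>i j \<beta>.
    if bilinear_on fscale (aff_space sA sB) fscale (aff_space sA sB) (*) \<beta>
    then P (\<lambda>a\<^sub>1 a\<^sub>2. Q i j (\<lambda>b\<^sub>1 b\<^sub>2. \<beta> (aff_tensor sA sB a\<^sub>1 b\<^sub>1) (aff_tensor sA sB a\<^sub>2 b\<^sub>2)))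
    else 0)"


section \<open>Universal property of the tensor product, and the operations on pure tensors\<close>

lemma vector_space_fscale: "vector_space (fscale :: 'k::field \<Rightarrow> ('x \<Rightarrow> 'k) \<Rightarrow> _)"
  by unfold_locales (auto simp: fscale_def fun_eq_iff algebra_simps)

lemma vector_space_mult: "vector_space ((*) :: 'k::field \<Rightarrow> 'k \<Rightarrow> 'k)"
  by unfold_locales (auto simp: algebra_simps)

lemma module_fscale: "module (fscale :: 'k::field \<Rightarrow> ('x \<Rightarrow> 'k) \<Rightarrow> _)"
  using vector_space_fscale by (simp add: module_iff_vector_space)

lemma pure_tensor_bilinear:
  "bilinear_on s U s' V fscale (pure_tensor s U s' V)"
  unfolding bilinear_on_def linear_on_def pure_tensor_def fscale_def fun_eq_iff plus_fun_def
  by (auto simp: bilinear_on_def linear_on_def)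

lemma separating_functional:
  fixes s :: "'k::field \<Rightarrow> 'w::ab_group_add \<Rightarrow> 'w"
  assumes "vector_space s" "w \<noteq> 0"
  obtains f where "linear_on s UNIV (*) f" "f w \<noteq> 0"
proof -
  interpret vector_space_pair s "(*) :: 'k \<Rightarrow> 'k \<Rightarrow> 'k"
    by (intro vector_space_pair.intro assms vector_space_mult)
  have "vs1.independent {w}" using assms(2) by (simp add: vs1.dependent_single)
  then obtain g where g: "Vector_Spaces.linear s (*) g" "g w = 1"
    using linear_independent_extend[of "{w}" "\<lambda>_. 1"] by auto
  show thesis
    using g by (intro that[of g]) (auto simp: linear_on_def linear_add linear_scale)
qed

theorem tensor_space_universal:
  fixes s'' :: "'k::field \<Rightarrow> 'w::ab_group_add \<Rightarrow> 'w"
  assumes W: "vector_space s''" and f: "bilinear_on s U s' V s'' f"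
  shows "\<exists>F. linear_on fscale (tensor_space s U s' V) s'' F \<and>
             (\<forall>u\<in>U. \<forall>v\<in>V. F (pure_tensor s U s' V u v) = f u v)"
proof -
  interpret F: module "fscale :: 'k \<Rightarrow> (('a \<Rightarrow> 'b \<Rightarrow> 'k) \<Rightarrow> 'k) \<Rightarrow> _" by (rule module_fscale)
  interpret W: vector_space s'' by (rule W)
  define P where "P T w \<longleftrightarrow> (\<forall>\<phi>. linear_on s'' UNIV (*) \<phi> \<longrightarrow> T (\<lambda>u v. \<phi> (f u v)) = \<phi> w)" for T w
  have gen: "P (pure_tensor s U s' V u v) (f u v)" for u v
    using f unfolding P_def pure_tensor_def by (auto simp: bilinear_on_def linear_on_def)
  have add: "P T w \<Longrightarrow> P T' w' \<Longrightarrow> P (T + T') (w + w')" for T T' w w'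
    by (auto simp: P_def linear_on_def)
  have scl: "P T w \<Longrightarrow> P (fscale c T) (s'' c w)" for T w c
    by (auto simp: P_def linear_on_def fscale_def)
  have zero: "P 0 0"
    unfolding P_def linear_on_def by (metis W.scale_zero_left mult_zero_left zero_fun_def UNIV_I)
  have uniq: "w = w'" if "P T w" "P T w'" for T w w'
  proof (rule ccontr)
    assume "w \<noteq> w'"
    then obtain \<phi> where \<phi>: "linear_on s'' UNIV (*) \<phi>" "\<phi> (w - w') \<noteq> 0"
      using separating_functional[OF W, of "w - w'"] by auto
    have "\<phi> w = \<phi> ((w - w') + w')" by simp
    also have "\<dots> = \<phi> (w - w') + \<phi> w'" using \<phi>(1) unfolding linear_on_def by blast
    finally show False using that \<phi> by (auto simp: P_def)
  qed
  have ex: "\<exists>w. P T w" if "T \<in> tensor_space s U s' V" for T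
    using that unfolding tensor_space_def
  proof (induction rule: F.span_induct_alt)
    case base
    then show ?case using zero by blast
  next
    case (step c x y)
    then show ?case using add scl gen by blast
  qed
  define F where "F T = (THE w. P T w)" for T
  have FI: "F T = w" if "P T w" for T w
    unfolding F_def using that uniq by blast
  have PF: "P T (F T)" if "T \<in> tensor_space s U s' V" for T
    using ex[OF that] FI by blast
  show ?thesis
  proof (intro exI conjI)
    show "linear_on fscale (tensor_space s U s' V) s'' F"
      unfolding linear_on_def using PF FI add scl by blast
    show "\<forall>u\<in>U. \<forall>v\<in>V. F (pure_tensor s U s' V u v) = f u v"
      using gen FI by blast
  qed
qed

theorem tensor_space_unique:
  fixes s'' :: "'k::field \<Rightarrow> 'w::ab_group_add \<Rightarrow> 'w"
  assumes W: "vector_space s''"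
    and F: "linear_on fscale (tensor_space s U s' V) s'' F"
    and F': "linear_on fscale (tensor_space s U s' V) s'' F'"
    and eq: "\<And>u v. u \<in> U \<Longrightarrow> v \<in> V \<Longrightarrow> F (pure_tensor s U s' V u v) = F' (pure_tensor s U s' V u v)"
    and T: "T \<in> tensor_space s U s' V"
  shows "F T = F' T"
proof -
  interpret T: module "fscale :: 'k \<Rightarrow> (('a \<Rightarrow> 'b \<Rightarrow> 'k) \<Rightarrow> 'k) \<Rightarrow> _" by (rule module_fscale)
  interpret W: vector_space s'' by (rule W)
  have "T \<in> tensor_space s U s' V \<and> F T = F' T"
    using T unfolding tensor_space_def
  proof (induction rule: T.span_induct_alt)
    case base
    have z: "0 \<in> tensor_space s U s' V"
      unfolding tensor_space_def by (rule T.span_zero)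
    have "G 0 = 0" if "linear_on fscale (tensor_space s U s' V) s'' G" for G
    proof -
      have "G (fscale 0 0) = s'' 0 (G 0)" using that z unfolding linear_on_def by blast
      then show ?thesis by simp
    qed
    from this[OF F] this[OF F'] have "F 0 = F' 0" by (rule trans[OF _ sym])
    with z show ?case unfolding tensor_space_def by (rule conjI)
  next
    case (step c x y)
    then obtain u v where uv: "u \<in> U" "v \<in> V" "x = pure_tensor s U s' V u v" by blast
    have x: "x \<in> tensor_space s U s' V" using step(1) unfolding tensor_space_def by (rule T.span_base)
    have cx: "fscale c x \<in> tensor_space s U s' V"
      using x unfolding tensor_space_def by (rule T.span_scale)
    have y: "y \<in> tensor_space s U s' V" "F y = F' y" using step(2) by (auto simp: tensor_space_def)
    have m: "fscale c x + y \<in> tensor_space s U s' V"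
      using cx y(1) unfolding tensor_space_def by (rule T.span_add)
    have "G (fscale c x + y) = s'' c (G x) + G y"
      if "linear_on fscale (tensor_space s U s' V) s'' G" for G
      
    proof -
      have "G (fscale c x + y) = G (fscale c x) + G y"
        using that cx y(1) unfolding linear_on_def by blast
      also have "G (fscale c x) = s'' c (G x)"
        using that x unfolding linear_on_def by blast
      finally show ?thesis .
    qed
    from this[OF F] this[OF F'] have "F (fscale c x + y) = F' (fscale c x + y)"
      unfolding y(2) uv(3) eq[OF uv(1,2)] by (rule trans[OF _ sym])
    with m show ?case unfolding tensor_space_def by (rule conjI)
  qed
  then show ?thesis by blast
qed

lemma tensor_flip_pure:
  "tensor_flip (pure_tensor s V s V x y) = pure_tensor s V s V y x"
  by (auto simp: tensor_flip_def pure_tensor_def bilinear_on_def fun_eq_iff)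

lemma tensor_map_pure:
  assumes "linear_on s V s f" "linear_on s V s g" "f ` V \<subseteq> V" "g ` V \<subseteq> V"
  shows "tensor_map s V f g (pure_tensor s V s V x y) = pure_tensor s V s V (f x) (g y)"
proof -
  have "bilinear_on s V s V (*) (\<lambda>x y. \<beta> (f x) (g y))" if "bilinear_on s V s V (*) \<beta>" for \<beta>
    using that assms unfolding bilinear_on_def linear_on_def by (auto simp: image_subset_iff)
  then show ?thesis by (auto simp: tensor_map_def pure_tensor_def fun_eq_iff)
qed

end

theory Submission
  imports Defs
begin

text \<open>The idea is to dualise everything.  Write \<open>A\<^sup>*\<close> for the dual space of \<open>A\<close>, let \<open>\<phi> \<psi>\<close> be the product
  on \<open>A\<^sup>*\<close> transposed to the coproduct of \<open>A\<close>, and let \<open>\<phi> \<otimes> c\<close> act on \<open>L = A \<otimes> B\<close> by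
  \<open>a \<otimes> b \<mapsto> \<phi> a (b, c)\<close>.  The definition of \<open>\<Delta>\<^sub>B\<close> says exactly that \<open>\<delta>\<close> is the transpose of the bracket
  \<open>[\<phi> \<otimes> c, \<psi> \<otimes> d] = \<phi> \<psi> \<otimes> c \<diamond> d - \<psi> \<phi> \<otimes> d \<diamond> c\<close> of \<open>A\<^sup>* \<otimes> B\<close> (\<open>cobracket_eval\<close>).  The homogeneous functionals
  \<open>\<phi> \<otimes> c\<close> with \<open>c \<in> B\<^bsub>-m-i\<^esub>\<close>, where \<open>m\<close> is the degree of the form, contain the coordinates of the
  finite-dimensional space \<open>L\<^sub>i\<close> (\<open>frame_L\<close>).  So an identity between completed tensors can be tested, one
  multidegree at a time, on products of such functionals (\<open>L2_eq_zero\<close>, \<open>L3_eq_zero\<close>), and for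
  homogeneous elements this leaves a single degree in each of the sums over degrees.

  This translates the three parts of the definition of a completed Lie bialgebra into scalar
  identities (\<open>lie_bialgebra_iff\<close>).

  \<^item> The Jacobi identity of \<open>L\<close> is that of \<open>A \<otimes> B\<close>, and the co-Jacobi identity of \<open>\<delta>\<close> is the
    Jacobi identity of \<open>A\<^sup>* \<otimes> B\<close>.  The tensor product of a Novikov algebra and a right Novikov algebra is
    a Lie algebra (\<open>novikov_jacobi\<close>), and \<open>A\<^sup>*\<close> is a Novikov algebra if and only if \<open>A\<close> is a Novikov
    coalgebra (\<open>novikov_coalgebra_iff\<close>).

  \<^item> The cocycle condition becomes an identity between four-fold forms on \<open>B\<close> with coefficients
    depending on two elements and two functionals of \<open>A\<close>.  By invariance every such form is a
    combination of the values \<open>(v, u \<diamond> (w \<diamond> z))\<close>, which are symmetric in \<open>u, w\<close> and in \<open>v, z\<close>.  Four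
    elements of \<open>B\<close> therefore give only six values, and the coefficients of these six are the defects
    in the three compatibility conditions of a Novikov bialgebra (\<open>cocycle_defect_tp\<close>).  Hence the
    cocycle condition holds when all the defects vanish.

  For Laurent polynomials all the forms involved are polynomials in the exponents, the value
  \<open>(v, u \<diamond> (w \<diamond> z))\<close> at powers of \<open>t\<close> being the product of the exponents of \<open>u\<close> and \<open>w\<close>.  A few choices of
  exponents then isolate every coefficient up to a factor \<open>2\<close>, which gives the converse
  (\<open>laurent_jacobi_novikov\<close>, \<open>lie_bialgebra_imp_bialgebra\<close>).\<close>

interpretation fun_space: vector_space "fscale :: 'k::field \<Rightarrow> ('x \<Rightarrow> 'k) \<Rightarrow> ('x \<Rightarrow> 'k)"
  by (rule vector_space_fscale)

lemma fscale_apply: "fscale c f x = c * f x"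
  by (simp add: fscale_def)

section \<open>Linear maps on subspaces\<close>

lemma linear_onI:
  assumes "\<And>x y. x \<in> U \<Longrightarrow> y \<in> U \<Longrightarrow> f (x + y) = f x + f y"
    and "\<And>c x. x \<in> U \<Longrightarrow> f (s c x) = s' c (f x)"
  shows "linear_on s U s' f"
  using assms by (simp add: linear_on_def)

lemma linear_onD_add: "linear_on s U s' f \<Longrightarrow> x \<in> U \<Longrightarrow> y \<in> U \<Longrightarrow> f (x + y) = f x + f y"
  by (simp add: linear_on_def)

lemma linear_onD_scale: "linear_on s U s' f \<Longrightarrow> x \<in> U \<Longrightarrow> f (s c x) = s' c (f x)"
  by (simp add: linear_on_def)

lemma linear_on_zero:
  assumes "linear_on s U s' f" "0 \<in> U"
  shows "f 0 = 0"
  using linear_onD_add[OF assms(1) assms(2) assms(2)] by simp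

lemma linear_onD_diff:
  assumes "linear_on s U s' f" "x \<in> U" "y \<in> U" "x - y \<in> U"
  shows "f (x - y) = f x - f y"
  using linear_onD_add[OF assms(1) assms(4,3)] by simp

lemma bilinear_onD:
  assumes "bilinear_on s U s' V s'' f"
  shows "v \<in> V \<Longrightarrow> linear_on s U s'' (\<lambda>u. f u v)" "u \<in> U \<Longrightarrow> linear_on s' V s'' (f u)"
  using assms by (auto simp: bilinear_on_def)

lemma linear_on_span_eq:
  assumes s: "module s" and f: "linear_on s U s' f" and g: "linear_on s U s' g"
    and s': "module s'"
    and U: "U = module.span s S" and eq: "\<And>x. x \<in> S \<Longrightarrow> f x = g x" and x: "x \<in> U"
  shows "f x = g x"
proof -
  interpret s: module s by (rule s)
  have U0: "0 \<in> U" unfolding U by (rule s.span_zero)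
  have "x \<in> U \<and> f x = g x" using x unfolding U
  proof (induction rule: s.span_induct_alt)
    case base
    show ?case using linear_on_zero[OF f U0] linear_on_zero[OF g U0] s.span_zero by metis
  next
    case (step c x y)
    have xU: "x \<in> U" and yU: "y \<in> U" and sU: "s c x \<in> U"
      using step unfolding U by (auto intro: s.span_base s.span_scale)
    have "f (s c x + y) = g (s c x + y)"
      unfolding linear_onD_add[OF f sU yU] linear_onD_add[OF g sU yU]
        linear_onD_scale[OF f xU] linear_onD_scale[OF g xU] using step eq by simp
    then show ?case using sU yU unfolding U by (auto intro: s.span_add)
  qed
  then show ?thesis by simp
qed

lemma bilinear_on_prod:
  assumes "linear_on s U (*) f" "linear_on s' V (*) g"
  shows "bilinear_on s U s' V (*) (\<lambda>x y. f x * g y)"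
  using assms by (auto simp: bilinear_on_def linear_on_def algebra_simps)

lemma bilinear_on_swap:
  "bilinear_on s U s' V s'' f \<longleftrightarrow> bilinear_on s' V s U s'' (\<lambda>x y. f y x)"
  by (auto simp: bilinear_on_def)

lemma bilinear_on_add:
  assumes "bilinear_on s U s' V (*) f" "bilinear_on s U s' V (*) g"
  shows "bilinear_on s U s' V (*) (\<lambda>x y. f x y + g x y)"
  using assms by (auto simp: bilinear_on_def linear_on_def algebra_simps)

lemma bilinear_on_scale:
  assumes "bilinear_on s U s' V (*) f"
  shows "bilinear_on s U s' V (*) (\<lambda>x y. c * f x y)"
  using assms by (auto simp: bilinear_on_def linear_on_def algebra_simps)

lemma bilinear_on_diff:
  assumes "bilinear_on s U s' V (*) f" "bilinear_on s U s' V (*) g"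
  shows "bilinear_on s U s' V (*) (\<lambda>x y. f x y - g x y)"
  using assms by (auto simp: bilinear_on_def linear_on_def algebra_simps)

lemma bilinear_on_zero: "bilinear_on s U s' V (*) (\<lambda>x y. 0)"
  by (auto simp: bilinear_on_def linear_on_def)

lemma bilinear_on_comp:
  assumes "bilinear_on s U s' V (*) \<beta>"
    "linear_on t X s f" "f ` X \<subseteq> U" "linear_on t' Y s' g" "g ` Y \<subseteq> V"
  shows "bilinear_on t X t' Y (*) (\<lambda>x y. \<beta> (f x) (g y))"
  using assms unfolding bilinear_on_def linear_on_def by (auto simp: image_subset_iff)

lemma trilinear_form_iff:
  "trilinear_form s V f \<longleftrightarrow>
    (\<forall>x\<in>V. \<forall>y\<in>V. linear_on s V (*) (f x y)) \<and>
    (\<forall>x\<in>V. \<forall>z\<in>V. linear_on s V (*) (\<lambda>y. f x y z)) \<and>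
    (\<forall>y\<in>V. \<forall>z\<in>V. linear_on s V (*) (\<lambda>x. f x y z))"
  by (auto simp: trilinear_form_def bilinear_on_def)

lemma trilinear_form_prod:
  assumes "linear_on s V (*) f" "linear_on s V (*) g" "linear_on s V (*) h"
  shows "trilinear_form s V (\<lambda>x y z. f x * (g y * h z))"
  using assms by (auto simp: trilinear_form_iff linear_on_def algebra_simps)

lemma trilinear_form_mult:
  assumes "linear_on s V (*) f" "bilinear_on s V s V (*) \<beta>"
  shows "trilinear_form s V (\<lambda>x y z. f x * \<beta> y z)"
proof -
  have "bilinear_on s V s V (*) (\<lambda>y z. f x * \<beta> y z)" for x
    by (rule bilinear_on_scale[OF assms(2)])
  moreover have "linear_on s V (*) (\<lambda>x. f x * \<beta> y z)" for y z
    using assms(1) by (auto simp: linear_on_def algebra_simps)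
  ultimately show ?thesis unfolding trilinear_form_def by blast
qed

lemma trilinear_form_flip:
  "trilinear_form s V (\<lambda>x y z. \<gamma> y x z) \<longleftrightarrow> trilinear_form s V \<gamma>"
  by (auto simp: trilinear_form_iff)

section \<open>Tensors as functionals on forms\<close>

text \<open>The properties of an element of \<open>V \<otimes> W \<subseteq> U \<otimes> U'\<close>, as a functional on the bilinear forms on
  \<open>U \<times> U'\<close>, on which all the arguments rest: it is linear, and it depends only on the restriction
  of a form to \<open>V \<times> W\<close>.  Unlike membership in a span, these properties pass through the operations
  on tensors by direct substitution.\<close>

definition bitensor_on ::
  "('k::field \<Rightarrow> 'u::ab_group_add \<Rightarrow> 'u) \<Rightarrow> 'u set \<Rightarrow> ('k \<Rightarrow> 'v::ab_group_add \<Rightarrow> 'v) \<Rightarrow> 'v set \<Rightarrow>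
   'u set \<Rightarrow> 'v set \<Rightarrow> ('k, 'u, 'v) tensor \<Rightarrow> bool"
  where "bitensor_on s U s' U' V W T \<longleftrightarrow>
    (\<forall>\<beta>. \<not> bilinear_on s U s' U' (*) \<beta> \<longrightarrow> T \<beta> = 0) \<and>
    (\<forall>\<beta> \<beta>'. bilinear_on s U s' U' (*) \<beta> \<longrightarrow> bilinear_on s U s' U' (*) \<beta>' \<longrightarrow>
       T (\<lambda>x y. \<beta> x y + \<beta>' x y) = T \<beta> + T \<beta>') \<and>
    (\<forall>c \<beta>. bilinear_on s U s' U' (*) \<beta> \<longrightarrow> T (\<lambda>x y. c * \<beta> x y) = c * T \<beta>) \<and>
    (\<forall>\<beta>. bilinear_on s U s' U' (*) \<beta> \<longrightarrow> (\<forall>x\<in>V. \<forall>y\<in>W. \<beta> x y = 0) \<longrightarrow> T \<beta> = 0)"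

text \<open>The analogue for \<open>V \<otimes> W \<otimes> X \<subseteq> U \<otimes> U \<otimes> U\<close>.\<close>

definition tritensor_on ::
  "('k::field \<Rightarrow> 'v::ab_group_add \<Rightarrow> 'v) \<Rightarrow> 'v set \<Rightarrow> 'v set \<Rightarrow> 'v set \<Rightarrow> 'v set \<Rightarrow>
   ('k, 'v) tensor3 \<Rightarrow> bool"
  where "tritensor_on s U V W X T \<longleftrightarrow>
    (\<forall>\<gamma>. \<not> trilinear_form s U \<gamma> \<longrightarrow> T \<gamma> = 0) \<and>
    (\<forall>\<gamma> \<gamma>'. trilinear_form s U \<gamma> \<longrightarrow> trilinear_form s U \<gamma>' \<longrightarrow>
       T (\<lambda>x y z. \<gamma> x y z + \<gamma>' x y z) = T \<gamma> + T \<gamma>') \<and>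
    (\<forall>c \<gamma>. trilinear_form s U \<gamma> \<longrightarrow> T (\<lambda>x y z. c * \<gamma> x y z) = c * T \<gamma>) \<and>
    (\<forall>\<gamma>. trilinear_form s U \<gamma> \<longrightarrow> (\<forall>x\<in>V. \<forall>y\<in>W. \<forall>z\<in>X. \<gamma> x y z = 0) \<longrightarrow> T \<gamma> = 0)"

definition tensor_span ::
  "('k::field \<Rightarrow> 'u::ab_group_add \<Rightarrow> 'u) \<Rightarrow> 'u set \<Rightarrow> ('k \<Rightarrow> 'v::ab_group_add \<Rightarrow> 'v) \<Rightarrow> 'v set \<Rightarrow>
   'u set \<Rightarrow> 'v set \<Rightarrow> ('k, 'u, 'v) tensor set"
  where "tensor_span s U s' U' V W = fun_space.span {pure_tensor s U s' U' x y |x y. x \<in> V \<and> y \<in> W}"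

lemma tensor_span_induct [consumes 1, case_names zero step]:
  assumes "T \<in> tensor_span s U s' U' V W" and "P 0"
    and "\<And>c x y T. x \<in> V \<Longrightarrow> y \<in> W \<Longrightarrow> T \<in> tensor_span s U s' U' V W \<Longrightarrow> P T \<Longrightarrow>
           P (fscale c (pure_tensor s U s' U' x y) + T)"
  shows "P T"
proof -
  have "T \<in> tensor_span s U s' U' V W \<and> P T"
    using assms(1) unfolding tensor_span_def
  proof (induction rule: fun_space.span_induct_alt)
    case base
    show ?case by (intro conjI fun_space.span_zero assms(2))
  next
    case (step c x T)
    from step(1) obtain u v where uv: "u \<in> V" "v \<in> W" "x = pure_tensor s U s' U' u v" by blast
    have "fscale c x + T \<in> fun_space.span {pure_tensor s U s' U' x y |x y. x \<in> V \<and> y \<in> W}"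
      by (intro fun_space.span_add fun_space.span_scale fun_space.span_base[OF step(1)] step(2)[THEN conjunct1])
    moreover have "P (fscale c x + T)"
      using assms(3)[of u v T c] step uv unfolding tensor_span_def by simp
    ultimately show ?case by (rule conjI)
  qed
  then show ?thesis by blast
qed

lemma subspace_tensor_span: "fun_space.subspace (tensor_span s U s' U' V W)"
  unfolding tensor_span_def by (rule fun_space.subspace_span)

lemma pure_in_tensor_span:
  "x \<in> V \<Longrightarrow> y \<in> W \<Longrightarrow> pure_tensor s U s' U' x y \<in> tensor_span s U s' U' V W"
  unfolding tensor_span_def by (rule fun_space.span_base) blast

lemma tensor_space_eq: "tensor_space s U s' U' = tensor_span s U s' U' U U'"
  by (simp add: tensor_space_def tensor_span_def)

lemma bitensor_on_plus:
  "bitensor_on s U s' U' V W T \<Longrightarrow> bitensor_on s U s' U' V W T' \<Longrightarrow> bitensor_on s U s' U' V W (T + T')"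
  by (simp add: bitensor_on_def algebra_simps)

lemma bitensor_on_fscale:
  "bitensor_on s U s' U' V W T \<Longrightarrow> bitensor_on s U s' U' V W (fscale c T)"
  by (simp add: bitensor_on_def fscale_apply algebra_simps)

lemma bitensor_on_pure:
  assumes "x \<in> V" "y \<in> W"
  shows "bitensor_on s U s' U' V W (pure_tensor s U s' U' x y)"
  unfolding bitensor_on_def pure_tensor_def
  using assms by (simp add: bilinear_on_add bilinear_on_scale)

lemma tensor_span_bitensor:
  assumes "T \<in> tensor_span s U s' U' V W"
  shows "bitensor_on s U s' U' V W T"
  using assms
proof (induction rule: tensor_span_induct)
  case zero
  show ?case by (simp add: bitensor_on_def)
next
  case (step c x y T)
  show ?case
    by (intro bitensor_on_plus bitensor_on_fscale bitensor_on_pure step)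
qed

context
  fixes s U s' U' V W T
  assumes T: "bitensor_on s U s' U' V W T"
begin

lemma bitensor_nonbilinear: "\<not> bilinear_on s U s' U' (*) \<beta> \<Longrightarrow> T \<beta> = 0"
  by (rule T[unfolded bitensor_on_def, THEN conjunct1, rule_format])

lemma bitensor_add:
  "bilinear_on s U s' U' (*) \<beta> \<Longrightarrow> bilinear_on s U s' U' (*) \<beta>' \<Longrightarrow>
     T (\<lambda>x y. \<beta> x y + \<beta>' x y) = T \<beta> + T \<beta>'"
  by (rule T[unfolded bitensor_on_def, THEN conjunct2, THEN conjunct1, rule_format])

lemma bitensor_scale:
  "bilinear_on s U s' U' (*) \<beta> \<Longrightarrow> T (\<lambda>x y. c * \<beta> x y) = c * T \<beta>"
  by (rule T[unfolded bitensor_on_def, THEN conjunct2, THEN conjunct2, THEN conjunct1, rule_format])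

lemma bitensor_vanish:
  "bilinear_on s U s' U' (*) \<beta> \<Longrightarrow> (\<And>x y. x \<in> V \<Longrightarrow> y \<in> W \<Longrightarrow> \<beta> x y = 0) \<Longrightarrow> T \<beta> = 0"
  by (rule T[unfolded bitensor_on_def, THEN conjunct2, THEN conjunct2, THEN conjunct2, rule_format])

lemma bitensor_diff:
  assumes "bilinear_on s U s' U' (*) \<beta>" "bilinear_on s U s' U' (*) \<beta>'"
  shows "T (\<lambda>x y. \<beta> x y - \<beta>' x y) = T \<beta> - T \<beta>'"
  using bitensor_add[OF bilinear_on_diff[OF assms] assms(2)] by simp

lemma bitensor_cong:
  assumes "bilinear_on s U s' U' (*) \<beta>" "bilinear_on s U s' U' (*) \<beta>'"
    "\<And>x y. x \<in> V \<Longrightarrow> y \<in> W \<Longrightarrow> \<beta> x y = \<beta>' x y"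
  shows "T \<beta> = T \<beta>'"
  using bitensor_diff[OF assms(1,2)] bitensor_vanish[OF bilinear_on_diff[OF assms(1,2)]] assms(3)
  by simp

lemma bitensor_lincomb:
  assumes "\<And>z. z \<in> set zs \<Longrightarrow> bilinear_on s U s' U' (*) (B z)"
  shows "bilinear_on s U s' U' (*) (\<lambda>x y. \<Sum>z\<leftarrow>zs. c z * B z x y) \<and>
         T (\<lambda>x y. \<Sum>z\<leftarrow>zs. c z * B z x y) = (\<Sum>z\<leftarrow>zs. c z * T (B z))"
  using assms
proof (induction zs)
  case Nil
  then show ?case using bitensor_vanish[of "\<lambda>x y. 0"] by (simp add: bilinear_on_zero)
next
  case (Cons z zs)
  have 1: "bilinear_on s U s' U' (*) (\<lambda>x y. c z * B z x y)"
    using Cons.prems by (intro bilinear_on_scale) simp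
  have 2: "bilinear_on s U s' U' (*) (\<lambda>x y. \<Sum>z\<leftarrow>zs. c z * B z x y)"
    using Cons by simp
  show ?case
    using bilinear_on_add[OF 1 2] bitensor_add[OF 1 2] bitensor_scale[of "B z" "c z"] Cons by simp
qed

end

context
  fixes s U V W X T
  assumes T: "tritensor_on s U V W X T"
begin

lemma tritensor_nontrilinear: "\<not> trilinear_form s U \<gamma> \<Longrightarrow> T \<gamma> = 0"
  by (rule T[unfolded tritensor_on_def, THEN conjunct1, rule_format])

lemma tritensor_add:
  "trilinear_form s U \<gamma> \<Longrightarrow> trilinear_form s U \<gamma>' \<Longrightarrow>
     T (\<lambda>x y z. \<gamma> x y z + \<gamma>' x y z) = T \<gamma> + T \<gamma>'"
  by (rule T[unfolded tritensor_on_def, THEN conjunct2, THEN conjunct1, rule_format])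

lemma tritensor_scale:
  "trilinear_form s U \<gamma> \<Longrightarrow> T (\<lambda>x y z. c * \<gamma> x y z) = c * T \<gamma>"
  by (rule T[unfolded tritensor_on_def, THEN conjunct2, THEN conjunct2, THEN conjunct1, rule_format])

lemma tritensor_vanish:
  "trilinear_form s U \<gamma> \<Longrightarrow> (\<And>x y z. x \<in> V \<Longrightarrow> y \<in> W \<Longrightarrow> z \<in> X \<Longrightarrow> \<gamma> x y z = 0) \<Longrightarrow> T \<gamma> = 0"
  by (rule T[unfolded tritensor_on_def, THEN conjunct2, THEN conjunct2, THEN conjunct2, rule_format])

lemma tritensor_cong:
  assumes "trilinear_form s U \<gamma>" "trilinear_form s U \<gamma>'"
    "\<And>x y z. x \<in> V \<Longrightarrow> y \<in> W \<Longrightarrow> z \<in> X \<Longrightarrow> \<gamma> x y z = \<gamma>' x y z"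
  shows "T \<gamma> = T \<gamma>'"
proof -
  have d: "trilinear_form s U (\<lambda>x y z. \<gamma> x y z - \<gamma>' x y z)"
    using assms(1,2) by (auto simp: trilinear_form_iff linear_on_def algebra_simps)
  show ?thesis using tritensor_add[OF d assms(2)] tritensor_vanish[OF d] assms(3) by simp
qed

lemma tritensor_lincomb:
  assumes "\<And>z. z \<in> set zs \<Longrightarrow> trilinear_form s U (B z)"
  shows "trilinear_form s U (\<lambda>x y w. \<Sum>z\<leftarrow>zs. c z * B z x y w) \<and>
         T (\<lambda>x y w. \<Sum>z\<leftarrow>zs. c z * B z x y w) = (\<Sum>z\<leftarrow>zs. c z * T (B z))"
  using assms
proof (induction zs)
  case Nil
  have "trilinear_form s U (\<lambda>x y z. 0)" by (auto simp: trilinear_form_iff linear_on_def)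
  then show ?case using tritensor_vanish[of "\<lambda>x y z. 0"] by simp
next
  case (Cons z zs)
  have 1: "trilinear_form s U (\<lambda>x y w. c z * B z x y w)"
    using Cons.prems[of z] by (auto simp: trilinear_form_iff linear_on_def algebra_simps)
  have 2: "trilinear_form s U (\<lambda>x y w. \<Sum>z\<leftarrow>zs. c z * B z x y w)"
    using Cons by simp
  have 3: "trilinear_form s U (\<lambda>x y w. c z * B z x y w + (\<Sum>z\<leftarrow>zs. c z * B z x y w))"
    using 1 2 by (auto simp: trilinear_form_iff linear_on_def algebra_simps)
  show ?case using 3 tritensor_add[OF 1 2] tritensor_scale[of "B z" "c z"] Cons by simp
qed

end

lemma bitensor_on_minus:
  "bitensor_on s U s' U' V W T \<Longrightarrow> bitensor_on s U s' U' V W T' \<Longrightarrow> bitensor_on s U s' U' V W (T - T')"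
  by (simp add: bitensor_on_def algebra_simps)

lemma bitensor_on_flip:
  assumes "bitensor_on s U s U V W T"
  shows "bitensor_on s U s U W V (tensor_flip T)"
  unfolding bitensor_on_def tensor_flip_def
proof (intro conjI allI impI)
  note swap = bilinear_on_swap[THEN iffD1]
  show "T (\<lambda>x y. \<beta> y x) = 0" if "\<not> bilinear_on s U s U (*) \<beta>" for \<beta>
    using that bilinear_on_swap[of s U s U "(*)" \<beta>] by (intro bitensor_nonbilinear[OF assms]) blast
  show "T (\<lambda>x y. \<beta> y x + \<beta>' y x) = T (\<lambda>x y. \<beta> y x) + T (\<lambda>x y. \<beta>' y x)"
    if "bilinear_on s U s U (*) \<beta>" "bilinear_on s U s U (*) \<beta>'" for \<beta> \<beta>'
    by (rule bitensor_add[OF assms swap[OF that(1)] swap[OF that(2)]])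
  show "T (\<lambda>x y. c * \<beta> y x) = c * T (\<lambda>x y. \<beta> y x)" if "bilinear_on s U s U (*) \<beta>" for c \<beta>
    by (rule bitensor_scale[OF assms swap[OF that]])
  show "T (\<lambda>x y. \<beta> y x) = 0"
    if "bilinear_on s U s U (*) \<beta>" "\<forall>x\<in>W. \<forall>y\<in>V. \<beta> x y = 0" for \<beta>
    using that by (intro bitensor_vanish[OF assms swap]) auto
qed

lemma bitensor_on_map:
  assumes T: "bitensor_on s U s U V W T" and f: "linear_on s U s f" "f ` U \<subseteq> U" "f ` V \<subseteq> V'"
    and g: "linear_on s U s g" "g ` U \<subseteq> U" "g ` W \<subseteq> W'"
  shows "bitensor_on s U s U V' W' (tensor_map s U f g T)"
proof -
  have b: "bilinear_on s U s U (*) (\<lambda>x y. \<beta> (f x) (g y))" if "bilinear_on s U s U (*) \<beta>" for \<beta>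
    using bilinear_on_comp[OF that f(1,2) g(1,2)] .
  have v: "T (\<lambda>x y. \<beta> (f x) (g y)) = 0"
    if "bilinear_on s U s U (*) \<beta>" "\<forall>x\<in>V'. \<forall>y\<in>W'. \<beta> x y = 0" for \<beta>
    using that f(3) g(3) by (intro bitensor_vanish[OF T b]) (auto simp: image_subset_iff)
  show ?thesis
    unfolding bitensor_on_def tensor_map_def
    using v bitensor_add[OF T b b] bitensor_scale[OF T b]
    by (simp add: bilinear_on_add bilinear_on_scale)
qed

lemma bitensor_on_sum:
  assumes "finite Q" "\<And>q. q \<in> Q \<Longrightarrow> bitensor_on s U s' U' V W (t q)"
  shows "bitensor_on s U s' U' V W (\<Sum>q\<in>Q. t q)"
  using assms
proof (induction Q rule: finite_induct)
  case empty
  then show ?case by (simp add: bitensor_on_def)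
next
  case (insert q Q)
  then show ?case unfolding sum.insert[OF insert(1,2)] by (intro bitensor_on_plus) auto
qed

lemma tritensor_on_minus:
  "tritensor_on s U V W X T \<Longrightarrow> tritensor_on s U V W X T' \<Longrightarrow> tritensor_on s U V W X (T - T')"
  by (simp add: tritensor_on_def algebra_simps)

lemma tritensor_on_plus:
  "tritensor_on s U V W X T \<Longrightarrow> tritensor_on s U V W X T' \<Longrightarrow> tritensor_on s U V W X (T + T')"
  by (simp add: tritensor_on_def algebra_simps)

lemma tritensor_on_sum:
  assumes "finite Q" "\<And>q. q \<in> Q \<Longrightarrow> tritensor_on s U V W X (t q)"
  shows "tritensor_on s U V W X (\<Sum>q\<in>Q. t q)"
  using assms
proof (induction Q rule: finite_induct)
  case empty
  then show ?case by (simp add: tritensor_on_def)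
next
  case (insert q Q)
  then show ?case unfolding sum.insert[OF insert(1,2)] by (intro tritensor_on_plus) auto
qed

lemma tritensor_on_flip:
  assumes "tritensor_on s U V W X T"
  shows "tritensor_on s U W V X (flip_tensor_id T)"
  unfolding tritensor_on_def flip_tensor_id_def
proof (intro conjI allI impI)
  note flip = trilinear_form_flip[THEN iffD2]
  show "T (\<lambda>x y z. \<gamma> y x z) = 0" if "\<not> trilinear_form s U \<gamma>" for \<gamma>
    using that trilinear_form_flip[of s U \<gamma>] by (intro tritensor_nontrilinear[OF assms]) blast
  show "T (\<lambda>x y z. \<gamma> y x z + \<gamma>' y x z) = T (\<lambda>x y z. \<gamma> y x z) + T (\<lambda>x y z. \<gamma>' y x z)"
    if "trilinear_form s U \<gamma>" "trilinear_form s U \<gamma>'" for \<gamma> \<gamma>'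
    by (rule tritensor_add[OF assms flip[OF that(1)] flip[OF that(2)]])
  show "T (\<lambda>x y z. c * \<gamma> y x z) = c * T (\<lambda>x y z. \<gamma> y x z)" if "trilinear_form s U \<gamma>" for c \<gamma>
    by (rule tritensor_scale[OF assms flip[OF that]])
  show "T (\<lambda>x y z. \<gamma> y x z) = 0"
    if "trilinear_form s U \<gamma>" "\<forall>x\<in>W. \<forall>y\<in>V. \<forall>z\<in>X. \<gamma> x y z = 0" for \<gamma>
    using that by (intro tritensor_vanish[OF assms flip]) auto
qed

text \<open>The form that \<open>id \<otimes> D\<close> substitutes into a tensor.  The functionals \<open>D y\<close> are additive only on forms, and
  \<open>\<gamma> (x + x')\<close> agrees with \<open>\<gamma> x + \<gamma> x'\<close> only on \<open>U\<close>, so linearity in \<open>x\<close> uses that \<open>D y\<close> sees no more than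
  the restriction of a form to \<open>V' \<times> W'\<close>.\<close>

lemma bilinear_id_cop:
  assumes U: "module s" "module.subspace s U" "V' \<subseteq> U" "W' \<subseteq> U"
    and D: "linear_on s U fscale D" "\<forall>y\<in>U. bitensor_on s U s U V' W' (D y)"
    and \<gamma>: "trilinear_form s U \<gamma>"
  shows "bilinear_on s U s U (*) (\<lambda>x y. D y (\<gamma> x))"
proof (unfold bilinear_on_def, intro conjI ballI linear_onI)
  interpret s: module s by (rule U)
  have g: "bilinear_on s U s U (*) (\<gamma> x)" if "x \<in> U" for x
    using \<gamma> that by (simp add: trilinear_form_def)
  show "D v (\<gamma> (x + y)) = D v (\<gamma> x) + D v (\<gamma> y)" if v: "v \<in> U" and xy: "x \<in> U" "y \<in> U" for v x y
  proof -
    have "D v (\<gamma> (x + y)) = D v (\<lambda>u w. \<gamma> x u w + \<gamma> y u w)"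
      using \<gamma> xy U(3,4) s.subspace_add[OF U(2) xy]
      by (intro bitensor_cong[OF bspec[OF D(2) v]] g bilinear_on_add)
        (auto simp: trilinear_form_iff linear_on_def subset_iff)
    also have "\<dots> = D v (\<gamma> x) + D v (\<gamma> y)"
      by (intro bitensor_add[OF bspec[OF D(2) v]] g xy)
    finally show ?thesis .
  qed
  show "D v (\<gamma> (s c x)) = c * D v (\<gamma> x)" if v: "v \<in> U" and x: "x \<in> U" for v c x
  proof -
    have "D v (\<gamma> (s c x)) = D v (\<lambda>u w. c * \<gamma> x u w)"
      using \<gamma> x U(3,4) s.subspace_scale[OF U(2) x]
      by (intro bitensor_cong[OF bspec[OF D(2) v]] g bilinear_on_scale)
        (auto simp: trilinear_form_iff linear_on_def subset_iff)
    also have "\<dots> = c * D v (\<gamma> x)"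
      by (intro bitensor_scale[OF bspec[OF D(2) v]] g x)
    finally show ?thesis .
  qed
  show "D (x + y) (\<gamma> u) = D x (\<gamma> u) + D y (\<gamma> u)" if "u \<in> U" "x \<in> U" "y \<in> U" for u x y
    using linear_onD_add[OF D(1)] that by simp
  show "D (s c x) (\<gamma> u) = c * D x (\<gamma> u)" if "u \<in> U" "x \<in> U" for u c x
    using linear_onD_scale[OF D(1)] that by (simp add: fscale_apply)
qed

lemma trilinear_rotate:
  "trilinear_form s V (\<lambda>x y z. \<gamma> y z x) \<longleftrightarrow> trilinear_form s V \<gamma>"
  by (auto simp: trilinear_form_iff)

lemma tritensor_on_id_cop:
  assumes U: "module s" "module.subspace s U" "V' \<subseteq> U" "W' \<subseteq> U" and W: "W \<subseteq> U" "V \<subseteq> U"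
    and D: "linear_on s U fscale D" "\<forall>y\<in>U. bitensor_on s U s U V' W' (D y)"
    and T: "bitensor_on s U s U V W T"
  shows "tritensor_on s U V V' W' (id_tensor_cop s U D T)"
proof -
  note b = bilinear_id_cop[OF U D]
  have g: "bilinear_on s U s U (*) (\<gamma> x)" if "x \<in> U" "trilinear_form s U \<gamma>" for x \<gamma>
    using that by (simp add: trilinear_form_def)
  have t1: "trilinear_form s U (\<lambda>x y z. \<gamma> x y z + \<gamma>' x y z)"
    if "trilinear_form s U \<gamma>" "trilinear_form s U \<gamma>'" for \<gamma> \<gamma>'
    using that by (auto simp: trilinear_form_iff linear_on_def algebra_simps)
  have t2: "trilinear_form s U (\<lambda>x y z. c * \<gamma> x y z)"
    if "trilinear_form s U \<gamma>" for c \<gamma>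
    using that by (auto simp: trilinear_form_iff linear_on_def algebra_simps)
  have 1: "T (\<lambda>x y. D y (\<lambda>u v. \<gamma> x u v + \<gamma>' x u v)) = T (\<lambda>x y. D y (\<gamma> x)) + T (\<lambda>x y. D y (\<gamma>' x))"
    if "trilinear_form s U \<gamma>" "trilinear_form s U \<gamma>'" for \<gamma> \<gamma>'
  proof -
    have "T (\<lambda>x y. D y (\<lambda>u v. \<gamma> x u v + \<gamma>' x u v)) = T (\<lambda>x y. D y (\<gamma> x) + D y (\<gamma>' x))"
    proof (rule bitensor_cong[OF T b[OF t1[OF that]] bilinear_on_add[OF b b]])
      fix x y assume xy: "x \<in> V" "y \<in> W"
      show "D y (\<lambda>u v. \<gamma> x u v + \<gamma>' x u v) = D y (\<gamma> x) + D y (\<gamma>' x)"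
        using xy W that by (intro bitensor_add[OF bspec[OF D(2)]] g) auto
    qed (use that in auto)
    also have "\<dots> = T (\<lambda>x y. D y (\<gamma> x)) + T (\<lambda>x y. D y (\<gamma>' x))"
      using that by (intro bitensor_add[OF T] b)
    finally show ?thesis .
  qed
  have 2: "T (\<lambda>x y. D y (\<lambda>u v. c * \<gamma> x u v)) = c * T (\<lambda>x y. D y (\<gamma> x))"
    if "trilinear_form s U \<gamma>" for c \<gamma>
  proof -
    have "T (\<lambda>x y. D y (\<lambda>u v. c * \<gamma> x u v)) = T (\<lambda>x y. c * D y (\<gamma> x))"
    proof (rule bitensor_cong[OF T b[OF t2[OF that]] bilinear_on_scale[OF b]])
      fix x y assume xy: "x \<in> V" "y \<in> W"
      show "D y (\<lambda>u v. c * \<gamma> x u v) = c * D y (\<gamma> x)"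
        using xy W that by (intro bitensor_scale[OF bspec[OF D(2)]] g) auto
    qed (use that in auto)
    also have "\<dots> = c * T (\<lambda>x y. D y (\<gamma> x))"
      using that by (intro bitensor_scale[OF T] b)
    finally show ?thesis .
  qed
  have 3: "T (\<lambda>x y. D y (\<gamma> x)) = 0"
    if "trilinear_form s U \<gamma>" "\<forall>x\<in>V. \<forall>y\<in>V'. \<forall>z\<in>W'. \<gamma> x y z = 0" for \<gamma>
  proof (rule bitensor_vanish[OF T b[OF that(1)]])
    fix x y assume "x \<in> V" "y \<in> W"
    then show "D y (\<gamma> x) = 0"
      using that W by (intro bitensor_vanish[OF bspec[OF D(2)]] g) auto
  qed
  show ?thesis
    unfolding tritensor_on_def id_tensor_cop_def by (simp add: 1 2 3 t1 t2)
qed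

text \<open>Up to a cyclic permutation of the three factors, \<open>D \<otimes> id\<close> is \<open>id \<otimes> D\<close> after the flip; so the facts about
  the former follow from those about the latter.\<close>

lemma cop_id_eq_id_cop:
  "cop_tensor_id s U D T =
     (\<lambda>\<gamma>. id_tensor_cop s U D (tensor_flip T) (\<lambda>x y z. \<gamma> y z x))"
  unfolding cop_tensor_id_def id_tensor_cop_def tensor_flip_def
  by (rule ext) (subst trilinear_rotate, rule refl)

lemma tritensor_on_cop_id:
  assumes U: "module s" "module.subspace s U" "V' \<subseteq> U" "W' \<subseteq> U" and W: "W \<subseteq> U" "V \<subseteq> U"
    and D: "linear_on s U fscale D" "\<forall>y\<in>U. bitensor_on s U s U V' W' (D y)"
    and T: "bitensor_on s U s U V W T"
  shows "tritensor_on s U V' W' W (cop_tensor_id s U D T)"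
proof -
  note t = tritensor_on_id_cop[OF U W(2,1) D bitensor_on_flip[OF T]]
  show ?thesis
    unfolding tritensor_on_def cop_id_eq_id_cop
  proof (intro conjI allI impI)
    let ?S = "id_tensor_cop s U D (tensor_flip T)"
    note rot = trilinear_rotate[THEN iffD2]
    show "?S (\<lambda>x y z. \<gamma> y z x) = 0" if "\<not> trilinear_form s U \<gamma>" for \<gamma>
      using that trilinear_rotate[of s U \<gamma>] by (intro tritensor_nontrilinear[OF t]) blast
    show "?S (\<lambda>x y z. \<gamma> y z x + \<gamma>' y z x) = ?S (\<lambda>x y z. \<gamma> y z x) + ?S (\<lambda>x y z. \<gamma>' y z x)"
      if "trilinear_form s U \<gamma>" "trilinear_form s U \<gamma>'" for \<gamma> \<gamma>'
      by (rule tritensor_add[OF t rot[OF that(1)] rot[OF that(2)]])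
    show "?S (\<lambda>x y z. c * \<gamma> y z x) = c * ?S (\<lambda>x y z. \<gamma> y z x)" if "trilinear_form s U \<gamma>" for c \<gamma>
      by (rule tritensor_scale[OF t rot[OF that]])
    show "?S (\<lambda>x y z. \<gamma> y z x) = 0"
      if "trilinear_form s U \<gamma>" "\<forall>x\<in>V'. \<forall>y\<in>W'. \<forall>z\<in>W. \<gamma> x y z = 0" for \<gamma>
      using that by (intro tritensor_vanish[OF t rot]) auto
  qed
qed

text \<open>On a product of linear forms the coproduct acts by transposition: if \<open>k\<close> is the transpose of \<open>g \<otimes> h\<close>
  under \<open>D\<close>, then \<open>f \<otimes> g \<otimes> h\<close> is pulled back to \<open>f \<otimes> k\<close>.  It suffices to know \<open>k\<close> on \<open>W\<close>, which lets \<open>W\<close> be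
  a single homogeneous component.\<close>

lemma id_cop_prod:
  assumes U: "module s" "module.subspace s U" "V' \<subseteq> U" "W' \<subseteq> U" and W: "W \<subseteq> U" "V \<subseteq> U"
    and D: "linear_on s U fscale D" "\<forall>y\<in>U. bitensor_on s U s U V' W' (D y)"
    and T: "bitensor_on s U s U V W T"
    and fgh: "linear_on s U (*) f" "linear_on s U (*) g" "linear_on s U (*) h"
    and k: "linear_on s U (*) k" "\<And>y. y \<in> W \<Longrightarrow> D y (\<lambda>u v. g u * h v) = k y"
  shows "id_tensor_cop s U D T (\<lambda>x y z. f x * (g y * h z)) = T (\<lambda>x y. f x * k y)"
proof -
  have t: "trilinear_form s U (\<lambda>x y z. f x * (g y * h z))"
    by (rule trilinear_form_prod[OF fgh])
  have "T (\<lambda>x y. D y (\<lambda>u v. f x * (g u * h v))) = T (\<lambda>x y. f x * k y)"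
  proof (rule bitensor_cong[OF T bilinear_id_cop[OF U D t] bilinear_on_prod[OF fgh(1) k(1)]])
    fix x y assume "x \<in> V" "y \<in> W"
    then show "D y (\<lambda>u v. f x * (g u * h v)) = f x * k y"
      using W k(2) bitensor_scale[OF bspec[OF D(2)] bilinear_on_prod[OF fgh(2,3)]] by auto
  qed
  then show ?thesis using t by (simp add: id_tensor_cop_def)
qed

lemma cop_id_prod:
  assumes U: "module s" "module.subspace s U" "V' \<subseteq> U" "W' \<subseteq> U" and W: "W \<subseteq> U" "V \<subseteq> U"
    and D: "linear_on s U fscale D" "\<forall>y\<in>U. bitensor_on s U s U V' W' (D y)"
    and T: "bitensor_on s U s U V W T"
    and fgh: "linear_on s U (*) f" "linear_on s U (*) g" "linear_on s U (*) h"
    and k: "linear_on s U (*) k" "\<And>x. x \<in> V \<Longrightarrow> D x (\<lambda>u v. f u * g v) = k x"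
  shows "cop_tensor_id s U D T (\<lambda>x y z. f x * (g y * h z)) = T (\<lambda>x y. k x * h y)"
proof -
  have "cop_tensor_id s U D T (\<lambda>x y z. f x * (g y * h z))
      = id_tensor_cop s U D (tensor_flip T) (\<lambda>x y z. h x * (f y * g z))"
    unfolding cop_id_eq_id_cop by (simp add: mult_ac)
  also have "\<dots> = tensor_flip T (\<lambda>x y. h x * k y)"
    by (rule id_cop_prod[OF U W(2,1) D bitensor_on_flip[OF T] fgh(3,1,2) k])
  finally show ?thesis by (simp add: tensor_flip_def mult_ac)
qed

lemma tensor_flip_span:
  fixes s :: "'k::field \<Rightarrow> 'v::ab_group_add \<Rightarrow> 'v"
  assumes "T \<in> tensor_span s U s U V W"
  shows "tensor_flip T \<in> tensor_span s U s U W V"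
  using assms
proof (induction rule: tensor_span_induct)
  case zero
  have "tensor_flip (0 :: ('k, 'v, 'v) tensor) = 0" by (rule ext) (simp add: tensor_flip_def)
  then show ?case by (simp only: fun_space.subspace_0[OF subspace_tensor_span])
next
  case (step c x y T)
  have "tensor_flip (fscale c (pure_tensor s U s U x y) + T) = fscale c (tensor_flip (pure_tensor s U s U x y)) + tensor_flip T"
    by (rule ext) (simp add: tensor_flip_def fscale_apply)
  also have "\<dots> = fscale c (pure_tensor s U s U y x) + tensor_flip T"
    by (simp only: tensor_flip_pure)
  also have "\<dots> \<in> tensor_span s U s U W V"
    by (intro fun_space.subspace_add[OF subspace_tensor_span] fun_space.subspace_scale[OF subspace_tensor_span]
        pure_in_tensor_span step)
  finally show ?case .
qed

section \<open>Dual frames\<close>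

text \<open>The space \<open>V\<close> is finite-dimensional, and \<open>F\<close> contains enough functionals to recover every vector of \<open>V\<close>
  from finitely many coordinates.\<close>

definition has_dual_frame ::
  "('k::field \<Rightarrow> 'v::ab_group_add \<Rightarrow> 'v) \<Rightarrow> 'v set \<Rightarrow> ('v \<Rightarrow> 'k) set \<Rightarrow> bool"
  where "has_dual_frame s V F \<longleftrightarrow>
    (\<exists>zs. (\<forall>(e, f)\<in>set zs. e \<in> V \<and> f \<in> F) \<and> (\<forall>v\<in>V. v = (\<Sum>(e, f)\<leftarrow>zs. s (f v) e)))"

lemma linear_on_sum_list:
  assumes s: "module s" and U: "module.subspace s U" and f: "linear_on s U s' f"
    and "\<And>z. z \<in> set zs \<Longrightarrow> e z \<in> U"
  shows "(\<Sum>z\<leftarrow>zs. s (c z) (e z)) \<in> U \<and> f (\<Sum>z\<leftarrow>zs. s (c z) (e z)) = (\<Sum>z\<leftarrow>zs. s' (c z) (f (e z)))"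
  using assms(4)
proof (induction zs)
  interpret s: module s by (rule s)
  case Nil
  then show ?case using s.subspace_0[OF U] linear_on_zero[OF f] by simp
next
  interpret s: module s by (rule s)
  case (Cons z zs)
  then have "e z \<in> U" "(\<Sum>z\<leftarrow>zs. s (c z) (e z)) \<in> U" by auto
  then show ?case
    using Cons s.subspace_add[OF U] s.subspace_scale[OF U] linear_onD_add[OF f] linear_onD_scale[OF f]
    by simp
qed

lemma dual_frame_linear:
  fixes s :: "'k::field \<Rightarrow> 'v::ab_group_add \<Rightarrow> 'v"
  assumes s: "module s" and U: "module.subspace s U" and V: "V \<subseteq> U" and F: "has_dual_frame s V F"
  shows "\<exists>zs. (\<forall>z\<in>set zs. fst z \<in> V \<and> snd z \<in> F) \<and>
    (\<forall>h v. linear_on s U (*) h \<longrightarrow> v \<in> V \<longrightarrow> h v = (\<Sum>z\<leftarrow>zs. h (fst z) * snd z v))"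
proof -
  from F obtain zs where zs: "\<forall>z\<in>set zs. fst z \<in> V \<and> snd z \<in> F"
    "\<forall>v\<in>V. v = (\<Sum>z\<leftarrow>zs. s (snd z v) (fst z))"
    unfolding has_dual_frame_def case_prod_beta by blast
  have "h v = (\<Sum>z\<leftarrow>zs. h (fst z) * snd z v)" if h: "linear_on s U (*) h" and v: "v \<in> V" for h v
  proof -
    have "h (\<Sum>z\<leftarrow>zs. s (snd z v) (fst z)) = (\<Sum>z\<leftarrow>zs. snd z v * h (fst z))"
      using linear_on_sum_list[OF s U h, of zs fst "\<lambda>z. snd z v"] zs(1) V by blast
    then show "h v = (\<Sum>z\<leftarrow>zs. h (fst z) * snd z v)"
      using zs(2)[rule_format, OF v, symmetric] by (simp add: mult.commute)
  qed
  then show ?thesis using zs(1) by blast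
qed

text \<open>Substituting the reproducing formulas into both arguments of a form expresses every tensor through its
  values on products \<open>f \<otimes> g\<close>.  The frames do not depend on the tensor, which is what makes
  \<open>has_dual_frame_tensor\<close> a consequence.\<close>

lemma bitensor_expand:
  fixes s :: "'k::field \<Rightarrow> 'u::ab_group_add \<Rightarrow> 'u" and s' :: "'k \<Rightarrow> 'v::ab_group_add \<Rightarrow> 'v"
  assumes U: "module s" "module.subspace s U" "V \<subseteq> U" "has_dual_frame s V F"
    and U': "module s'" "module.subspace s' U'" "W \<subseteq> U'" "has_dual_frame s' W F'"
    and lin: "\<And>f. f \<in> F \<Longrightarrow> linear_on s U (*) f" "\<And>f. f \<in> F' \<Longrightarrow> linear_on s' U' (*) f"
  shows "\<exists>zs zs'. (\<forall>z\<in>set zs. fst z \<in> V \<and> snd z \<in> F) \<and> (\<forall>w\<in>set zs'. fst w \<in> W \<and> snd w \<in> F') \<and>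
    (\<forall>T \<beta>. bitensor_on s U s' U' V W T \<longrightarrow> bilinear_on s U s' U' (*) \<beta> \<longrightarrow>
       T \<beta> = (\<Sum>z\<leftarrow>zs. \<Sum>w\<leftarrow>zs'. \<beta> (fst z) (fst w) * T (\<lambda>x y. snd z x * snd w y)))"
proof -
  from dual_frame_linear[OF U] obtain zs where zs: "\<forall>z\<in>set zs. fst z \<in> V \<and> snd z \<in> F"
    and exp: "\<forall>h v. linear_on s U (*) h \<longrightarrow> v \<in> V \<longrightarrow> h v = (\<Sum>z\<leftarrow>zs. h (fst z) * snd z v)"
    by blast
  from dual_frame_linear[OF U'] obtain zs' where zs': "\<forall>z\<in>set zs'. fst z \<in> W \<and> snd z \<in> F'"
    and exp': "\<forall>h v. linear_on s' U' (*) h \<longrightarrow> v \<in> W \<longrightarrow> h v = (\<Sum>z\<leftarrow>zs'. h (fst z) * snd z v)"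
    by blast
  have "T \<beta> = (\<Sum>z\<leftarrow>zs. \<Sum>w\<leftarrow>zs'. \<beta> (fst z) (fst w) * T (\<lambda>x y. snd z x * snd w y))"
    if T: "bitensor_on s U s' U' V W T" and \<beta>: "bilinear_on s U s' U' (*) \<beta>" for T \<beta>
  proof -
    have second: "T (\<lambda>x y. f x * h y) = (\<Sum>w\<leftarrow>zs'. h (fst w) * T (\<lambda>x y. f x * snd w y))"
      if f: "f \<in> F" and h: "linear_on s' U' (*) h" for f h
    proof -
      have b: "bilinear_on s U s' U' (*) (\<lambda>x y. f x * snd w y)" if "w \<in> set zs'" for w
        using zs' f lin that by (intro bilinear_on_prod) auto
      have lc: "bilinear_on s U s' U' (*) (\<lambda>x y. \<Sum>w\<leftarrow>zs'. h (fst w) * (f x * snd w y)) \<and>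
          T (\<lambda>x y. \<Sum>w\<leftarrow>zs'. h (fst w) * (f x * snd w y)) = (\<Sum>w\<leftarrow>zs'. h (fst w) * T (\<lambda>x y. f x * snd w y))"
        by (rule bitensor_lincomb[OF T]) (rule b)
      have "T (\<lambda>x y. f x * h y) = T (\<lambda>x y. \<Sum>w\<leftarrow>zs'. h (fst w) * (f x * snd w y))"
      proof (rule bitensor_cong[OF T bilinear_on_prod[OF lin(1)[OF f] h]])
        fix x y assume y: "y \<in> W"
        have "f x * h y = f x * (\<Sum>w\<leftarrow>zs'. h (fst w) * snd w y)"
          using exp' h y by simp
        then show "f x * h y = (\<Sum>w\<leftarrow>zs'. h (fst w) * (f x * snd w y))"
          by (simp only: sum_list_const_mult[symmetric] mult.left_commute)
      qed (use lc in blast)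
      then show ?thesis using lc by simp
    qed
    have b: "bilinear_on s U s' U' (*) (\<lambda>x y. snd z x * \<beta> (fst z) y)" if "z \<in> set zs" for z
      using zs lin U(3) that by (intro bilinear_on_prod bilinear_onD(2)[OF \<beta>]) auto
    have lc: "bilinear_on s U s' U' (*) (\<lambda>x y. \<Sum>z\<leftarrow>zs. 1 * (snd z x * \<beta> (fst z) y)) \<and>
        T (\<lambda>x y. \<Sum>z\<leftarrow>zs. 1 * (snd z x * \<beta> (fst z) y)) = (\<Sum>z\<leftarrow>zs. 1 * T (\<lambda>x y. snd z x * \<beta> (fst z) y))"
      by (rule bitensor_lincomb[OF T]) (rule b)
    have "T \<beta> = T (\<lambda>x y. \<Sum>z\<leftarrow>zs. 1 * (snd z x * \<beta> (fst z) y))"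
    proof (rule bitensor_cong[OF T \<beta>])
      fix x y assume x: "x \<in> V" and y: "y \<in> W"
      have "\<beta> x y = (\<Sum>z\<leftarrow>zs. \<beta> (fst z) y * snd z x)"
        using exp bilinear_onD(1)[OF \<beta>, of y] x y U'(3) by blast
      then show "\<beta> x y = (\<Sum>z\<leftarrow>zs. 1 * (snd z x * \<beta> (fst z) y))"
        by (simp only: mult.commute mult_1_left)
    qed (use lc in blast)
    also have "\<dots> = (\<Sum>z\<leftarrow>zs. 1 * T (\<lambda>x y. snd z x * \<beta> (fst z) y))"
      using lc by blast
    also have "\<dots> = (\<Sum>z\<leftarrow>zs. \<Sum>w\<leftarrow>zs'. \<beta> (fst z) (fst w) * T (\<lambda>x y. snd z x * snd w y))"
    proof -
      have "T (\<lambda>x y. snd z x * \<beta> (fst z) y) = (\<Sum>w\<leftarrow>zs'. \<beta> (fst z) (fst w) * T (\<lambda>x y. snd z x * snd w y))"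
        if "z \<in> set zs" for z
        using zs U(3) that by (intro second bilinear_onD(2)[OF \<beta>]) auto
      then show ?thesis by (simp cong: map_cong)
    qed
    finally show ?thesis .
  qed
  then show ?thesis using zs zs' by blast
qed

lemma bitensor_eq_zero:
  fixes s :: "'k::field \<Rightarrow> 'u::ab_group_add \<Rightarrow> 'u" and s' :: "'k \<Rightarrow> 'v::ab_group_add \<Rightarrow> 'v"
  assumes T: "bitensor_on s U s' U' V W T"
    and U: "module s" "module.subspace s U" "V \<subseteq> U" "has_dual_frame s V F"
    and U': "module s'" "module.subspace s' U'" "W \<subseteq> U'" "has_dual_frame s' W F'"
    and lin: "\<And>f. f \<in> F \<Longrightarrow> linear_on s U (*) f" "\<And>f. f \<in> F' \<Longrightarrow> linear_on s' U' (*) f"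
    and zero: "\<And>f g. f \<in> F \<Longrightarrow> g \<in> F' \<Longrightarrow> T (\<lambda>x y. f x * g y) = 0"
  shows "T = 0"
proof
  fix \<beta>
  obtain zs zs' where zs: "\<forall>z\<in>set zs. fst z \<in> V \<and> snd z \<in> F" "\<forall>w\<in>set zs'. fst w \<in> W \<and> snd w \<in> F'"
    and exp: "bilinear_on s U s' U' (*) \<beta> \<longrightarrow>
       T \<beta> = (\<Sum>z\<leftarrow>zs. \<Sum>w\<leftarrow>zs'. \<beta> (fst z) (fst w) * T (\<lambda>x y. snd z x * snd w y))"
    using bitensor_expand[OF U U' lin] T by blast
  have "(\<Sum>z\<leftarrow>zs. \<Sum>w\<leftarrow>zs'. \<beta> (fst z) (fst w) * T (\<lambda>x y. snd z x * snd w y)) = 0"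
    using zs zero by (simp cong: map_cong)
  then show "T \<beta> = 0 \<beta>"
    using exp bitensor_nonbilinear[OF T, of \<beta>] by (cases "bilinear_on s U s' U' (*) \<beta>") auto
qed

lemma sum_list_product:
  "(\<Sum>p\<leftarrow>List.product xs ys. f p) = (\<Sum>x\<leftarrow>xs. \<Sum>y\<leftarrow>ys. f (x, y) :: 'w::comm_monoid_add)"
  by (induction xs) (simp_all add: comp_def)

lemma sum_list_apply: "(\<Sum>z\<leftarrow>zs. f z) x = (\<Sum>z\<leftarrow>zs. f z x)"
  by (induction zs) auto

lemma has_dual_frame_tensor:
  fixes s :: "'k::field \<Rightarrow> 'u::ab_group_add \<Rightarrow> 'u" and s' :: "'k \<Rightarrow> 'v::ab_group_add \<Rightarrow> 'v"
  assumes U: "module s" "module.subspace s U" "V \<subseteq> U" "has_dual_frame s V F"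
    and U': "module s'" "module.subspace s' U'" "W \<subseteq> U'" "has_dual_frame s' W F'"
    and lin: "\<And>f. f \<in> F \<Longrightarrow> linear_on s U (*) f" "\<And>f. f \<in> F' \<Longrightarrow> linear_on s' U' (*) f"
  shows "has_dual_frame fscale (tensor_span s U s' U' V W) {\<lambda>T. T (\<lambda>x y. f x * g y) |f g. f \<in> F \<and> g \<in> F'}"
proof -
  obtain zs zs' where zs: "\<forall>z\<in>set zs. fst z \<in> V \<and> snd z \<in> F" "\<forall>w\<in>set zs'. fst w \<in> W \<and> snd w \<in> F'"
    and exp: "\<forall>T \<beta>. bitensor_on s U s' U' V W T \<longrightarrow> bilinear_on s U s' U' (*) \<beta> \<longrightarrow>
       T \<beta> = (\<Sum>z\<leftarrow>zs. \<Sum>w\<leftarrow>zs'. \<beta> (fst z) (fst w) * T (\<lambda>x y. snd z x * snd w y))"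
    using bitensor_expand[OF U U' lin] by blast
  define ps where "ps = map (\<lambda>p. (pure_tensor s U s' U' (fst (fst p)) (fst (snd p)),
    \<lambda>T :: ('k, 'u, 'v) tensor. T (\<lambda>x y. snd (fst p) x * snd (snd p) y))) (List.product zs zs')"
  have "T = (\<Sum>p\<leftarrow>ps. fscale (snd p T) (fst p))" if T: "T \<in> tensor_span s U s' U' V W" for T
  proof
    fix \<beta>
    show "T \<beta> = (\<Sum>p\<leftarrow>ps. fscale (snd p T) (fst p)) \<beta>"
      using exp tensor_span_bitensor[OF T] bitensor_nonbilinear[OF tensor_span_bitensor[OF T], of \<beta>]
      unfolding sum_list_apply ps_def
      by (cases "bilinear_on s U s' U' (*) \<beta>")
        (simp_all add: comp_def sum_list_product fscale_apply pure_tensor_def mult.commute)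
  qed
  moreover have "\<forall>p\<in>set ps. fst p \<in> tensor_span s U s' U' V W \<and>
      snd p \<in> {\<lambda>T. T (\<lambda>x y. f x * g y) |f g. f \<in> F \<and> g \<in> F'}"
    unfolding ps_def using zs by (auto intro!: pure_in_tensor_span)
  ultimately show ?thesis
    unfolding has_dual_frame_def case_prod_beta by blast
qed

text \<open>Fixing a functional in the first factor turns a three-fold tensor into a two-fold one, to which
  \<open>bitensor_eq_zero\<close> applies; the first factor is then treated by its own frame.\<close>

lemma tritensor_eq_zero:
  assumes T: "tritensor_on s U V1 V2 V3 T"
    and U: "module s" "module.subspace s U"
    and V: "V1 \<subseteq> U" "V2 \<subseteq> U" "V3 \<subseteq> U"
    and F: "has_dual_frame s V1 F1" "has_dual_frame s V2 F2" "has_dual_frame s V3 F3"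
    and lin: "\<And>f. f \<in> F1 \<union> F2 \<union> F3 \<Longrightarrow> linear_on s U (*) f"
    and zero: "\<And>f g h. f \<in> F1 \<Longrightarrow> g \<in> F2 \<Longrightarrow> h \<in> F3 \<Longrightarrow> T (\<lambda>x y z. f x * (g y * h z)) = 0"
  shows "T = 0"
proof
  fix \<gamma>
  have 1: "T (\<lambda>x y z. f x * \<beta> y z) = 0" if f: "f \<in> F1" and b: "bilinear_on s U s U (*) \<beta>" for f \<beta>
  proof -
    define S where "S = (\<lambda>\<beta>. if bilinear_on s U s U (*) \<beta> then T (\<lambda>x y z. f x * \<beta> y z) else 0)"
    have t: "trilinear_form s U (\<lambda>x y z. f x * \<beta> y z)" if "bilinear_on s U s U (*) \<beta>" for \<beta>
      using that lin[of f] f by (intro trilinear_form_mult) auto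
    have S: "bitensor_on s U s U V2 V3 S"
      unfolding bitensor_on_def
    proof (intro conjI allI impI)
      show "S \<beta> = 0" if "\<not> bilinear_on s U s U (*) \<beta>" for \<beta>
        using that by (simp add: S_def)
      show "S (\<lambda>x y. \<beta> x y + \<beta>' x y) = S \<beta> + S \<beta>'"
        if "bilinear_on s U s U (*) \<beta>" "bilinear_on s U s U (*) \<beta>'" for \<beta> \<beta>'
        using tritensor_add[OF T t[OF that(1)] t[OF that(2)]] that
        by (simp add: S_def bilinear_on_add distrib_left)
      show "S (\<lambda>x y. c * \<beta> x y) = c * S \<beta>" if "bilinear_on s U s U (*) \<beta>" for c \<beta>
        using tritensor_scale[OF T t[OF that], of c] that
        by (simp add: S_def bilinear_on_scale mult.left_commute)
      show "S \<beta> = 0" if "bilinear_on s U s U (*) \<beta>" "\<forall>x\<in>V2. \<forall>y\<in>V3. \<beta> x y = 0" for \<beta>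
        using tritensor_vanish[OF T t[OF that(1)]] that by (simp add: S_def)
    qed
    have "S = 0"
      using lin zero[OF f] by (intro bitensor_eq_zero[OF S U V(2) F(2) U V(3) F(3)])
        (auto simp: S_def)
    then have "S \<beta> = 0" by simp
    then show ?thesis using b by (simp add: S_def)
  qed
  from dual_frame_linear[OF U V(1) F(1)] obtain zs where zs: "\<forall>z\<in>set zs. fst z \<in> V1 \<and> snd z \<in> F1"
    and exp: "\<forall>h v. linear_on s U (*) h \<longrightarrow> v \<in> V1 \<longrightarrow> h v = (\<Sum>z\<leftarrow>zs. h (fst z) * snd z v)"
    by blast
  show "T \<gamma> = 0 \<gamma>"
  proof (cases "trilinear_form s U \<gamma>")
    case True
    have b: "bilinear_on s U s U (*) (\<gamma> e)" if "e \<in> U" for e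
      using True that by (simp add: trilinear_form_def)
    have t: "trilinear_form s U (\<lambda>x y w. snd z x * \<gamma> (fst z) y w)" if "z \<in> set zs" for z
      using b[of "fst z"] lin[of "snd z"] zs that V(1) by (intro trilinear_form_mult) auto
    have lc: "trilinear_form s U (\<lambda>x y w. \<Sum>z\<leftarrow>zs. 1 * (snd z x * \<gamma> (fst z) y w)) \<and>
        T (\<lambda>x y w. \<Sum>z\<leftarrow>zs. 1 * (snd z x * \<gamma> (fst z) y w)) =
        (\<Sum>z\<leftarrow>zs. 1 * T (\<lambda>x y w. snd z x * \<gamma> (fst z) y w))"
      by (rule tritensor_lincomb[OF T]) (rule t)
    have "T \<gamma> = T (\<lambda>x y w. \<Sum>z\<leftarrow>zs. 1 * (snd z x * \<gamma> (fst z) y w))"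
    proof (rule tritensor_cong[OF T True])
      fix x y w assume x: "x \<in> V1" and yw: "y \<in> V2" "w \<in> V3"
      have "linear_on s U (*) (\<lambda>x. \<gamma> x y w)"
        using True yw V unfolding trilinear_form_def by blast
      then have "\<gamma> x y w = (\<Sum>z\<leftarrow>zs. \<gamma> (fst z) y w * snd z x)"
        using exp x by blast
      then show "\<gamma> x y w = (\<Sum>z\<leftarrow>zs. 1 * (snd z x * \<gamma> (fst z) y w))"
        by (simp only: mult.commute mult_1_left)
    qed (use lc in blast)
    also have "\<dots> = (\<Sum>z\<leftarrow>zs. 1 * T (\<lambda>x y w. snd z x * \<gamma> (fst z) y w))"
      using lc by blast
    also have "\<dots> = (\<Sum>z\<leftarrow>zs. 0)"
    proof -
      have "T (\<lambda>x y w. snd z x * \<gamma> (fst z) y w) = 0" if "z \<in> set zs" for z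
        using zs V(1) that by (intro 1 b) auto
      then show ?thesis by (simp cong: map_cong)
    qed
    finally show ?thesis by simp
  qed (simp add: tritensor_nontrilinear[OF T])
qed


text \<open>A separating space of functionals on a finite-dimensional space contains the coordinates of some
  basis: the frame is built by induction on a spanning set, in the manner of the Gram--Schmidt
  process.\<close>

lemma has_dual_frame_span:
  fixes s :: "'k::field \<Rightarrow> 'v::ab_group_add \<Rightarrow> 'v"
  assumes s: "vector_space s" and "finite S" and V: "V = module.span s S"
    and F: "fun_space.subspace F" "\<And>f. f \<in> F \<Longrightarrow> linear_on s V (*) f"
    and sep: "\<And>v. v \<in> V \<Longrightarrow> v \<noteq> 0 \<Longrightarrow> \<exists>f\<in>F. f v \<noteq> 0"
  shows "has_dual_frame s V F"
proof -
  interpret s: vector_space s by (rule s)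
  have subV: "s.subspace V" unfolding V by (rule s.subspace_span)
  have "S \<subseteq> V" unfolding V by (rule s.span_superset)
  with \<open>finite S\<close> have "has_dual_frame s (s.span S) F"
  proof (induction S rule: finite_induct)
    case empty
    show ?case unfolding has_dual_frame_def by (intro exI[of _ "[]"]) auto
  next
    case (insert e S)
    let ?V = "s.span S"
    have e: "e \<in> V" and VV: "?V \<subseteq> V"
      using insert.prems by (auto intro!: s.span_minimal[OF _ subV])
    have VW: "?V \<subseteq> s.span (insert e S)" by (intro s.span_mono) auto
    have eW: "e \<in> s.span (insert e S)" by (simp add: s.span_base)
    obtain zs where zs: "\<forall>z\<in>set zs. fst z \<in> ?V \<and> snd z \<in> F"
      "\<forall>v\<in>?V. v = (\<Sum>z\<leftarrow>zs. s (snd z v) (fst z))"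
      using insert unfolding has_dual_frame_def case_prod_beta by blast
    show ?case
    proof (cases "e \<in> ?V")
      case True
      then have "s.span (insert e S) = ?V" by (rule s.span_redundant)
      then show ?thesis using insert by auto
    next
      case False
      define P where "P v = (\<Sum>z\<leftarrow>zs. s (snd z v) (fst z))" for v
      have P: "P v \<in> ?V" for v
        unfolding P_def using zs(1)
        by (induction zs) (auto intro!: s.span_add s.span_scale simp: s.span_zero)
      have PV: "P v = v" if "v \<in> ?V" for v
        using zs(2) that unfolding P_def by simp
      have P_add: "P (v + w) = P v + P w" if "v \<in> V" "w \<in> V" for v w
        unfolding P_def using zs(1)
      proof (induction zs)
        case (Cons z zs)
        then have "snd z (v + w) = snd z v + snd z w"
          using linear_onD_add[OF F(2) that, of "snd z"] by simp
        with Cons show ?case by (simp add: s.scale_left_distrib algebra_simps)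
      qed simp
      \<comment> \<open>The map \<open>P\<close> is a projection to the span of \<open>S\<close>, and \<open>e'\<close> is the part of \<open>e\<close> in its kernel.\<close>
      define e' where "e' = e - P e"
      have e'V: "e' \<in> V" and e'W: "e' \<in> s.span (insert e S)"
        unfolding e'_def using e P VV VW eW
        by (auto intro!: s.subspace_diff[OF subV] s.span_diff)
      have "e' \<noteq> 0" using False P[of e] unfolding e'_def by auto
      have "P e = P e' + P (P e)" using P_add[OF e'V, of "P e"] P VV by (auto simp: e'_def)
      then have Pe': "P e' = 0" using PV[OF P] by simp
      \<comment> \<open>Separation gives a functional that does not vanish on \<open>e'\<close>; it is normalised to \<open>f\<close> with \<open>f e' = 1\<close>.\<close>
      obtain f0 where f0: "f0 \<in> F" "f0 e' \<noteq> 0" using sep e'V \<open>e' \<noteq> 0\<close> by blast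
      define f where "f = fscale (1 / f0 e') f0"
      have f: "f \<in> F" "f e' = 1"
        using f0 fun_space.subspace_scale[OF F(1)] by (auto simp: f_def fscale_apply)
      have f_zero: "f 0 = 0" by (rule linear_on_zero[OF F(2)[OF f(1)] s.subspace_0[OF subV]])
      \<comment> \<open>The functional \<open>f \<circ> P\<close> is a combination of frame functionals, hence given by some \<open>g \<in> F\<close>; then \<open>f - g\<close> still has the value 1 at \<open>e'\<close> but vanishes on the span of \<open>S\<close>.\<close>
      have "\<forall>z\<in>set zs. fst z \<in> V \<and> snd z \<in> F" using zs(1) VV by auto
      then have "\<exists>g\<in>F. \<forall>v\<in>V. g v = f (P v)" unfolding P_def
      proof (induction zs)
        case Nil
        show ?case
          using f_zero fun_space.subspace_0[OF F(1)] by (intro bexI[of _ 0]) auto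
      next
        case (Cons z zs)
        then obtain g where g: "g \<in> F" "\<forall>v\<in>V. g v = f (\<Sum>z\<leftarrow>zs. s (snd z v) (fst z))" by auto
        have "(\<Sum>z\<leftarrow>zs. s (snd z v) (fst z)) \<in> V" for v
          using Cons.prems s.subspace_0[OF subV] s.subspace_add[OF subV] s.subspace_scale[OF subV]
          by (induction zs) auto
        then have "f (\<Sum>z\<leftarrow>z # zs. s (snd z v) (fst z)) = snd z v * f (fst z) + g v" if "v \<in> V" for v
          using that g Cons.prems s.subspace_scale[OF subV]
          by (simp add: linear_onD_add[OF F(2)[OF f(1)]] linear_onD_scale[OF F(2)[OF f(1)]])
        moreover have "fscale (f (fst z)) (snd z) + g \<in> F"
          using Cons.prems g(1)
          by (intro fun_space.subspace_add[OF F(1)] fun_space.subspace_scale[OF F(1)]) auto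
        ultimately show ?case
          by (intro bexI[of _ "fscale (f (fst z)) (snd z) + g"]) (auto simp: fscale_apply mult.commute)
      qed
      then obtain g where g: "g \<in> F" "\<forall>v\<in>V. g v = f (P v)" by blast
      have fg: "f - g \<in> F" by (rule fun_space.subspace_diff[OF F(1) f(1) g(1)])
      have fg': "(f - g) e' = 1" "v \<in> ?V \<Longrightarrow> (f - g) v = 0" for v
        using g(2) e'V VV f(2) Pe' f_zero PV[of v] by auto
      have "v = (\<Sum>z\<leftarrow>(e', f - g) # zs. s (snd z v) (fst z))" if v_span: "v \<in> s.span (insert e S)" for v
      proof -
        obtain c where c: "v - s c e \<in> ?V" using v_span unfolding s.span_breakdown_eq by blast
        define w where "w = v - s c e'"
        have "w = v - s c e + s c (P e)" by (simp add: w_def e'_def s.scale_right_diff_distrib)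
        then have w: "w \<in> ?V" using c P by (simp add: s.span_add s.span_scale)
        have v: "v = w + s c e'" by (simp add: w_def)
        have cV: "s c e' \<in> V" by (rule s.subspace_scale[OF subV e'V])
        have "(f - g) v = c"
          unfolding v using linear_onD_add[OF F(2)[OF fg] subsetD[OF VV w] cV]
            linear_onD_scale[OF F(2)[OF fg] e'V] fg' w by simp
        moreover have "P v = w"
        proof -
          have "P (s c e') = s c (P e')" unfolding P_def using zs(1)
          proof (induction zs)
            case (Cons z zs)
            then have "snd z (s c e') = c * snd z e'"
              using linear_onD_scale[OF F(2) e'V, of "snd z"] by simp
            with Cons show ?case by (simp add: s.scale_right_distrib)
          qed simp
          then show ?thesis unfolding v using P_add[OF subsetD[OF VV w] cV] PV[OF w] Pe' by simp
        qed
        ultimately show ?thesis using v unfolding P_def by (simp add: add.commute)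
      qed
      then show ?thesis
        unfolding has_dual_frame_def case_prod_beta using zs(1) VW e'W fg
        by (intro exI[of _ "(e', f - g) # zs"]) auto
    qed
  qed
  then show ?thesis by (simp add: V)
qed

lemma has_dual_frame_mono: "has_dual_frame s V F \<Longrightarrow> F \<subseteq> F' \<Longrightarrow> has_dual_frame s V F'"
  unfolding has_dual_frame_def case_prod_beta by (meson subsetD)

section \<open>Graded spaces and sums over degrees\<close>

lemma
  assumes G: "graded_space s V G" and x: "x \<in> V"
  shows graded_part_in: "graded_part s G i x \<in> G i"
    and graded_part_rest: "x - graded_part s G i x \<in> module.span s (\<Union>j\<in>-{i}. G j)"
    and graded_part_unique: "y \<in> G i \<Longrightarrow> x - y \<in> module.span s (\<Union>j\<in>-{i}. G j) \<Longrightarrow> graded_part s G i x = y"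
proof -
  interpret s: vector_space s using G by (simp add: graded_space_def)
  let ?R = "s.span (\<Union>j\<in>-{i}. G j)"
  have sub: "s.subspace (G i)" for i using G by (simp add: graded_space_def)
  have V: "V = s.span (\<Union>i. G i)" and int: "G i \<inter> ?R = {0}"
    using G unfolding graded_space_def by blast+
  have "\<exists>y. y \<in> G i \<and> x - y \<in> ?R" using x unfolding V
  proof (induction rule: s.span_induct_alt)
    case base
    show ?case using s.subspace_0[OF sub] by (intro exI[of _ 0]) (simp add: s.span_zero)
  next
    case (step c u w)
    then obtain y j where y: "y \<in> G i" "w - y \<in> ?R" and u: "u \<in> G j" by blast
    show ?case
    proof (cases "j = i")
      case True
      then show ?thesis using y u
        by (intro exI[of _ "s c u + y"]) (auto intro!: s.subspace_add[OF sub] s.subspace_scale[OF sub])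
    next
      case False
      then have "s c u \<in> ?R" using u by (intro s.span_scale s.span_base) auto
      then have "s c u + (w - y) \<in> ?R" using y by (intro s.span_add)
      then show ?thesis using y by (intro exI[of _ y]) (simp add: algebra_simps)
    qed
  qed
  then obtain y0 where y0: "y0 \<in> G i" "x - y0 \<in> ?R" by blast
  have uniq: "y = y'" if "y \<in> G i" "x - y \<in> ?R" "y' \<in> G i" "x - y' \<in> ?R" for y y'
  proof -
    have "(x - y') - (x - y) \<in> ?R" by (rule s.span_diff[OF that(4,2)])
    moreover have "y - y' \<in> G i" using that by (intro s.subspace_diff[OF sub])
    ultimately have "y - y' \<in> G i \<inter> ?R" by simp
    then show ?thesis unfolding int by simp
  qed
  show P: "graded_part s G i x = y" if "y \<in> G i" "x - y \<in> ?R" for y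
    unfolding graded_part_def using that uniq by blast
  show "graded_part s G i x \<in> G i" "x - graded_part s G i x \<in> ?R"
    using P[OF y0] y0 by auto
qed

lemma graded_part_linear:
  assumes G: "graded_space s V G"
  shows "linear_on s V s (graded_part s G i)"
proof -
  interpret s: vector_space s using G by (simp add: graded_space_def)
  have sub: "s.subspace (G i)" for i using G by (simp add: graded_space_def)
  have subV: "s.subspace V" using G unfolding graded_space_def by (metis s.subspace_span)
  note mem = graded_part_in[OF G] graded_part_rest[OF G]
  show ?thesis
  proof (rule linear_onI)
    fix x y assume xy: "x \<in> V" "y \<in> V"
    have "(x - graded_part s G i x) + (y - graded_part s G i y) \<in> s.span (\<Union>j\<in>-{i}. G j)"
      using mem xy by (intro s.span_add) auto
    then show "graded_part s G i (x + y) = graded_part s G i x + graded_part s G i y"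
      using xy mem by (intro graded_part_unique[OF G s.subspace_add[OF subV]] s.subspace_add[OF sub])
        (auto simp: algebra_simps)
  next
    fix c x assume x: "x \<in> V"
    have "s c (x - graded_part s G i x) \<in> s.span (\<Union>j\<in>-{i}. G j)"
      using mem x by (intro s.span_scale) auto
    then show "graded_part s G i (s c x) = s c (graded_part s G i x)"
      using x mem by (intro graded_part_unique[OF G s.subspace_scale[OF subV]] s.subspace_scale[OF sub])
        (auto simp: s.scale_right_diff_distrib)
  qed
qed

lemma sum_apply: "(\<Sum>q\<in>Q. t q) x = (\<Sum>q\<in>Q. t q x)" for t :: "'i \<Rightarrow> 'x \<Rightarrow> 'k::comm_monoid_add"
  by (induction Q rule: infinite_finite_induct) auto

lemma Sum_any_apply:
  fixes t :: "'i \<Rightarrow> 'x \<Rightarrow> 'k::comm_monoid_add"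
  assumes "finitely_many t"
  shows "Sum_any t x = Sum_any (\<lambda>q. t q x)"
proof -
  have fin: "finite {q. t q \<noteq> 0}" using assms by (simp add: finitely_many_def)
  have sub: "{q. t q x \<noteq> 0} \<subseteq> {q. t q \<noteq> 0}" by auto
  show ?thesis
    unfolding Sum_any.expand_set[of t] sum_apply Sum_any.expand_superset[OF fin sub] ..
qed

lemma Sum_any_single:
  assumes "\<And>q. q \<noteq> q0 \<Longrightarrow> f q = 0"
  shows "Sum_any f = f q0"
proof -
  have "{q. f q \<noteq> 0} \<subseteq> {q0}" using assms by auto
  then show ?thesis by (simp add: Sum_any.expand_superset[of "{q0}"])
qed

lemma diff_apply3:
  fixes F G H :: "int \<Rightarrow> int \<Rightarrow> int \<Rightarrow> 'z::ab_group_add"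
  shows "(F - G - H) i j k = F i j k - G i j k - H i j k"
  by simp

section \<open>The Jacobi identity for tensor products\<close>

text \<open>The value of \<open>\<beta>\<close> on \<open>[a1 \<otimes> b1, [a2 \<otimes> b2, a3 \<otimes> b3]]\<close>, for the bracket
  \<open>[a \<otimes> b, a' \<otimes> b'] = p a a' \<otimes> q b b' - p a' a \<otimes> q b' b\<close>.  Stating the Jacobi identity through \<open>\<beta>\<close>, without
  a tensor product, lets it serve for \<open>A \<otimes> B\<close> and for \<open>A\<^sup>* \<otimes> B\<close> alike.\<close>

definition nested_bracket ::
  "('u \<Rightarrow> 'u \<Rightarrow> 'u) \<Rightarrow> ('b \<Rightarrow> 'b \<Rightarrow> 'b) \<Rightarrow> ('u \<Rightarrow> 'b \<Rightarrow> 'k::ab_group_add) \<Rightarrow>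
   'u \<Rightarrow> 'b \<Rightarrow> 'u \<Rightarrow> 'b \<Rightarrow> 'u \<Rightarrow> 'b \<Rightarrow> 'k"
  where "nested_bracket p q \<beta> a1 b1 a2 b2 a3 b3 =
    \<beta> (p a1 (p a2 a3)) (q b1 (q b2 b3)) - \<beta> (p (p a2 a3) a1) (q (q b2 b3) b1) -
    (\<beta> (p a1 (p a3 a2)) (q b1 (q b3 b2)) - \<beta> (p (p a3 a2) a1) (q (q b3 b2) b1))"

definition jacobi_sum ::
  "('u \<Rightarrow> 'u \<Rightarrow> 'u) \<Rightarrow> ('b \<Rightarrow> 'b \<Rightarrow> 'b) \<Rightarrow> ('u \<Rightarrow> 'b \<Rightarrow> 'k::ab_group_add) \<Rightarrow>
   'u \<Rightarrow> 'b \<Rightarrow> 'u \<Rightarrow> 'b \<Rightarrow> 'u \<Rightarrow> 'b \<Rightarrow> 'k"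
  where "jacobi_sum p q \<beta> a1 b1 a2 b2 a3 b3 =
    nested_bracket p q \<beta> a1 b1 a2 b2 a3 b3 + nested_bracket p q \<beta> a2 b2 a3 b3 a1 b1 +
    nested_bracket p q \<beta> a3 b3 a1 b1 a2 b2"

text \<open>The Novikov identities are relative to a carrier because they are applied to the linear functionals on
  \<open>A\<close> inside the type of all functions.\<close>

definition novikov_on :: "'u::ab_group_add set \<Rightarrow> ('u \<Rightarrow> 'u \<Rightarrow> 'u) \<Rightarrow> bool"
  where "novikov_on U p \<longleftrightarrow>
    (\<forall>a\<in>U. \<forall>b\<in>U. \<forall>c\<in>U. p (p a b) c - p a (p b c) = p (p b a) c - p b (p a c) \<and>
                         p (p a b) c = p (p a c) b)"

text \<open>Of the twelve double products of three elements on either side, those of the form \<open>(x y) z\<close> in \<open>U\<close> depend only on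
  \<open>x\<close> and those of the form \<open>x (y z)\<close> in \<open>B\<close> only on \<open>z\<close>.  The remaining identity on each side compares
  two products of the other form with these, and once it has been used all terms cancel.\<close>

lemma novikov_jacobi:
  fixes \<beta> :: "'u::ab_group_add \<Rightarrow> 'b::ab_group_add \<Rightarrow> 'k::field"
  assumes s: "module s" and U: "module.subspace s U"
    and closed: "\<And>a b. a \<in> U \<Longrightarrow> b \<in> U \<Longrightarrow> p a b \<in> U"
    and p: "novikov_on U p" and q: "right_novikov_algebra s' q"
    and \<beta>: "bilinear_on s U s' UNIV (*) \<beta>"
    and a: "a1 \<in> U" "a2 \<in> U" "a3 \<in> U"
  shows "jacobi_sum p q \<beta> a1 b1 a2 b2 a3 b3 = 0"
proof -
  interpret s: module s by (rule s)
  have q1: "q (q x y) z - q x (q y z) = q (q x z) y - q x (q z y)"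
    and q2: "q x (q y z) = q y (q x z)" for x y z
    using q by (auto simp: right_novikov_algebra_def)
  have p1: "p b (p a c) = p a (p b c) + p (p b a) c - p (p a b) c"
    and p2: "p (p a b) c = p (p a c) b" if "a \<in> U" "b \<in> U" "c \<in> U" for a b c
  proof -
    have e: "p (p a b) c - p a (p b c) = p (p b a) c - p b (p a c)"
      using p that unfolding novikov_on_def by blast
    show "p b (p a c) = p a (p b c) + p (p b a) c - p (p a b) c"
      using e by (simp add: algebra_simps)
    show "p (p a b) c = p (p a c) b" using p that unfolding novikov_on_def by blast
  qed
  have q1': "q (q x z) y = q (q x y) z - q x (q y z) + q x (q z y)" for x y z
    using q1[of x y z] by (simp add: algebra_simps)
  \<comment> \<open>Left symmetry exchanges the first two factors on the \<open>U\<close> side, right symmetry the last two on the \<open>B\<close> side.\<close>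
  have A: "\<beta> (p b (p a c)) y = \<beta> (p a (p b c)) y + \<beta> (p (p b a) c) y - \<beta> (p (p a b) c) y"
    if "a \<in> U" "b \<in> U" "c \<in> U" for a b c y
  proof -
    have l: "linear_on s U (*) (\<lambda>x. \<beta> x y)" using bilinear_onD(1)[OF \<beta>] by simp
    have m: "p a (p b c) \<in> U" "p (p b a) c \<in> U" "p (p a b) c \<in> U" using that closed by auto
    then have m': "p a (p b c) + p (p b a) c \<in> U" "p a (p b c) + p (p b a) c - p (p a b) c \<in> U"
      using s.subspace_add[OF U] s.subspace_diff[OF U] by auto
    show ?thesis
      unfolding p1[OF that] linear_onD_diff[OF l m'(1) m(3) m'(2)] linear_onD_add[OF l m(1,2)] ..
  qed
  have B: "\<beta> w (q (q x z) y) = \<beta> w (q (q x y) z) - \<beta> w (q x (q y z)) + \<beta> w (q x (q z y))"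
    if "w \<in> U" for w x y z
  proof -
    have l: "linear_on s' UNIV (*) (\<beta> w)" using bilinear_onD(2)[OF \<beta>] that by simp
    show ?thesis
      unfolding q1'[of x z y] using linear_onD_add[OF l] linear_onD_diff[OF l] by simp
  qed
  have Y: "p (p a2 a3) a1 = p (p a2 a1) a3" "p (p a3 a2) a1 = p (p a3 a1) a2" "p (p a1 a3) a2 = p (p a1 a2) a3"
    using p2 a by auto
  have YU: "p (p a1 a2) a3 \<in> U" "p (p a2 a1) a3 \<in> U" "p (p a3 a1) a2 \<in> U" using closed a by auto
  note A' = A[OF a(1,2,3)] A[OF a(1,3,2)] A[OF a(2,3,1)]
  note B' = B[OF YU(1), of b1 b3 b2] B[OF YU(2), of b2 b3 b1] B[OF YU(3), of b3 b2 b1]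
  show ?thesis
    unfolding jacobi_sum_def nested_bracket_def A' B' Y
    unfolding q2[of b2 b1 b3] q2[of b3 b1 b2] q2[of b3 b2 b1]
    by (simp add: algebra_simps)
qed

section \<open>Laurent polynomials detect the Novikov identities\<close>

text \<open>The multiplication and the form of \<open>k[t, 1/t]\<close> on a family \<open>t i\<close> of powers of \<open>t\<close>.\<close>

definition laurent_basis ::
  "('k::field_char_0 \<Rightarrow> 'b::ab_group_add \<Rightarrow> 'b) \<Rightarrow> ('b \<Rightarrow> 'b \<Rightarrow> 'b) \<Rightarrow> ('b \<Rightarrow> 'b \<Rightarrow> 'k) \<Rightarrow> (int \<Rightarrow> 'b) \<Rightarrow> bool"
  where "laurent_basis s q form t \<longleftrightarrow>
    bilinear_on s UNIV s UNIV s q \<and> bilinear_on s UNIV s UNIV (*) form \<and>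
    (\<forall>i j. q (t i) (t j) = s (of_int i) (t (i + j - 1))) \<and>
    (\<forall>i j. form (t i) (t j) = (if i + j + 1 = 0 then 1 else 0))"

lemma laurent_nested:
  fixes form :: "'b::ab_group_add \<Rightarrow> 'b \<Rightarrow> 'k::field_char_0"
  assumes t: "laurent_basis s q form t"
  shows "form (q (t i) (q (t j) (t k))) (t n) = (if i + j + k + n = 1 then of_int (i * j) else 0)"
    and "form (q (q (t i) (t j)) (t k)) (t n) = (if i + j + k + n = 1 then of_int (i * (i + j - 1)) else 0)"
proof -
  have q: "q (t i) (t j) = s (of_int i) (t (i + j - 1))"
    and f: "form (t i) (t j) = (if i + j + 1 = 0 then 1 else 0)" for i j
    using t by (simp_all add: laurent_basis_def)
  have q1: "q (s c x) y = s c (q x y)" and q2: "q x (s c y) = s c (q x y)"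
    and f1: "form (s c x) y = c * form x y" for c x y
    using t by (simp_all add: laurent_basis_def bilinear_on_def linear_on_def)
  show "form (q (t i) (q (t j) (t k))) (t n) = (if i + j + k + n = 1 then of_int (i * j) else 0)"
    by (simp add: q q2 f1 f mult.commute)
  show "form (q (q (t i) (t j)) (t k)) (t n) = (if i + j + k + n = 1 then of_int (i * (i + j - 1)) else 0)"
    by (simp add: q q1 f1 f)
qed

text \<open>The coefficient of every double product of \<open>a, b, c\<close> in the Jacobi sum at \<open>a t\<^sup>i, b t\<^sup>j, c t\<^sup>k\<close> is a quadratic
  polynomial in \<open>i, j, k\<close>, and \<open>t n\<close> picks out the only power of \<open>t\<close> that occurs.\<close>

lemma laurent_jacobi_novikov:
  fixes form :: "'b::ab_group_add \<Rightarrow> 'b \<Rightarrow> 'k::field_char_0"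
  assumes t: "laurent_basis s q form t"
    and J: "\<And>i j k n. jacobi_sum p q (\<lambda>x y. h x * form y (t n)) a (t i) b (t j) c (t k) = 0"
  shows "h (p (p a b) c) = h (p (p a c) b)"
    and "h (p (p a b) c) - h (p a (p b c)) = h (p (p b a) c) - h (p b (p a c))"
proof -
  note s = jacobi_sum_def nested_bracket_def laurent_nested[OF t]
  \<comment> \<open>At \<open>(-1, 0, 0)\<close> only \<open>(a b) c\<close> and \<open>(a c) b\<close> survive, with coefficients \<open>-i (i - 1)\<close> and \<open>i (i - 1)\<close>.\<close>
  have "2 * h (p (p a b) c) = 2 * h (p (p a c) b)"
    using J[where i = "-1" and j = 0 and k = 0 and n = 2] by (simp add: s algebra_simps)
  then show "h (p (p a b) c) = h (p (p a c) b)" by simp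
  \<comment> \<open>At \<open>(1, 1, 0)\<close> the four products in left symmetry are left over, each with coefficient 1 or -1.\<close>
  show "h (p (p a b) c) - h (p a (p b c)) = h (p (p b a) c) - h (p b (p a c))"
    using J[where i = 1 and j = 1 and k = 0 and n = "-1"] by (simp add: s algebra_simps)
qed

section \<open>The pairing of \<open>A \<otimes> B\<close> with \<open>A\<^sup>* \<otimes> B\<close>\<close>

text \<open>The parameter \<open>m\<close> is the degree of the form, so that \<open>B\<^sub>i\<close> is paired with \<open>B\<^bsub>-m-i\<^esub>\<close> and with no other component.\<close>

locale affinization =
  fixes sA :: "'k::field_char_0 \<Rightarrow> 'a::ab_group_add \<Rightarrow> 'a"
    and basisA :: "'a set"
    and circ :: "'a \<Rightarrow> 'a \<Rightarrow> 'a"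
    and DA :: "'a \<Rightarrow> ('k, 'a, 'a) tensor"
    and sB :: "'k \<Rightarrow> 'b::ab_group_add \<Rightarrow> 'b"
    and GB :: "int \<Rightarrow> 'b set"
    and dia :: "'b \<Rightarrow> 'b \<Rightarrow> 'b"
    and form :: "'b \<Rightarrow> 'b \<Rightarrow> 'k"
    and DB :: "'b \<Rightarrow> ('k, 'b) ctensor"
    and br :: "('k, 'a, 'b) tensor \<Rightarrow> ('k, 'a, 'b) tensor \<Rightarrow> ('k, 'a, 'b) tensor"
    and \<delta> :: "('k, 'a, 'b) tensor \<Rightarrow> ('k, ('k, 'a, 'b) tensor) ctensor"
    and m :: int
  assumes A_fin_dim: "finite_dimensional_vector_space sA basisA"
    and circ: "bilinear_on sA UNIV sA UNIV sA circ"
    and DA_linear: "linear_on sA UNIV fscale DA"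
    and DA_range: "\<And>a. DA a \<in> tensor_space sA UNIV sA UNIV"
    and B: "quadratic_graded_right_novikov_algebra sB GB dia form"
    and form_degree: "\<And>i j x y. i + j + m \<noteq> 0 \<Longrightarrow> x \<in> GB i \<Longrightarrow> y \<in> GB j \<Longrightarrow> form x y = 0"
    and DB_range: "\<And>a. DB a \<in> completed_square sB UNIV GB"
    and DB: "\<And>a b c. cpairing form (DB a) b c = form a (dia b c)"
    and br_bilinear: "bilinear_on fscale (aff_space sA sB) fscale (aff_space sA sB) fscale br"
    and br: "\<And>a1 b1 a2 b2. br (aff_tensor sA sB a1 b1) (aff_tensor sA sB a2 b2) =
               aff_tensor sA sB (circ a1 a2) (dia b1 b2) - aff_tensor sA sB (circ a2 a1) (dia b2 b1)"
    and \<delta>_linear: "linear_on fscale (aff_space sA sB) cscale \<delta>"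
    and \<delta>: "\<And>a b. \<delta> (aff_tensor sA sB a b) =
               bullet sA sB (DA a) (DB b) - cflip (bullet sA sB (DA a) (DB b))"
begin

sublocale A: finite_dimensional_vector_space sA basisA
  by (rule A_fin_dim)

sublocale B: vector_space sB
  using B by (simp add: quadratic_graded_right_novikov_algebra_def graded_right_novikov_algebra_def
      right_novikov_algebra_def)

abbreviation "L \<equiv> aff_space sA sB"
abbreviation "GL \<equiv> aff_grading sA sB GB"
abbreviation "tp \<equiv> aff_tensor sA sB"
abbreviation "dualA \<equiv> {\<phi>. linear_on sA UNIV (*) \<phi>}"

lemma B_right_novikov: "right_novikov_algebra sB dia"
  and B_graded: "graded_space sB UNIV GB"
  and B_fin: "\<exists>S. finite S \<and> GB i = B.span S"
  and dia_degree: "x \<in> GB i \<Longrightarrow> y \<in> GB j \<Longrightarrow> dia x y \<in> GB (i + j)"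
  using B by (simp_all add: quadratic_graded_right_novikov_algebra_def graded_right_novikov_algebra_def)

lemma form_bilinear: "bilinear_on sB UNIV sB UNIV (*) form"
  using B by (simp add: quadratic_graded_right_novikov_algebra_def)

lemma form_sym: "form a b = form b a"
  by (rule B[unfolded quadratic_graded_right_novikov_algebra_def, THEN conjunct2, THEN conjunct2, THEN conjunct1, rule_format])

lemma form_inv: "form (dia a b) c = - form a (dia b c + dia c b)"
  by (rule B[unfolded quadratic_graded_right_novikov_algebra_def, THEN conjunct2, THEN conjunct2, THEN conjunct2, THEN conjunct2, THEN conjunct2, rule_format])

lemma form_nondeg: "(\<And>b. form a b = 0) \<Longrightarrow> a = 0"
  using B by (simp add: quadratic_graded_right_novikov_algebra_def)

lemma dia_left_comm: "dia a (dia b c) = dia b (dia a c)"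
  using B_right_novikov by (simp add: right_novikov_algebra_def)

lemma GB_subspace: "B.subspace (GB i)"
  using B_graded by (simp add: graded_space_def)

lemma GB_span: "B.span (\<Union>i. GB i) = UNIV"
  using B_graded by (simp add: graded_space_def)

lemma form_linear: "linear_on sB UNIV (*) (\<lambda>b. form b c)" "linear_on sB UNIV (*) (form c)"
  using bilinear_onD[OF form_bilinear] by auto

lemma subspace_UNIV: "A.subspace UNIV" "B.subspace UNIV"
  by simp_all

lemma modules: "module sA" "module sB" "module (fscale :: 'k \<Rightarrow> ('x \<Rightarrow> 'k) \<Rightarrow> _)"
  by (unfold_locales)

lemma L_eq: "L = tensor_span sA UNIV sB UNIV UNIV UNIV"
  by (rule tensor_space_eq)

lemma GL_eq: "GL i = tensor_span sA UNIV sB UNIV UNIV (GB i)"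
  by (simp add: aff_grading_def tensor_span_def)

lemma GL_subset: "GL i \<subseteq> L"
  unfolding L_eq GL_eq tensor_span_def by (rule fun_space.span_mono) blast

lemma subspace_L: "fun_space.subspace L"
  unfolding L_eq by (rule subspace_tensor_span)

lemma subspace_GL: "fun_space.subspace (GL i)"
  unfolding GL_eq by (rule subspace_tensor_span)

lemma tp_in: "tp a b \<in> L" "b \<in> GB i \<Longrightarrow> tp a b \<in> GL i"
  unfolding L_eq GL_eq by (simp_all add: pure_in_tensor_span)

text \<open>Identities that are linear in an element of \<open>L\<close> need only be verified at pure tensors with a
  homogeneous factor in \<open>B\<close>, for which the sums over degrees in the cocycle condition collapse.\<close>

lemma L_span_tp: "L = fun_space.span {tp a b |a b. b \<in> (\<Union>i. GB i)}" (is "_ = fun_space.span ?S")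
proof
  show "fun_space.span ?S \<subseteq> L"
    by (rule fun_space.span_minimal[OF _ subspace_L]) (auto simp: tp_in)
  have "tp a b \<in> fun_space.span ?S" for a b
  proof -
    have lin: "linear_on sB UNIV fscale (tp a)"
      using bilinear_onD(2)[OF pure_tensor_bilinear[of sA UNIV sB UNIV]] by simp
    have "b \<in> B.span (\<Union>i. GB i)" by (simp add: GB_span)
    then show ?thesis
    proof (induction rule: B.span_induct_alt)
      case base
      show ?case unfolding linear_on_zero[OF lin UNIV_I] by (rule fun_space.span_zero)
    next
      case (step c x y)
      have "tp a (sB c x + y) = fscale c (tp a x) + tp a y"
        using linear_onD_add[OF lin] linear_onD_scale[OF lin] by simp
      moreover have "tp a x \<in> ?S" using step(1) by blast
      ultimately show ?case
        using step(2) by (simp only: fun_space.span_add fun_space.span_scale fun_space.span_base)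
    qed
  qed
  then show "L \<subseteq> fun_space.span ?S"
    unfolding tensor_space_def by (intro fun_space.span_minimal) (auto simp: fun_space.subspace_span)
qed

lemma L_span_GL: "L = fun_space.span (\<Union>i. GL i)"
proof
  show "fun_space.span (\<Union>i. GL i) \<subseteq> L"
    using GL_subset by (intro fun_space.span_minimal subspace_L) auto
  show "L \<subseteq> fun_space.span (\<Union>i. GL i)"
    unfolding L_span_tp using tp_in(2) by (intro fun_space.span_mono) auto
qed

lemma L_bitensor: "x \<in> L \<Longrightarrow> bitensor_on sA UNIV sB UNIV UNIV UNIV x"
  unfolding L_eq by (rule tensor_span_bitensor)

lemma GL_bitensor: "x \<in> GL i \<Longrightarrow> bitensor_on sA UNIV sB UNIV UNIV (GB i) x"
  unfolding GL_eq by (rule tensor_span_bitensor)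

text \<open>The functional \<open>\<phi> \<otimes> c\<close> on \<open>A \<otimes> B\<close>.  An element of \<open>A \<otimes> B\<close> is itself a function on bilinear forms, so the
  pairing is an evaluation.\<close>

definition pairing :: "('a \<Rightarrow> 'k) \<Rightarrow> 'b \<Rightarrow> ('k, 'a, 'b) tensor \<Rightarrow> 'k"
  where "pairing \<phi> c x = x (\<lambda>a b. \<phi> a * form b c)"

lemma pairing_form: "\<phi> \<in> dualA \<Longrightarrow> bilinear_on sA UNIV sB UNIV (*) (\<lambda>a b. \<phi> a * form b c)"
  by (rule bilinear_on_prod[OF _ form_linear(1)]) simp

lemma pairing_tp: "\<phi> \<in> dualA \<Longrightarrow> pairing \<phi> c (tp a b) = \<phi> a * form b c"
  using pairing_form by (simp add: pairing_def pure_tensor_def)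

lemma pairing_linear: "linear_on fscale U (*) (pairing \<phi> c)"
  by (rule linear_onI) (simp_all add: pairing_def fscale_apply)

lemma pairing_diff: "pairing \<phi> c (x - y) = pairing \<phi> c x - pairing \<phi> c y"
  by (simp add: pairing_def)

lemma pairing_degree:
  assumes "\<phi> \<in> dualA" "c \<in> GB k" "x \<in> GL j" "j + k + m \<noteq> 0"
  shows "pairing \<phi> c x = 0"
  unfolding pairing_def
  by (rule bitensor_vanish[OF GL_bitensor[OF assms(3)] pairing_form[OF assms(1)]])
    (use form_degree[OF assms(4)] assms(2) in auto)

lemma pairing_bilinear:
  assumes "x \<in> L"
  shows "bilinear_on fscale dualA sB UNIV (*) (\<lambda>\<phi> c. pairing \<phi> c x)"
proof -
  note T = L_bitensor[OF assms]
  have f: "form b (c + d) = form b c + form b d" "form b (sB k c) = k * form b c" for b c d k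
    using linear_onD_add[OF form_linear(2)] linear_onD_scale[OF form_linear(2)] by auto
  show ?thesis
    unfolding bilinear_on_def
  proof (intro conjI ballI linear_onI)
    fix c \<phi> \<psi> assume p: "\<phi> \<in> dualA" "\<psi> \<in> dualA"
    show "pairing (\<phi> + \<psi>) c x = pairing \<phi> c x + pairing \<psi> c x"
      using bitensor_add[OF T pairing_form[OF p(1)] pairing_form[OF p(2)]] by (simp add: pairing_def distrib_right)
  next
    fix c k \<phi> assume p: "\<phi> \<in> dualA"
    show "pairing (fscale k \<phi>) c x = k * pairing \<phi> c x"
      using bitensor_scale[OF T pairing_form[OF p]] by (simp add: pairing_def fscale_apply mult.assoc)
  next
    fix c d \<phi> assume p: "\<phi> \<in> dualA"
    show "pairing \<phi> (c + d) x = pairing \<phi> c x + pairing \<phi> d x"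
      using bitensor_add[OF T pairing_form[OF p] pairing_form[OF p]] by (simp add: pairing_def f distrib_left)
  next
    fix c k \<phi> assume p: "\<phi> \<in> dualA"
    show "pairing \<phi> (sB k c) x = k * pairing \<phi> c x"
      using bitensor_scale[OF T pairing_form[OF p]] by (simp add: pairing_def f mult.left_commute)
  qed
qed

lemma frame_A: "has_dual_frame sA UNIV dualA"
proof (rule has_dual_frame_span[OF A.vector_space_axioms A.finite_Basis A.span_Basis[symmetric]])
  show "fun_space.subspace dualA"
    by (rule fun_space.subspaceI) (auto simp: linear_on_def fscale_apply algebra_simps)
  show "\<exists>f\<in>dualA. f v \<noteq> 0" if "v \<noteq> 0" for v
    using separating_functional[OF A.vector_space_axioms that] by (metis mem_Collect_eq)
qed simp

text \<open>The form restricts to a perfect pairing of \<open>B\<^sub>i\<close> and \<open>B\<^bsub>-m-i\<^esub>\<close>: a vector of \<open>B\<^sub>i\<close> orthogonal to \<open>B\<^bsub>-m-i\<^esub>\<close> is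
  orthogonal to all of \<open>B\<close> for reasons of degree.\<close>

lemma frame_B: "has_dual_frame sB (GB i) {\<lambda>b. form b c |c. c \<in> GB (- m - i)}"
proof -
  let ?F = "{\<lambda>b. form b c |c. c \<in> GB (- m - i)}"
  obtain S where S: "finite S" "GB i = B.span S" using B_fin by blast
  have f: "form b (c + d) = form b c + form b d" "form b (sB k c) = k * form b c" for b c d k
    using linear_onD_add[OF form_linear(2)] linear_onD_scale[OF form_linear(2)] by auto
  show ?thesis
  proof (rule has_dual_frame_span[OF B.vector_space_axioms S])
    show "fun_space.subspace ?F"
    proof (rule fun_space.subspaceI)
      show "0 \<in> ?F"
        using B.subspace_0[OF GB_subspace] linear_on_zero[OF form_linear(2)] by fastforce
      show "f + g \<in> ?F"
        if fg: "f \<in> ?F" "g \<in> ?F" for f g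
      proof -
        obtain c d where "c \<in> GB (- m - i)" "d \<in> GB (- m - i)" "f = (\<lambda>b. form b c)" "g = (\<lambda>b. form b d)"
          using fg by blast
        then show ?thesis
          using B.subspace_add[OF GB_subspace] by (auto simp: f intro!: exI[of _ "c + d"])
      qed
      show "fscale k g \<in> ?F"
        if g: "g \<in> ?F" for k g
      proof -
        obtain c where "c \<in> GB (- m - i)" "g = (\<lambda>b. form b c)" using g by blast
        then show ?thesis
          using B.subspace_scale[OF GB_subspace] by (auto simp: f fscale_def intro!: exI[of _ "sB k c"])
      qed
    qed
    show "linear_on sB (GB i) (*) f" if "f \<in> ?F" for f
      using that form_linear(1) by (auto simp: linear_on_def)
    show "\<exists>f\<in>?F. f v \<noteq> 0" if v: "v \<in> GB i" "v \<noteq> 0" for v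
    proof (rule ccontr)
      assume none: "\<not> ?thesis"
      have 0: "form v c = 0" if c: "c \<in> GB (- m - i)" for c
      proof (rule ccontr)
        assume "form v c \<noteq> 0"
        with none c show False by auto
      qed
      have "form v c = 0" for c
      proof -
        have "c \<in> B.span (\<Union>j. GB j)" by (simp add: GB_span)
        then show ?thesis
        proof (induction rule: B.span_induct_alt)
          case base
          show ?case using linear_on_zero[OF form_linear(2)] by simp
        next
          case (step k x y)
          then obtain j where j: "x \<in> GB j" by blast
          have "form v x = 0"
            using 0[of x] form_degree[OF _ v(1) j] j by (cases "j = - m - i") auto
          then show ?case using step by (simp add: f)
        qed
      qed
      then show False using form_nondeg[of v] v(2) by simp
    qed
  qed
qed

definition pairings :: "int \<Rightarrow> (('k, 'a, 'b) tensor \<Rightarrow> 'k) set"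
  where "pairings i = {pairing \<phi> c |\<phi> c. \<phi> \<in> dualA \<and> c \<in> GB (- m - i)}"

lemma frame_L: "has_dual_frame fscale (GL i) (pairings i)"
proof -
  let ?F = "{\<lambda>T. T (\<lambda>x y. f x * g y) |f g. f \<in> dualA \<and> g \<in> {\<lambda>b. form b c |c. c \<in> GB (- m - i)}} ::
    (('k, 'a, 'b) tensor \<Rightarrow> 'k) set"
  have "has_dual_frame fscale (GL i)
      ?F"
    unfolding GL_eq
    by (rule has_dual_frame_tensor[OF modules(1) subspace_UNIV(1) subset_UNIV frame_A
          modules(2) subspace_UNIV(2) subset_UNIV frame_B]) (auto simp: form_linear)
  then show ?thesis
  proof (rule has_dual_frame_mono)
    show "?F \<subseteq> pairings i"
    proof
      fix h assume "h \<in> ?F"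
      then obtain f c where "f \<in> dualA" "c \<in> GB (- m - i)" "h = (\<lambda>T. T (\<lambda>x y. f x * form y c))" by auto
      moreover from this have "h = pairing f c" by (simp add: pairing_def[abs_def])
      ultimately show "h \<in> pairings i" unfolding pairings_def by blast
    qed
  qed
qed

lemma pairings_linear: "f \<in> pairings i \<Longrightarrow> linear_on fscale L (*) f"
  by (auto simp: pairings_def pairing_linear)

lemma L2_eq_zero:
  assumes "bitensor_on fscale L fscale L (GL i) (GL j) T"
    and "\<And>\<phi> c \<psi> d. \<phi> \<in> dualA \<Longrightarrow> \<psi> \<in> dualA \<Longrightarrow> c \<in> GB (- m - i) \<Longrightarrow> d \<in> GB (- m - j) \<Longrightarrow>
           T (\<lambda>x y. pairing \<phi> c x * pairing \<psi> d y) = 0"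
  shows "T = 0"
  by (rule bitensor_eq_zero[OF assms(1) modules(3) subspace_L GL_subset frame_L
        modules(3) subspace_L GL_subset frame_L pairings_linear pairings_linear])
    (auto simp: pairings_def intro!: assms(2))

lemma L3_eq_zero:
  assumes "tritensor_on fscale L (GL i) (GL j) (GL k) T"
    and "\<And>\<phi> c \<psi> d \<chi> e. \<phi> \<in> dualA \<Longrightarrow> \<psi> \<in> dualA \<Longrightarrow> \<chi> \<in> dualA \<Longrightarrow>
           c \<in> GB (- m - i) \<Longrightarrow> d \<in> GB (- m - j) \<Longrightarrow> e \<in> GB (- m - k) \<Longrightarrow>
           T (\<lambda>x y z. pairing \<phi> c x * (pairing \<psi> d y * pairing \<chi> e z)) = 0"
  shows "T = 0"
  by (rule tritensor_eq_zero[OF assms(1) modules(3) subspace_L GL_subset GL_subset GL_subset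
        frame_L frame_L frame_L])
    (auto simp: pairings_def pairing_linear intro!: assms(2))

lemma A2_eq_zero:
  assumes "bitensor_on sA UNIV sA UNIV UNIV UNIV T"
    and "\<And>\<phi> \<psi>. \<phi> \<in> dualA \<Longrightarrow> \<psi> \<in> dualA \<Longrightarrow> T (\<lambda>x y. \<phi> x * \<psi> y) = 0"
  shows "T = 0"
  by (rule bitensor_eq_zero[OF assms(1) modules(1) subspace_UNIV(1) subset_UNIV frame_A
        modules(1) subspace_UNIV(1) subset_UNIV frame_A]) (auto intro!: assms(2))

lemma A3_eq_zero:
  assumes "tritensor_on sA UNIV UNIV UNIV UNIV T"
    and "\<And>\<phi> \<psi> \<chi>. \<phi> \<in> dualA \<Longrightarrow> \<psi> \<in> dualA \<Longrightarrow> \<chi> \<in> dualA \<Longrightarrow>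
           T (\<lambda>x y z. \<phi> x * (\<psi> y * \<chi> z)) = 0"
  shows "T = 0"
  by (rule tritensor_eq_zero[OF assms(1) modules(1) subspace_UNIV(1) subset_UNIV subset_UNIV subset_UNIV
        frame_A frame_A frame_A]) (auto intro!: assms(2))

lemma pairing_span_other:
  assumes "x \<in> fun_space.span (\<Union>j\<in>-{i}. GL j)" "\<phi> \<in> dualA" "c \<in> GB (- m - i)"
  shows "pairing \<phi> c x = 0"
  using assms(1)
proof (induction rule: fun_space.span_induct_alt)
  case base
  show ?case by (simp add: pairing_def)
next
  case (step k x y)
  then obtain j where j: "j \<noteq> i" "x \<in> GL j" by blast
  have "pairing \<phi> c x = 0" by (rule pairing_degree[OF assms(2,3) j(2)]) (use j(1) in simp)
  then show ?case
    using step by (simp add: pairing_def fscale_apply)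
qed

text \<open>The sum of the \<open>L\<^sub>i\<close> is direct because the functionals \<open>\<phi> \<otimes> c\<close> with \<open>c \<in> B\<^bsub>-m-i\<^esub>\<close> vanish on all the other
  components and separate the elements of \<open>L\<^sub>i\<close>.\<close>

lemma L_graded: "graded_space fscale L GL"
  unfolding graded_space_def
proof (intro conjI allI)
  show "vector_space (fscale :: 'k \<Rightarrow> ('k, 'a, 'b) tensor \<Rightarrow> _)" by (rule vector_space_fscale)
  show "fun_space.subspace (GL i)" for i by (rule subspace_GL)
  show "L = fun_space.span (\<Union>i. GL i)" by (rule L_span_GL)
  show "GL i \<inter> fun_space.span (\<Union>j\<in>-{i}. GL j) = {0}" for i
  proof (intro equalityI subsetI)
    fix x assume x: "x \<in> GL i \<inter> fun_space.span (\<Union>j\<in>-{i}. GL j)"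
    have "x = 0"
    proof (rule bitensor_eq_zero[OF GL_bitensor modules(1) subspace_UNIV(1) subset_UNIV frame_A
          modules(2) subspace_UNIV(2) subset_UNIV frame_B])
      show "x \<in> GL i" using x by simp
      fix f g assume "f \<in> dualA" "g \<in> {\<lambda>b. form b c |c. c \<in> GB (- m - i)}"
      then show "x (\<lambda>x y. f x * g y) = 0"
        using x pairing_span_other[of x i f] by (auto simp: pairing_def)
    qed (auto simp: form_linear)
    then show "x \<in> {0}" by simp
  next
    fix x :: "('k, 'a, 'b) tensor" assume "x \<in> {0}"
    then show "x \<in> GL i \<inter> fun_space.span (\<Union>j\<in>-{i}. GL j)"
      using fun_space.subspace_0[OF subspace_GL] fun_space.span_zero by blast
  qed
qed

section \<open>The cobracket as the transpose of the bracket of \<open>A\<^sup>* \<otimes> B\<close>\<close>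

text \<open>The product on \<open>A\<^sup>*\<close> transposed to the coproduct of \<open>A\<close>.\<close>

definition dual_prod :: "('a \<Rightarrow> 'k) \<Rightarrow> ('a \<Rightarrow> 'k) \<Rightarrow> 'a \<Rightarrow> 'k"
  where "dual_prod \<phi> \<psi> = (\<lambda>a. DA a (\<lambda>x y. \<phi> x * \<psi> y))"

lemma DA_bitensor: "bitensor_on sA UNIV sA UNIV UNIV UNIV (DA a)"
  using DA_range[of a] unfolding tensor_space_eq by (rule tensor_span_bitensor)

lemma DB_bitensor: "bitensor_on sB UNIV sB UNIV (GB i) (GB j) (DB b i j)"
  using DB_range[of b] unfolding completed_square_def tensor_span_def[symmetric]
  by (simp add: tensor_span_bitensor)

lemma dual_prod_closed: "dual_prod \<phi> \<psi> \<in> dualA"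
  using DA_linear by (simp add: linear_on_def dual_prod_def fscale_apply)

text \<open>In the pairing with \<open>c \<otimes> d\<close>, the homogeneity of \<open>c\<close> and \<open>d\<close> leaves only one of the infinitely many components
  of \<open>\<Delta>\<^sub>B b\<close>; so the defining property of \<open>\<Delta>\<^sub>B\<close> holds component by component.\<close>

lemma DB_eval:
  assumes c: "c \<in> GB (- m - i)" and d: "d \<in> GB (- m - j)"
  shows "DB b i j (\<lambda>x y. form x c * form y d) = form b (dia c d)"
proof -
  have z: "DB b i' j' (\<lambda>x y. form x c * form y d) = 0" if "(i', j') \<noteq> (i, j)" for i' j'
  proof (rule bitensor_vanish[OF DB_bitensor bilinear_on_prod[OF form_linear(1) form_linear(1)]])
    fix x y assume xy: "x \<in> GB i'" "y \<in> GB j'"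
    show "form x c * form y d = 0"
      using that form_degree[OF _ xy(1) c] form_degree[OF _ xy(2) d] by (cases "i = i'") auto
  qed
  have "cpairing form (DB b) c d = (case (i, j) of (i, j) \<Rightarrow> DB b i j (\<lambda>x y. form x c * form y d))"
    unfolding cpairing_def using z by (intro Sum_any_single) auto
  then show ?thesis using DB by simp
qed

lemma bullet_eval:
  assumes c: "c \<in> GB (- m - i)" and d: "d \<in> GB (- m - j)" and \<phi>: "\<phi> \<in> dualA" and \<psi>: "\<psi> \<in> dualA"
  shows "bullet sA sB (DA a) (DB b) i j (\<lambda>x y. pairing \<phi> c x * pairing \<psi> d y) = dual_prod \<phi> \<psi> a * form b (dia c d)"
proof -
  have "DB b i j (\<lambda>b1 b2. pairing \<phi> c (tp a1 b1) * pairing \<psi> d (tp a2 b2)) = form b (dia c d) * (\<phi> a1 * \<psi> a2)" for a1 a2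
  proof -
    have "(\<lambda>b1 b2. pairing \<phi> c (tp a1 b1) * pairing \<psi> d (tp a2 b2))
        = (\<lambda>b1 b2. (\<phi> a1 * \<psi> a2) * (form b1 c * form b2 d))"
      by (simp add: pairing_tp \<phi>[simplified] \<psi>[simplified] mult_ac)
    then show ?thesis
      using bitensor_scale[OF DB_bitensor bilinear_on_prod[OF form_linear(1) form_linear(1)], of b i j "\<phi> a1 * \<psi> a2"]
        DB_eval[OF c d, of b] by simp
  qed
  then have "DA a (\<lambda>a1 a2. DB b i j (\<lambda>b1 b2. pairing \<phi> c (tp a1 b1) * pairing \<psi> d (tp a2 b2)))
      = form b (dia c d) * dual_prod \<phi> \<psi> a"
    using bitensor_scale[OF DA_bitensor bilinear_on_prod] \<phi> \<psi> by (simp add: dual_prod_def)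
  moreover have "bilinear_on fscale L fscale L (*) (\<lambda>x y. pairing \<phi> c x * pairing \<psi> d y)"
    by (intro bilinear_on_prod pairing_linear)
  ultimately show ?thesis by (simp add: bullet_def mult.commute)
qed

text \<open>The bracket of \<open>\<phi> \<otimes> c\<close> and \<open>\<psi> \<otimes> d\<close> in \<open>A\<^sup>* \<otimes> B\<close>, as a functional on \<open>L\<close>.\<close>

definition dual_bracket :: "('a \<Rightarrow> 'k) \<Rightarrow> 'b \<Rightarrow> ('a \<Rightarrow> 'k) \<Rightarrow> 'b \<Rightarrow> ('k, 'a, 'b) tensor \<Rightarrow> 'k"
  where "dual_bracket \<phi> c \<psi> d x = pairing (dual_prod \<phi> \<psi>) (dia c d) x - pairing (dual_prod \<psi> \<phi>) (dia d c) x"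

lemma dual_bracket_linear: "linear_on fscale U (*) (dual_bracket \<phi> c \<psi> d)"
  by (rule linear_onI) (simp_all add: dual_bracket_def pairing_def fscale_apply algebra_simps)

lemma dual_bracket_swap: "dual_bracket \<psi> d \<phi> c x = - dual_bracket \<phi> c \<psi> d x"
  by (simp add: dual_bracket_def)

lemma \<delta>_add: "x \<in> L \<Longrightarrow> y \<in> L \<Longrightarrow> \<delta> (x + y) i j = \<delta> x i j + \<delta> y i j"
  using linear_onD_add[OF \<delta>_linear] by simp

lemma \<delta>_scale: "x \<in> L \<Longrightarrow> \<delta> (fscale c x) i j = fscale c (\<delta> x i j)"
  using linear_onD_scale[OF \<delta>_linear] by (simp add: cscale_def)

lemma \<delta>_component_linear: "linear_on fscale L fscale (\<lambda>x. \<delta> x i j)"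
  by (rule linear_onI) (simp_all add: \<delta>_add \<delta>_scale)

text \<open>The cobracket is the transpose of the bracket of \<open>A\<^sup>* \<otimes> B\<close>.  Every later statement about \<open>\<delta>\<close> is obtained
  from this one.\<close>

lemma cobracket_eval:
  assumes x: "x \<in> L" and c: "c \<in> GB (- m - i)" and d: "d \<in> GB (- m - j)"
    and \<phi>: "\<phi> \<in> dualA" and \<psi>: "\<psi> \<in> dualA"
  shows "\<delta> x i j (\<lambda>x y. pairing \<phi> c x * pairing \<psi> d y) = dual_bracket \<phi> c \<psi> d x"
proof (rule linear_on_span_eq[OF modules(3) _ dual_bracket_linear])
  show "linear_on fscale L (*) (\<lambda>x. \<delta> x i j (\<lambda>x y. pairing \<phi> c x * pairing \<psi> d y))"
    by (rule linear_onI) (simp_all add: \<delta>_add \<delta>_scale fscale_apply)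
  show "module ((*) :: 'k \<Rightarrow> 'k \<Rightarrow> 'k)"
    using vector_space_mult by (simp add: module_iff_vector_space)
  show "x \<in> L" by (rule x)
  show "L = fun_space.span {tp a b |a b. b \<in> (\<Union>i. GB i)}" by (rule L_span_tp)
  fix z assume "z \<in> {tp a b |a b. b \<in> (\<Union>i. GB i)}"
  then obtain a b where z: "z = tp a b" by blast
  have "\<delta> z i j (\<lambda>x y. pairing \<phi> c x * pairing \<psi> d y) =
      bullet sA sB (DA a) (DB b) i j (\<lambda>x y. pairing \<phi> c x * pairing \<psi> d y) -
      bullet sA sB (DA a) (DB b) j i (\<lambda>x y. pairing \<psi> d x * pairing \<phi> c y)"
    by (simp add: z \<delta> cflip_def tensor_flip_def mult.commute)
  also have "\<dots> = dual_bracket \<phi> c \<psi> d z"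
    unfolding bullet_eval[OF c d \<phi> \<psi>] bullet_eval[OF d c \<psi> \<phi>] dual_bracket_def z
    using pairing_tp[OF dual_prod_closed] by simp
  finally show "\<delta> z i j (\<lambda>x y. pairing \<phi> c x * pairing \<psi> d y) = dual_bracket \<phi> c \<psi> d z" .
qed

lemma bullet_in:
  assumes P: "P \<in> tensor_span sA UNIV sA UNIV UNIV UNIV" and Q: "Q i j \<in> tensor_span sB UNIV sB UNIV (GB i) (GB j)"
  shows "bullet sA sB P Q i j \<in> tensor_span fscale L fscale L (GL i) (GL j)"
proof -
  let ?S = "tensor_span fscale L fscale L (GL i) (GL j)"
  let ?bil = "bilinear_on fscale L fscale L (*)"
  note sub = subspace_tensor_span[of fscale L fscale L "GL i" "GL j"]
  have lin: "linear_on sA UNIV fscale (\<lambda>a. tp a b)" "linear_on sB UNIV fscale (tp a)" for a b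
    using bilinear_onD[OF pure_tensor_bilinear[of sA UNIV sB UNIV]] by simp_all
  have bB: "bilinear_on sB UNIV sB UNIV (*) (\<lambda>b1 b2. \<beta> (tp a1 b1) (tp a2 b2))" if "?bil \<beta>" for a1 a2 \<beta>
    by (rule bilinear_on_comp[OF that lin(2) _ lin(2)]) (auto simp: tp_in)
  have bA: "bilinear_on sA UNIV sA UNIV (*) (\<lambda>a1 a2. \<beta> (tp a1 b1) (tp a2 b2))" if "?bil \<beta>" for b1 b2 \<beta>
    by (rule bilinear_on_comp[OF that lin(1) _ lin(1)]) (auto simp: tp_in)
  \<comment> \<open>The two stages of the bullet product: \<open>R\<close> inserts fixed \<open>a1\<close>, \<open>a2\<close> next to the factors of \<open>Q'\<close>, and \<open>R2\<close> then runs over the factors of \<open>P'\<close>.\<close>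
  define R where "R Q' a1 a2 = (\<lambda>\<beta>. if ?bil \<beta> then Q' (\<lambda>b1 b2. \<beta> (tp a1 b1) (tp a2 b2)) else 0)"
    for Q' :: "('k, 'b, 'b) tensor" and a1 a2
  define R2 where "R2 P' Q' = (\<lambda>\<beta>. if ?bil \<beta> then P' (\<lambda>a1 a2. Q' (\<lambda>b1 b2. \<beta> (tp a1 b1) (tp a2 b2))) else 0)"
    for P' :: "('k, 'a, 'a) tensor" and Q' :: "('k, 'b, 'b) tensor"
  have inner: "R Q' a1 a2 \<in> ?S" if "Q' \<in> tensor_span sB UNIV sB UNIV (GB i) (GB j)" for Q' a1 a2
    using that
  proof (induction rule: tensor_span_induct)
    case zero
    have "R 0 a1 a2 = 0" by (rule ext) (simp add: R_def)
    then show ?case by (simp only: fun_space.subspace_0[OF sub])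
  next
    case (step c b1 b2 Q')
    have "R (fscale c (pure_tensor sB UNIV sB UNIV b1 b2) + Q') a1 a2
        = fscale c (pure_tensor fscale L fscale L (tp a1 b1) (tp a2 b2)) + R Q' a1 a2"
      using bB by (intro ext) (simp add: R_def fscale_apply pure_tensor_def)
    also have "\<dots> \<in> ?S"
      by (intro fun_space.subspace_add[OF sub] fun_space.subspace_scale[OF sub] pure_in_tensor_span
          tp_in(2) step)
    finally show ?case .
  qed
  have bQ: "bilinear_on sA UNIV sA UNIV (*) (\<lambda>a1 a2. Q i j (\<lambda>b1 b2. \<beta> (tp a1 b1) (tp a2 b2)))" if \<beta>: "?bil \<beta>" for \<beta>
    using Q
  proof (induction rule: tensor_span_induct)
    case zero
    show ?case using bilinear_on_zero by simp
  next
    case (step c b1 b2 Q')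
    show ?case
      using bilinear_on_add[OF bilinear_on_scale[OF bA[OF \<beta>, of b1 b2], of c] step(4)] bB[OF \<beta>]
      by (simp add: fscale_apply pure_tensor_def)
  qed
  have "R2 P (Q i j) \<in> ?S"
    using P
  proof (induction rule: tensor_span_induct)
    case zero
    have "R2 0 (Q i j) = 0" by (rule ext) (simp add: R2_def)
    then show ?case by (simp only: fun_space.subspace_0[OF sub])
  next
    case (step c a1 a2 P)
    have "R2 (fscale c (pure_tensor sA UNIV sA UNIV a1 a2) + P) (Q i j) = fscale c (R (Q i j) a1 a2) + R2 P (Q i j)"
      using bQ by (intro ext) (simp add: R_def R2_def fscale_apply pure_tensor_def)
    also have "\<dots> \<in> ?S"
      by (intro fun_space.subspace_add[OF sub] fun_space.subspace_scale[OF sub] inner Q step)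
    finally show ?case .
  qed
  then show ?thesis by (simp add: R2_def bullet_def)
qed

lemma \<delta>_in:
  assumes "x \<in> L"
  shows "\<delta> x i j \<in> tensor_span fscale L fscale L (GL i) (GL j)"
proof -
  note sub = subspace_tensor_span[of fscale L fscale L "GL i" "GL j"]
  have base: "\<delta> (tp a b) i j \<in> tensor_span fscale L fscale L (GL i) (GL j)" for a b
  proof -
    have "bullet sA sB (DA a) (DB b) i j \<in> tensor_span fscale L fscale L (GL i) (GL j)" for i j
      using DA_range[of a] DB_range[of b]
      by (intro bullet_in) (simp_all add: tensor_space_eq completed_square_def tensor_span_def)
    then show ?thesis
      unfolding \<delta> cflip_def by (simp add: fun_space.subspace_diff[OF sub] tensor_flip_span)
  qed
  have "x \<in> tensor_span sA UNIV sB UNIV UNIV UNIV" using assms L_eq by simp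
  then show ?thesis
  proof (induction rule: tensor_span_induct)
    case zero
    show ?case
      by (simp only: linear_on_zero[OF \<delta>_component_linear fun_space.subspace_0[OF subspace_L]]
        fun_space.subspace_0[OF sub])
  next
    case (step c a b y)
    then show ?case
      using base fun_space.subspace_scale[OF subspace_L] tp_in(1)
      by (simp only: L_eq[symmetric] \<delta>_add \<delta>_scale fun_space.subspace_add[OF sub] fun_space.subspace_scale[OF sub])
  qed
qed

lemma \<delta>_bitensor: "x \<in> L \<Longrightarrow> bitensor_on fscale L fscale L (GL i) (GL j) (\<delta> x i j)"
  by (rule tensor_span_bitensor[OF \<delta>_in])

text \<open>On \<open>L\<^sub>p\<close> the component of \<open>\<delta>\<close> in bidegree \<open>(i, j)\<close> vanishes unless \<open>i + j = p - m\<close>, since it is tested by brackets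
  of functionals that live in degree \<open>-2m - i - j\<close> of \<open>B\<close>.  This makes all the sums over degrees finite.\<close>

lemma \<delta>_finite:
  assumes "x \<in> L"
  shows "finite {q. \<delta> x q j \<noteq> 0} \<and> finite {q. \<delta> x j q \<noteq> 0}"
proof -
  have base: "\<delta> x i j = 0" if x: "x \<in> GL p" and ij: "i + j \<noteq> p - m" for x p i j
  proof (rule L2_eq_zero)
    have xL: "x \<in> L" using x GL_subset by blast
    show "bitensor_on fscale L fscale L (GL i) (GL j) (\<delta> x i j)" by (rule \<delta>_bitensor[OF xL])
    fix \<phi> c \<psi> d assume h: "\<phi> \<in> dualA" "\<psi> \<in> dualA" "c \<in> GB (- m - i)" "d \<in> GB (- m - j)"
    have "dual_bracket \<phi> c \<psi> d x = 0"
      unfolding dual_bracket_def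
      using ij pairing_degree[OF dual_prod_closed dia_degree[OF h(3,4)] x] pairing_degree[OF dual_prod_closed dia_degree[OF h(4,3)] x]
      by simp
    then show "\<delta> x i j (\<lambda>x y. pairing \<phi> c x * pairing \<psi> d y) = 0"
      using cobracket_eval[OF xL h(3,4,1,2)] by simp
  qed
  have "x \<in> L \<and> finite {q. \<delta> x q j \<noteq> 0} \<and> finite {q. \<delta> x j q \<noteq> 0}"
    using assms unfolding L_span_GL
  proof (induction rule: fun_space.span_induct_alt)
    case base
    have "\<delta> 0 i j = 0" for i j
      by (rule linear_on_zero[OF \<delta>_component_linear fun_space.subspace_0[OF subspace_L]])
    then have "{q. \<delta> 0 q j \<noteq> 0} = {}" "{q. \<delta> 0 j q \<noteq> 0} = {}" by blast+
    then show ?case by (simp only: fun_space.span_zero finite.emptyI simp_thms)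
  next
    case (step c x y)
    then obtain p where p: "x \<in> GL p" by blast
    then have xL: "x \<in> L" and cx: "fscale c x \<in> L" using GL_subset fun_space.subspace_scale[OF subspace_L] by blast+
    have yL: "y \<in> L" using step(2) unfolding L_span_GL by blast
    have e: "\<delta> (fscale c x + y) i j = fscale c (\<delta> x i j) + \<delta> y i j" for i j
      by (simp only: \<delta>_add[OF cx yL] \<delta>_scale[OF xL])
    have z: "\<delta> (fscale c x + y) i j = 0" if "i + j \<noteq> p - m" "\<delta> y i j = 0" for i j
      unfolding e base[OF p that(1)] that(2) by simp
    have "{q. \<delta> (fscale c x + y) q j \<noteq> 0} \<subseteq> insert (p - m - j) {q. \<delta> y q j \<noteq> 0}"
      "{q. \<delta> (fscale c x + y) j q \<noteq> 0} \<subseteq> insert (p - m - j) {q. \<delta> y j q \<noteq> 0}"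
      using z by force+
    moreover have "finite (insert (p - m - j) {q. \<delta> y q j \<noteq> 0})" "finite (insert (p - m - j) {q. \<delta> y j q \<noteq> 0})"
      using step(2) by blast+
    ultimately have "finite {q. \<delta> (fscale c x + y) q j \<noteq> 0}" "finite {q. \<delta> (fscale c x + y) j q \<noteq> 0}"
      using finite_subset by blast+
    moreover have "fscale c x + y \<in> L" by (rule fun_space.subspace_add[OF subspace_L cx yL])
    ultimately show ?case unfolding L_span_GL by blast
  qed
  then show ?thesis by blast
qed

lemma \<delta>_antisym:
  assumes "x \<in> L"
  shows "\<delta> x i j = - tensor_flip (\<delta> x j i)"
proof -
  have "\<delta> x i j + tensor_flip (\<delta> x j i) = 0"
  proof (rule L2_eq_zero)
    show "bitensor_on fscale L fscale L (GL i) (GL j) (\<delta> x i j + tensor_flip (\<delta> x j i))"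
      by (intro bitensor_on_plus bitensor_on_flip \<delta>_bitensor assms)
    fix \<phi> c \<psi> d assume h: "\<phi> \<in> dualA" "\<psi> \<in> dualA" "c \<in> GB (- m - i)" "d \<in> GB (- m - j)"
    show "(\<delta> x i j + tensor_flip (\<delta> x j i)) (\<lambda>x y. pairing \<phi> c x * pairing \<psi> d y) = 0"
      using cobracket_eval[OF assms h(3,4,1,2)] cobracket_eval[OF assms h(4,3,2,1)] dual_bracket_swap[of \<phi> c \<psi> d x]
      by (simp add: tensor_flip_def mult.commute)
  qed
  then show ?thesis by (rule eq_neg_iff_add_eq_0[THEN iffD2])
qed

text \<open>Transposing twice turns \<open>(id \<otimes> \<delta>) \<delta>\<close> into a nested bracket.  The inner bracket of \<open>\<psi> \<otimes> d\<close> and \<open>\<chi> \<otimes> e\<close> pairs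
  nontrivially only with \<open>L\<^sub>q\<close> for \<open>q = m + j + k\<close>, and this selects one term of the sum.\<close>

lemma cid_cop_eval:
  assumes x: "x \<in> L" and lin: "\<phi> \<in> dualA" "\<psi> \<in> dualA" "\<chi> \<in> dualA"
    and deg: "c \<in> GB (- m - i)" "d \<in> GB (- m - j)" "e \<in> GB (- m - k)"
    and fin: "finitely_many (cid_cop_term fscale L \<delta> (\<delta> x) i j k)"
  shows "cid_cop fscale L \<delta> (\<delta> x) i j k (\<lambda>u v w. pairing \<phi> c u * (pairing \<psi> d v * pairing \<chi> e w)) =
    nested_bracket dual_prod dia (\<lambda>\<phi> c. pairing \<phi> c x) \<phi> c \<psi> d \<chi> e"
proof -
  let ?\<gamma> = "\<lambda>u v w. pairing \<phi> c u * (pairing \<psi> d v * pairing \<chi> e w)"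
  let ?k = "dual_bracket \<psi> d \<chi> e"
  have bl: "\<forall>y\<in>L. bitensor_on fscale L fscale L (GL j) (GL k) (\<delta> y j k)" using \<delta>_bitensor by blast
  have t: "cid_cop_term fscale L \<delta> (\<delta> x) i j k q ?\<gamma> = \<delta> x i q (\<lambda>u y. pairing \<phi> c u * ?k y)" for q
    unfolding cid_cop_term_def
    using cobracket_eval[OF _ deg(2,3) lin(2,3)] GL_subset
    by (intro id_cop_prod[OF modules(3) subspace_L GL_subset GL_subset GL_subset GL_subset
          \<delta>_component_linear bl \<delta>_bitensor[OF x] pairing_linear pairing_linear pairing_linear dual_bracket_linear]) auto
  let ?q = "m + j + k"
  have z: "\<delta> x i q (\<lambda>u y. pairing \<phi> c u * ?k y) = 0" if q: "q \<noteq> ?q" for q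
  proof (rule bitensor_vanish[OF \<delta>_bitensor[OF x] bilinear_on_prod[OF pairing_linear dual_bracket_linear]])
    fix u y assume "u \<in> GL i" "y \<in> GL q"
    then have "?k y = 0"
      unfolding dual_bracket_def using q pairing_degree[OF dual_prod_closed dia_degree[OF deg(2,3)], of y q]
        pairing_degree[OF dual_prod_closed dia_degree[OF deg(3,2)], of y q] by simp
    then show "pairing \<phi> c u * ?k y = 0" by simp
  qed
  have de: "dia d e \<in> GB (- m - ?q)" "dia e d \<in> GB (- m - ?q)"
  proof -
    have q: "- m - ?q = (- m - j) + (- m - k)" "- m - ?q = (- m - k) + (- m - j)" by simp_all
    show "dia d e \<in> GB (- m - ?q)" unfolding q(1) by (rule dia_degree[OF deg(2,3)])
    show "dia e d \<in> GB (- m - ?q)" unfolding q(2) by (rule dia_degree[OF deg(3,2)])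
  qed
  have "cid_cop fscale L \<delta> (\<delta> x) i j k ?\<gamma> = \<delta> x i ?q (\<lambda>u y. pairing \<phi> c u * ?k y)"
    unfolding cid_cop_def Sum_any_apply[OF fin] t by (rule Sum_any_single) (rule z)
  also have "\<dots> = \<delta> x i ?q (\<lambda>u y. pairing \<phi> c u * pairing (dual_prod \<psi> \<chi>) (dia d e) y - pairing \<phi> c u * pairing (dual_prod \<chi> \<psi>) (dia e d) y)"
    by (simp add: dual_bracket_def right_diff_distrib)
  also have "\<dots> = dual_bracket \<phi> c (dual_prod \<psi> \<chi>) (dia d e) x - dual_bracket \<phi> c (dual_prod \<chi> \<psi>) (dia e d) x"
    unfolding bitensor_diff[OF \<delta>_bitensor[OF x] bilinear_on_prod[OF pairing_linear pairing_linear] bilinear_on_prod[OF pairing_linear pairing_linear]]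
      cobracket_eval[OF x deg(1) de(1) lin(1) dual_prod_closed] cobracket_eval[OF x deg(1) de(2) lin(1) dual_prod_closed] ..
  finally show ?thesis by (simp add: dual_bracket_def nested_bracket_def)
qed

text \<open>As for \<open>(id \<otimes> \<delta>) \<delta>\<close>, with the bracket in the first argument; the sign comes from writing
  \<open>[[\<xi>, \<eta>], \<zeta>]\<close> as \<open>-[\<zeta>, [\<xi>, \<eta>]]\<close>.\<close>

lemma ccop_id_eval:
  assumes x: "x \<in> L" and lin: "\<phi> \<in> dualA" "\<psi> \<in> dualA" "\<chi> \<in> dualA"
    and deg: "c \<in> GB (- m - i)" "d \<in> GB (- m - j)" "e \<in> GB (- m - k)"
    and fin: "finitely_many (ccop_id_term fscale L \<delta> (\<delta> x) i j k)"
  shows "ccop_id fscale L \<delta> (\<delta> x) i j k (\<lambda>u v w. pairing \<phi> c u * (pairing \<psi> d v * pairing \<chi> e w)) =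
    - nested_bracket dual_prod dia (\<lambda>\<phi> c. pairing \<phi> c x) \<chi> e \<phi> c \<psi> d"
proof -
  let ?\<gamma> = "\<lambda>u v w. pairing \<phi> c u * (pairing \<psi> d v * pairing \<chi> e w)"
  let ?k = "dual_bracket \<phi> c \<psi> d"
  have bl: "\<forall>y\<in>L. bitensor_on fscale L fscale L (GL i) (GL j) (\<delta> y i j)" using \<delta>_bitensor by blast
  have t: "ccop_id_term fscale L \<delta> (\<delta> x) i j k q ?\<gamma> = \<delta> x q k (\<lambda>u y. ?k u * pairing \<chi> e y)" for q
    unfolding ccop_id_term_def
    using cobracket_eval[OF _ deg(1,2) lin(1,2)] GL_subset
    by (intro cop_id_prod[OF modules(3) subspace_L GL_subset GL_subset GL_subset GL_subset
          \<delta>_component_linear bl \<delta>_bitensor[OF x] pairing_linear pairing_linear pairing_linear dual_bracket_linear]) auto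
  let ?q = "m + i + j"
  have z: "\<delta> x q k (\<lambda>u y. ?k u * pairing \<chi> e y) = 0" if q: "q \<noteq> ?q" for q
  proof (rule bitensor_vanish[OF \<delta>_bitensor[OF x] bilinear_on_prod[OF dual_bracket_linear pairing_linear]])
    fix u y assume "u \<in> GL q" "y \<in> GL k"
    then have "?k u = 0"
      unfolding dual_bracket_def using q pairing_degree[OF dual_prod_closed dia_degree[OF deg(1,2)], of u q]
        pairing_degree[OF dual_prod_closed dia_degree[OF deg(2,1)], of u q] by simp
    then show "?k u * pairing \<chi> e y = 0" by simp
  qed
  have cd: "dia c d \<in> GB (- m - ?q)" "dia d c \<in> GB (- m - ?q)"
  proof -
    have q: "- m - ?q = (- m - i) + (- m - j)" "- m - ?q = (- m - j) + (- m - i)" by simp_all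
    show "dia c d \<in> GB (- m - ?q)" unfolding q(1) by (rule dia_degree[OF deg(1,2)])
    show "dia d c \<in> GB (- m - ?q)" unfolding q(2) by (rule dia_degree[OF deg(2,1)])
  qed
  have "ccop_id fscale L \<delta> (\<delta> x) i j k ?\<gamma> = \<delta> x ?q k (\<lambda>u y. ?k u * pairing \<chi> e y)"
    unfolding ccop_id_def Sum_any_apply[OF fin] t by (rule Sum_any_single) (rule z)
  also have "\<dots> = \<delta> x ?q k (\<lambda>u y. pairing (dual_prod \<phi> \<psi>) (dia c d) u * pairing \<chi> e y - pairing (dual_prod \<psi> \<phi>) (dia d c) u * pairing \<chi> e y)"
    by (simp add: dual_bracket_def left_diff_distrib)
  also have "\<dots> = dual_bracket (dual_prod \<phi> \<psi>) (dia c d) \<chi> e x - dual_bracket (dual_prod \<psi> \<phi>) (dia d c) \<chi> e x"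
    unfolding bitensor_diff[OF \<delta>_bitensor[OF x] bilinear_on_prod[OF pairing_linear pairing_linear] bilinear_on_prod[OF pairing_linear pairing_linear]]
      cobracket_eval[OF x cd(1) deg(3) dual_prod_closed lin(3)] cobracket_eval[OF x cd(2) deg(3) dual_prod_closed lin(3)] ..
  finally show ?thesis by (simp add: dual_bracket_def nested_bracket_def)
qed

lemma cop_terms_finite:
  assumes "x \<in> L"
  shows "finitely_many (cid_cop_term fscale L \<delta> (\<delta> x) i j k)"
    and "finitely_many (ccop_id_term fscale L \<delta> (\<delta> x) i j k)"
proof -
  have 1: "cid_cop_term fscale L \<delta> (\<delta> x) i j k q = 0" if "\<delta> x i q = 0" for q
    by (rule ext) (simp add: cid_cop_term_def id_tensor_cop_def that)
  have 2: "ccop_id_term fscale L \<delta> (\<delta> x) i j k q = 0" if "\<delta> x q k = 0" for q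
    by (rule ext) (simp add: ccop_id_term_def cop_tensor_id_def that)
  show "finitely_many (cid_cop_term fscale L \<delta> (\<delta> x) i j k)"
    unfolding finitely_many_def
    by (rule finite_subset[OF _ conjunct2[OF \<delta>_finite[OF assms, of i]]]) (use 1 in blast)
  show "finitely_many (ccop_id_term fscale L \<delta> (\<delta> x) i j k)"
    unfolding finitely_many_def
    by (rule finite_subset[OF _ conjunct1[OF \<delta>_finite[OF assms, of k]]]) (use 2 in blast)
qed

lemma cojacobi_eval:
  assumes x: "x \<in> L" and lin: "\<phi> \<in> dualA" "\<psi> \<in> dualA" "\<chi> \<in> dualA"
    and deg: "c \<in> GB (- m - i)" "d \<in> GB (- m - j)" "e \<in> GB (- m - k)"
  shows "(cid_cop fscale L \<delta> (\<delta> x) - cflip_id (cid_cop fscale L \<delta> (\<delta> x)) - ccop_id fscale L \<delta> (\<delta> x)) i j k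
      (\<lambda>u v w. pairing \<phi> c u * (pairing \<psi> d v * pairing \<chi> e w)) =
    jacobi_sum dual_prod dia (\<lambda>\<phi> c. pairing \<phi> c x) \<phi> c \<psi> d \<chi> e"
proof -
  note fin = cop_terms_finite[OF x]
  have "cflip_id (cid_cop fscale L \<delta> (\<delta> x)) i j k (\<lambda>u v w. pairing \<phi> c u * (pairing \<psi> d v * pairing \<chi> e w))
      = cid_cop fscale L \<delta> (\<delta> x) j i k (\<lambda>u v w. pairing \<psi> d u * (pairing \<phi> c v * pairing \<chi> e w))"
    by (simp add: cflip_id_def flip_tensor_id_def mult.left_commute)
  then show ?thesis
    using cid_cop_eval[OF x lin deg fin(1)] cid_cop_eval[OF x lin(2,1,3) deg(2,1,3) fin(1)]
      ccop_id_eval[OF x lin deg fin(2)]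
    by (simp add: jacobi_sum_def nested_bracket_def)
qed

text \<open>All the other requirements on a completed Lie coalgebra hold for any coproduct \<open>\<Delta>\<^sub>A\<close>; only the Jacobi identity
  of \<open>A\<^sup>* \<otimes> B\<close> is a condition on it.\<close>

lemma completed_lie_coalgebra_iff:
  "completed_lie_coalgebra fscale L GL \<delta> \<longleftrightarrow>
    (\<forall>x\<in>L. \<forall>\<phi>\<in>dualA. \<forall>\<psi>\<in>dualA. \<forall>\<chi>\<in>dualA. \<forall>i j k. \<forall>c\<in>GB i. \<forall>d\<in>GB j. \<forall>e\<in>GB k.
       jacobi_sum dual_prod dia (\<lambda>\<phi> c. pairing \<phi> c x) \<phi> c \<psi> d \<chi> e = 0)" (is "?l = ?r")
proof
  assume l: ?l
  show ?r
  proof (intro ballI allI)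
    fix x \<phi> \<psi> \<chi> i j k c d e
    assume x: "x \<in> L" and lin: "\<phi> \<in> dualA" "\<psi> \<in> dualA" "\<chi> \<in> dualA"
      and "c \<in> GB i" "d \<in> GB j" "e \<in> GB k"
    then have deg: "c \<in> GB (- m - (- m - i))" "d \<in> GB (- m - (- m - j))" "e \<in> GB (- m - (- m - k))" by simp_all
    have "cid_cop fscale L \<delta> (\<delta> x) - cflip_id (cid_cop fscale L \<delta> (\<delta> x)) = ccop_id fscale L \<delta> (\<delta> x)"
      using l x by (simp add: completed_lie_coalgebra_def)
    then show "jacobi_sum dual_prod dia (\<lambda>\<phi> c. pairing \<phi> c x) \<phi> c \<psi> d \<chi> e = 0"
      using cojacobi_eval[OF x lin deg] by simp
  qed
next
  assume r: ?r
  have coj: "cid_cop fscale L \<delta> (\<delta> x) - cflip_id (cid_cop fscale L \<delta> (\<delta> x)) = ccop_id fscale L \<delta> (\<delta> x)"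
    if x: "x \<in> L" for x
  proof (intro ext[of _ "ccop_id fscale L \<delta> (\<delta> x)"] ext[of _ "ccop_id fscale L \<delta> (\<delta> x) _"]
      ext[of _ "ccop_id fscale L \<delta> (\<delta> x) _ _"])
    fix i j k
    note fin = cop_terms_finite[OF x, unfolded finitely_many_def]
    have bl: "\<forall>y\<in>L. bitensor_on fscale L fscale L (GL j) (GL k) (\<delta> y j k)" for j k using \<delta>_bitensor by blast
    have 1: "tritensor_on fscale L (GL i) (GL j) (GL k) (cid_cop fscale L \<delta> (\<delta> x) i j k)" for i j k
      unfolding cid_cop_def Sum_any.expand_set cid_cop_term_def
      by (rule tritensor_on_sum[OF fin(1)[unfolded cid_cop_term_def]],
          rule tritensor_on_id_cop[OF modules(3) subspace_L GL_subset GL_subset GL_subset GL_subset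
            \<delta>_component_linear bl \<delta>_bitensor[OF x]])
    have 2: "tritensor_on fscale L (GL i) (GL j) (GL k) (ccop_id fscale L \<delta> (\<delta> x) i j k)"
      unfolding ccop_id_def Sum_any.expand_set ccop_id_term_def
      by (rule tritensor_on_sum[OF fin(2)[unfolded ccop_id_term_def]],
          rule tritensor_on_cop_id[OF modules(3) subspace_L GL_subset GL_subset GL_subset GL_subset
            \<delta>_component_linear bl \<delta>_bitensor[OF x]])
    have "(cid_cop fscale L \<delta> (\<delta> x) - cflip_id (cid_cop fscale L \<delta> (\<delta> x)) - ccop_id fscale L \<delta> (\<delta> x)) i j k = 0"
    proof (rule L3_eq_zero)
      show "tritensor_on fscale L (GL i) (GL j) (GL k)
          ((cid_cop fscale L \<delta> (\<delta> x) - cflip_id (cid_cop fscale L \<delta> (\<delta> x)) - ccop_id fscale L \<delta> (\<delta> x)) i j k)"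
        unfolding diff_apply3 cflip_id_def by (intro tritensor_on_minus 1 2 tritensor_on_flip)
    qed (use cojacobi_eval[OF x] r x in auto)
    then show "(cid_cop fscale L \<delta> (\<delta> x) - cflip_id (cid_cop fscale L \<delta> (\<delta> x))) i j k = ccop_id fscale L \<delta> (\<delta> x) i j k"
      by (simp add: fun_eq_iff)
  qed
  show ?l
    unfolding completed_lie_coalgebra_def
  proof (intro conjI ballI allI L_graded \<delta>_linear cop_terms_finite coj)
    show "\<delta> x \<in> completed_square fscale L GL" if "x \<in> L" for x
      using \<delta>_in[OF that] by (simp add: completed_square_def tensor_span_def)
    show "\<delta> x = - cflip (\<delta> x)" if "x \<in> L" for x
      using \<delta>_antisym[OF that] by (simp add: cflip_def fun_eq_iff)
  qed
qed

section \<open>The Lie bracket\<close>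

lemma module_mult: "module ((*) :: 'k \<Rightarrow> 'k \<Rightarrow> 'k)"
  using vector_space_mult by (simp add: module_iff_vector_space)

lemma L_linear_zero:
  assumes h: "linear_on fscale L s' h" and s': "module s'"
    and zero: "\<And>a b p. b \<in> GB p \<Longrightarrow> h (tp a b) = 0" and x: "x \<in> L"
  shows "h x = 0"
proof -
  interpret s': module s' by (rule s')
  have z: "linear_on fscale L s' (\<lambda>x. 0)" by (rule linear_onI) simp_all
  show ?thesis
    by (rule linear_on_span_eq[OF modules(3) h z s' L_span_tp _ x]) (use zero in auto)
qed

lemma br_linear:
  "x \<in> L \<Longrightarrow> linear_on fscale L fscale (br x)" "y \<in> L \<Longrightarrow> linear_on fscale L fscale (\<lambda>x. br x y)"
  using bilinear_onD[OF br_bilinear] by auto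

lemma linear_in_L:
  assumes h: "linear_on fscale L fscale h" and base: "\<And>a b p. b \<in> GB p \<Longrightarrow> h (tp a b) \<in> L" and x: "x \<in> L"
  shows "h x \<in> L"
proof -
  have "x \<in> fun_space.span {tp a b |a b. b \<in> (\<Union>i. GB i)}" using x unfolding L_span_tp .
  then have "x \<in> L \<and> h x \<in> L"
  proof (induction rule: fun_space.span_induct_alt)
    case base
    show ?case
      unfolding linear_on_zero[OF h fun_space.subspace_0[OF subspace_L]]
      by (intro conjI fun_space.subspace_0[OF subspace_L])
  next
    case (step c x y)
    then obtain a b p where ab: "x = tp a b" "b \<in> GB p" by blast
    have x: "x \<in> L" "h x \<in> L" unfolding ab(1) by (rule tp_in(1), rule base[OF ab(2)])
    have y: "y \<in> L" "h y \<in> L" using step(2) by auto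
    have "h (fscale c x + y) = fscale c (h x) + h y"
      unfolding linear_onD_add[OF h fun_space.subspace_scale[OF subspace_L x(1)] y(1)]
        linear_onD_scale[OF h x(1)] ..
    then show ?case
      using x y by (simp only: fun_space.subspace_add[OF subspace_L] fun_space.subspace_scale[OF subspace_L])
  qed
  then show ?thesis by blast
qed

lemma br_in:
  assumes x: "x \<in> L" and y: "y \<in> L"
  shows "br x y \<in> L"
proof (rule linear_in_L[OF br_linear(1)[OF x] _ y])
  fix a b p
  show "br x (tp a b) \<in> L"
    by (rule linear_in_L[OF br_linear(2)[OF tp_in(1)] _ x])
      (simp only: br fun_space.subspace_diff[OF subspace_L tp_in(1) tp_in(1)])
qed

lemma br_nested:
  assumes \<beta>: "bilinear_on sA UNIV sB UNIV (*) \<beta>"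
  shows "br (tp a1 b1) (br (tp a2 b2) (tp a3 b3)) \<beta> = nested_bracket circ dia \<beta> a1 b1 a2 b2 a3 b3"
proof -
  have "br (tp a1 b1) (br (tp a2 b2) (tp a3 b3)) =
      br (tp a1 b1) (tp (circ a2 a3) (dia b2 b3)) - br (tp a1 b1) (tp (circ a3 a2) (dia b3 b2))"
    unfolding br[of a2 b2 a3 b3]
    by (intro linear_onD_diff[OF br_linear(1)] tp_in(1) fun_space.subspace_diff[OF subspace_L])
  then show ?thesis
    using \<beta> unfolding br by (simp add: nested_bracket_def pure_tensor_def)
qed

lemma linear_on_fun_add:
  "linear_on s U fscale f \<Longrightarrow> linear_on s U fscale g \<Longrightarrow> linear_on s U fscale (\<lambda>x. f x + g x)"
  by (auto simp: linear_on_def fscale_def fun_eq_iff algebra_simps)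

lemma br_linear_left: "linear_on fscale L fscale f \<Longrightarrow> f ` L \<subseteq> L \<Longrightarrow> y \<in> L \<Longrightarrow> linear_on fscale L fscale (\<lambda>x. br (f x) y)"
  using br_linear(2)[of y] by (auto simp: linear_on_def image_subset_iff)

lemma br_linear_right: "linear_on fscale L fscale f \<Longrightarrow> f ` L \<subseteq> L \<Longrightarrow> y \<in> L \<Longrightarrow> linear_on fscale L fscale (\<lambda>x. br y (f x))"
  using br_linear(1)[of y] by (auto simp: linear_on_def image_subset_iff)

lemma lie_algebra_iff:
  "lie_algebra_on fscale L br \<longleftrightarrow>
    (\<forall>a1 b1 a2 b2 a3 b3 \<beta>. bilinear_on sA UNIV sB UNIV (*) \<beta> \<longrightarrow>
       jacobi_sum circ dia \<beta> a1 b1 a2 b2 a3 b3 = 0)" (is "?l = ?r")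
proof
  assume l: ?l
  show ?r
  proof (intro allI impI)
    fix a1 b1 a2 b2 a3 b3 \<beta> assume \<beta>: "bilinear_on sA UNIV sB UNIV (*) \<beta>"
    have "br (tp a1 b1) (br (tp a2 b2) (tp a3 b3)) + br (tp a2 b2) (br (tp a3 b3) (tp a1 b1)) +
        br (tp a3 b3) (br (tp a1 b1) (tp a2 b2)) = 0"
      using l tp_in(1) by (simp add: lie_algebra_on_def)
    from fun_cong[OF this, of \<beta>] show "jacobi_sum circ dia \<beta> a1 b1 a2 b2 a3 b3 = 0"
      by (simp add: jacobi_sum_def br_nested[OF \<beta>])
  qed
next
  assume r: ?r
  have anti: "br x y + br y x = 0" if x: "x \<in> L" and y: "y \<in> L" for x y
  proof (rule L_linear_zero[where h = "\<lambda>x. br x y + br y x", OF _ modules(3) _ x])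
    show "linear_on fscale L fscale (\<lambda>x. br x y + br y x)"
      by (intro linear_on_fun_add br_linear y)
    fix a b p
    show "br (tp a b) y + br y (tp a b) = 0"
    proof (rule L_linear_zero[where h = "\<lambda>y. br (tp a b) y + br y (tp a b)", OF _ modules(3) _ y])
      show "linear_on fscale L fscale (\<lambda>y. br (tp a b) y + br y (tp a b))"
        by (intro linear_on_fun_add br_linear tp_in(1))
      show "br (tp a b) (tp a' b') + br (tp a' b') (tp a b) = 0" for a' b'
        unfolding br by simp
    qed
  qed
  have alt: "br x x = 0" if "x \<in> L" for x
  proof
    fix \<beta>
    have "(br x x + br x x) \<beta> = 0" using anti[OF that that] by simp
    then have "2 * br x x \<beta> = 0" by simp
    then show "br x x \<beta> = 0 \<beta>" by simp
  qed
  define J where "J x y z = br x (br y z) + br y (br z x) + br z (br x y)" for x y z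
  have J3: "J (tp a1 b1) (tp a2 b2) (tp a3 b3) = 0" for a1 b1 a2 b2 a3 b3
  proof
    fix \<beta>
    have m: "J (tp a1 b1) (tp a2 b2) (tp a3 b3) \<in> L"
      unfolding J_def by (intro fun_space.subspace_add[OF subspace_L] br_in tp_in(1))
    show "J (tp a1 b1) (tp a2 b2) (tp a3 b3) \<beta> = 0 \<beta>"
    proof (cases "bilinear_on sA UNIV sB UNIV (*) \<beta>")
      case True
      then show ?thesis
        using r by (simp add: J_def br_nested[OF True] jacobi_sum_def)
    qed (simp add: bitensor_nonbilinear[OF L_bitensor[OF m]])
  qed
  have J2: "J (tp a1 b1) (tp a2 b2) z = 0" if "z \<in> L" for a1 b1 a2 b2 z
    by (rule L_linear_zero[where h = "\<lambda>z. J (tp a1 b1) (tp a2 b2) z", OF _ modules(3) J3 that]) (unfold J_def,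
      intro linear_on_fun_add br_linear_left br_linear_right br_linear br_in tp_in(1) image_subsetI)
  have J1: "J (tp a1 b1) y z = 0" if y: "y \<in> L" and z: "z \<in> L" for a1 b1 y z
  proof (rule L_linear_zero[where h = "\<lambda>y. J (tp a1 b1) y z", OF _ modules(3) _ y])
    show "linear_on fscale L fscale (\<lambda>y. J (tp a1 b1) y z)"
      unfolding J_def
      by (intro linear_on_fun_add br_linear_left br_linear_right br_linear br_in tp_in(1) z image_subsetI)
    show "J (tp a1 b1) (tp a b) z = 0" for a b by (rule J2[OF z])
  qed
  have J0: "J x y z = 0" if x: "x \<in> L" and y: "y \<in> L" and z: "z \<in> L" for x y z
  proof (rule L_linear_zero[where h = "\<lambda>x. J x y z", OF _ modules(3) _ x])
    show "linear_on fscale L fscale (\<lambda>x. J x y z)"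
      unfolding J_def
      by (intro linear_on_fun_add br_linear_left br_linear_right br_linear br_in y z image_subsetI)
    show "J (tp a b) y z = 0" for a b by (rule J1[OF y z])
  qed
  show ?l
    unfolding lie_algebra_on_def
    using vector_space_fscale subspace_L br_in br_bilinear alt J0 by (simp add: J_def)
qed

section \<open>Novikov coalgebras and Novikov algebras on the dual space\<close>

lemma DA_bitensor_all: "\<forall>y\<in>UNIV. bitensor_on sA UNIV sA UNIV UNIV UNIV (DA y)"
  by (simp add: DA_bitensor)

lemma dualA_linear: "\<phi> \<in> dualA \<Longrightarrow> linear_on sA UNIV (*) \<phi>"
  by simp

lemma coalgebra_evals:
  assumes "\<phi> \<in> dualA" "\<psi> \<in> dualA" "\<chi> \<in> dualA"
  shows "id_tensor_cop sA UNIV DA (DA a) (\<lambda>x y z. \<phi> x * (\<psi> y * \<chi> z)) = dual_prod \<phi> (dual_prod \<psi> \<chi>) a"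
    and "id_tensor_cop sA UNIV DA (tensor_flip (DA a)) (\<lambda>x y z. \<phi> x * (\<psi> y * \<chi> z)) = dual_prod (dual_prod \<psi> \<chi>) \<phi> a"
    and "cop_tensor_id sA UNIV DA (DA a) (\<lambda>x y z. \<phi> x * (\<psi> y * \<chi> z)) = dual_prod (dual_prod \<phi> \<psi>) \<chi> a"
proof -
  note l = dualA_linear[OF assms(1)] dualA_linear[OF assms(2)] dualA_linear[OF assms(3)]
  note U = modules(1) subspace_UNIV(1) subset_UNIV subset_UNIV subset_UNIV subset_UNIV DA_linear DA_bitensor_all
  show "id_tensor_cop sA UNIV DA (DA a) (\<lambda>x y z. \<phi> x * (\<psi> y * \<chi> z)) = dual_prod \<phi> (dual_prod \<psi> \<chi>) a"
  proof -
    have "id_tensor_cop sA UNIV DA (DA a) (\<lambda>x y z. \<phi> x * (\<psi> y * \<chi> z)) = DA a (\<lambda>x y. \<phi> x * dual_prod \<psi> \<chi> y)"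
      by (rule id_cop_prod[OF U DA_bitensor l dualA_linear[OF dual_prod_closed]]) (simp add: dual_prod_def)
    then show ?thesis by (simp add: dual_prod_def)
  qed
  show "id_tensor_cop sA UNIV DA (tensor_flip (DA a)) (\<lambda>x y z. \<phi> x * (\<psi> y * \<chi> z)) = dual_prod (dual_prod \<psi> \<chi>) \<phi> a"
  proof -
    have "id_tensor_cop sA UNIV DA (tensor_flip (DA a)) (\<lambda>x y z. \<phi> x * (\<psi> y * \<chi> z))
        = tensor_flip (DA a) (\<lambda>x y. \<phi> x * dual_prod \<psi> \<chi> y)"
      by (rule id_cop_prod[OF U bitensor_on_flip[OF DA_bitensor] l dualA_linear[OF dual_prod_closed]])
        (simp add: dual_prod_def)
    then show ?thesis by (simp add: dual_prod_def tensor_flip_def mult.commute)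
  qed
  show "cop_tensor_id sA UNIV DA (DA a) (\<lambda>x y z. \<phi> x * (\<psi> y * \<chi> z)) = dual_prod (dual_prod \<phi> \<psi>) \<chi> a"
  proof -
    have "cop_tensor_id sA UNIV DA (DA a) (\<lambda>x y z. \<phi> x * (\<psi> y * \<chi> z)) = DA a (\<lambda>x y. dual_prod \<phi> \<psi> x * \<chi> y)"
      by (rule cop_id_prod[OF U DA_bitensor l dualA_linear[OF dual_prod_closed]]) (simp add: dual_prod_def)
    then show ?thesis by (simp add: dual_prod_def)
  qed
qed

text \<open>Testing the two coalgebra identities on \<open>\<phi> \<otimes> \<psi> \<otimes> \<chi>\<close> gives left symmetry and right commutativity in \<open>A\<^sup>*\<close>, and
  such products separate three-fold tensors over \<open>A\<close>.\<close>

lemma novikov_coalgebra_iff: "novikov_coalgebra sA DA \<longleftrightarrow> novikov_on dualA dual_prod"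
proof -
  let ?I = "\<lambda>a. id_tensor_cop sA UNIV DA (DA a)"
  let ?I' = "\<lambda>a. id_tensor_cop sA UNIV DA (tensor_flip (DA a))"
  let ?C = "\<lambda>a. cop_tensor_id sA UNIV DA (DA a)"
  note U = modules(1) subspace_UNIV(1) subset_UNIV subset_UNIV subset_UNIV subset_UNIV DA_linear DA_bitensor_all
  have t: "tritensor_on sA UNIV UNIV UNIV UNIV (?I a)" "tritensor_on sA UNIV UNIV UNIV UNIV (?I' a)"
      "tritensor_on sA UNIV UNIV UNIV UNIV (?C a)" for a
    by (rule tritensor_on_id_cop[OF U DA_bitensor],
        rule tritensor_on_id_cop[OF U bitensor_on_flip[OF DA_bitensor]],
        rule tritensor_on_cop_id[OF U DA_bitensor])
  have e1: "(?I a - flip_tensor_id (?I a) - (?C a - flip_tensor_id (?C a))) (\<lambda>x y z. \<phi> x * (\<psi> y * \<chi> z))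
      = dual_prod \<phi> (dual_prod \<psi> \<chi>) a - dual_prod \<psi> (dual_prod \<phi> \<chi>) a - (dual_prod (dual_prod \<phi> \<psi>) \<chi> a - dual_prod (dual_prod \<psi> \<phi>) \<chi> a)"
    and e2: "(flip_tensor_id (?I' a) - ?C a) (\<lambda>x y z. \<phi> x * (\<psi> y * \<chi> z)) = dual_prod (dual_prod \<phi> \<chi>) \<psi> a - dual_prod (dual_prod \<phi> \<psi>) \<chi> a"
    if h: "\<phi> \<in> dualA" "\<psi> \<in> dualA" "\<chi> \<in> dualA" for a \<phi> \<psi> \<chi>
    using coalgebra_evals[OF h, of a] coalgebra_evals[OF h(2,1,3), of a]
    by (simp_all add: flip_tensor_id_def mult.left_commute)
  have z1: "(?I a - flip_tensor_id (?I a) = ?C a - flip_tensor_id (?C a)) \<longleftrightarrow>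
      (\<forall>\<phi>\<in>dualA. \<forall>\<psi>\<in>dualA. \<forall>\<chi>\<in>dualA.
        dual_prod \<phi> (dual_prod \<psi> \<chi>) a - dual_prod \<psi> (dual_prod \<phi> \<chi>) a - (dual_prod (dual_prod \<phi> \<psi>) \<chi> a - dual_prod (dual_prod \<psi> \<phi>) \<chi> a) = 0)" (is "?p = ?q") for a
  proof
    assume p: ?p
    then have "?I a - flip_tensor_id (?I a) - (?C a - flip_tensor_id (?C a)) = 0" by simp
    then show ?q using e1[of _ _ _ a] by simp
  next
    assume q: ?q
    have "?I a - flip_tensor_id (?I a) - (?C a - flip_tensor_id (?C a)) = 0"
      by (rule A3_eq_zero) (use q e1[of _ _ _ a] in \<open>auto intro!: tritensor_on_minus tritensor_on_flip t\<close>)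
    then show ?p by (rule right_minus_eq[THEN iffD1])
  qed
  have z2: "(flip_tensor_id (?I' a) = ?C a) \<longleftrightarrow>
      (\<forall>\<phi>\<in>dualA. \<forall>\<psi>\<in>dualA. \<forall>\<chi>\<in>dualA. dual_prod (dual_prod \<phi> \<chi>) \<psi> a - dual_prod (dual_prod \<phi> \<psi>) \<chi> a = 0)" (is "?p = ?q") for a
  proof
    assume p: ?p
    then have "flip_tensor_id (?I' a) - ?C a = 0" by simp
    then show ?q using e2[of _ _ _ a] by simp
  next
    assume q: ?q
    have "flip_tensor_id (?I' a) - ?C a = 0"
      by (rule A3_eq_zero) (use q e2[of _ _ _ a] in \<open>auto intro!: tritensor_on_minus tritensor_on_flip t\<close>)
    then show ?p by (rule right_minus_eq[THEN iffD1])
  qed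
  have f1: "(dual_prod (dual_prod \<phi> \<psi>) \<chi> - dual_prod \<phi> (dual_prod \<psi> \<chi>) = dual_prod (dual_prod \<psi> \<phi>) \<chi> - dual_prod \<psi> (dual_prod \<phi> \<chi>)) \<longleftrightarrow>
      (\<forall>a. dual_prod \<phi> (dual_prod \<psi> \<chi>) a - dual_prod \<psi> (dual_prod \<phi> \<chi>) a - (dual_prod (dual_prod \<phi> \<psi>) \<chi> a - dual_prod (dual_prod \<psi> \<phi>) \<chi> a) = 0)"
    for \<phi> \<psi> \<chi>
    unfolding fun_eq_iff minus_apply by (rule iff_allI) (auto simp: algebra_simps)
  have f2: "(dual_prod (dual_prod \<phi> \<psi>) \<chi> = dual_prod (dual_prod \<phi> \<chi>) \<psi>) \<longleftrightarrow>
      (\<forall>a. dual_prod (dual_prod \<phi> \<chi>) \<psi> a - dual_prod (dual_prod \<phi> \<psi>) \<chi> a = 0)" for \<phi> \<psi> \<chi>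
    unfolding fun_eq_iff by (rule iff_allI) auto
  have "novikov_coalgebra sA DA \<longleftrightarrow> (\<forall>a. ?I a - flip_tensor_id (?I a) = ?C a - flip_tensor_id (?C a)) \<and>
      (\<forall>a. flip_tensor_id (?I' a) = ?C a)"
    unfolding novikov_coalgebra_def using A.vector_space_axioms DA_linear DA_range by simp
  then show ?thesis
    unfolding z1 z2 novikov_on_def f1 f2 by fast
qed

section \<open>The cocycle condition\<close>

lemma form_add_right: "form x (y + z) = form x y + form x z"
  using linear_onD_add[OF form_linear(2)] by simp

text \<open>The right-hand side of the invariance identity is symmetric in its last two arguments, hence so is
  \<open>(b \<diamond> x, y)\<close> in \<open>x\<close> and \<open>y\<close>.\<close>

lemma left_mult_selfadjoint: "form (dia b x) y = form x (dia b y)"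
  using form_inv[of b x y] form_inv[of b y x] form_sym[of x "dia b y"] by (simp add: add.commute)

lemma form_left_commute: "form v (dia u (dia w z)) = form v (dia w (dia u z))"
  by (simp only: dia_left_comm[of u w])

text \<open>With \<open>form_left_commute\<close>, this makes \<open>(v, u \<diamond> (w \<diamond> z))\<close> symmetric in \<open>u, w\<close> and in \<open>v, z\<close>: it depends only on the
  unordered pair \<open>{u, w}\<close> once the four elements are given.\<close>

lemma form_swap: "form v (dia u (dia w z)) = form z (dia u (dia w v))"
  using left_mult_selfadjoint form_sym dia_left_comm by metis

lemma form_prod_prod: "form (dia u v) (dia w z) = form v (dia u (dia w z))"
  by (rule left_mult_selfadjoint)

text \<open>Together with \<open>form_prod_prod\<close> this reduces every four-fold form to the symmetric values.\<close>

lemma form_left_nested: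
  "form z (dia (dia u v) w) = - form v (dia u (dia w z)) - form v (dia u (dia z w))"
proof -
  have "form z (dia (dia u v) w) = form (dia (dia u v) w) z" by (rule form_sym)
  also have "\<dots> = - (form (dia u v) (dia w z) + form (dia u v) (dia z w))"
    by (simp add: form_inv form_add_right)
  finally show ?thesis by (simp add: form_prod_prod)
qed

definition Lstar :: "'a \<Rightarrow> 'a \<Rightarrow> 'a" where "Lstar a x = circ a x + circ x a"
definition Rmul :: "'a \<Rightarrow> 'a \<Rightarrow> 'a" where "Rmul a x = circ x a"

lemma Lstar_linear: "linear_on sA UNIV sA (Lstar a)" and Rmul_linear: "linear_on sA UNIV sA (Rmul a)"
  using circ by (auto simp: bilinear_on_def linear_on_def Lstar_def Rmul_def A.scale_right_distrib algebra_simps)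

lemma comp_dualA: "\<phi> \<in> dualA \<Longrightarrow> \<phi> \<circ> Lstar a \<in> dualA" "\<phi> \<in> dualA \<Longrightarrow> \<phi> \<circ> Rmul a \<in> dualA"
  using Lstar_linear[of a] Rmul_linear[of a] by (auto simp: linear_on_def)

text \<open>The transpose of \<open>ad (a \<otimes> b)\<close> preserves \<open>A\<^sup>* \<otimes> B\<close>, by the adjoints of the multiplications of \<open>B\<close>.  It
  shifts the degree by that of \<open>b\<close>.\<close>

lemma pairing_br:
  assumes \<phi>: "\<phi> \<in> dualA" and z: "z \<in> L"
  shows "pairing \<phi> c (br (tp a b) z) = pairing (\<phi> \<circ> Lstar a) (dia b c) z + pairing (\<phi> \<circ> Rmul a) (dia c b) z"
proof -
  let ?h = "\<lambda>z. pairing \<phi> c (br (tp a b) z) - (pairing (\<phi> \<circ> Lstar a) (dia b c) z + pairing (\<phi> \<circ> Rmul a) (dia c b) z)"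
  have "?h z = 0"
  proof (rule L_linear_zero[where h = ?h, OF _ module_mult _ z])
    show "linear_on fscale L (*) ?h"
      using br_linear(1)[OF tp_in(1), of a b] by (auto simp: linear_on_def pairing_def fscale_apply algebra_simps)
    fix a' b'
    have \<phi>_add: "\<phi> (circ a a' + circ a' a) = \<phi> (circ a a') + \<phi> (circ a' a)"
      using \<phi> by (simp add: linear_on_def)
    have "pairing \<phi> c (br (tp a b) (tp a' b')) = \<phi> (circ a a') * form (dia b b') c - \<phi> (circ a' a) * form (dia b' b) c"
      using pairing_tp[OF \<phi>] by (simp add: br pairing_diff)
    also have "\<dots> = \<phi> (circ a a') * form b' (dia b c) + \<phi> (circ a' a) * (form b' (dia b c) + form b' (dia c b))"
      unfolding left_mult_selfadjoint[of b b' c] form_inv[of b' b c] form_add_right by (simp add: algebra_simps)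
    also have "\<dots> = pairing (\<phi> \<circ> Lstar a) (dia b c) (tp a' b') + pairing (\<phi> \<circ> Rmul a) (dia c b) (tp a' b')"
      unfolding pairing_tp[OF comp_dualA(1)[OF \<phi>]] pairing_tp[OF comp_dualA(2)[OF \<phi>]]
      using \<phi>_add by (simp add: Lstar_def Rmul_def algebra_simps)
    finally show "?h (tp a' b') = 0" by simp
  qed
  then show ?thesis by simp
qed

text \<open>The value of \<open>(ad x \<otimes> id) (\<delta> y)\<close> at \<open>(\<phi> \<otimes> c) \<otimes> (\<psi> \<otimes> d)\<close>, with \<open>j\<close> the degree of the second factor.  The projection to
  the degree of the first factor does not appear, because \<open>c\<close> sees only that degree.\<close>

definition ad_cobracket :: "('k, 'a, 'b) tensor \<Rightarrow> ('k, 'a, 'b) tensor \<Rightarrow> int \<Rightarrow>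
    ('a \<Rightarrow> 'k) \<Rightarrow> 'b \<Rightarrow> ('a \<Rightarrow> 'k) \<Rightarrow> 'b \<Rightarrow> 'k"
  where "ad_cobracket x y j \<phi> c \<psi> d = Sum_any (\<lambda>q. \<delta> y q j (\<lambda>u v. pairing \<phi> c (br x u) * pairing \<psi> d v))"

lemma pairing_br_linear: "x \<in> L \<Longrightarrow> linear_on fscale L (*) (\<lambda>u. pairing \<phi> c (br x u))"
  using br_linear(1)[of x] by (auto simp: linear_on_def pairing_def fscale_apply)

lemma ad_cobracket_form: "x \<in> L \<Longrightarrow> bilinear_on fscale L fscale L (*) (\<lambda>u v. pairing \<phi> c (br x u) * pairing \<psi> d v)"
  by (intro bilinear_on_prod pairing_br_linear pairing_linear)

lemma ad_cobracket_support:
  assumes "y \<in> L"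
  shows "finite {q. \<delta> y q j \<beta> \<noteq> 0}"
  by (rule finite_subset[OF _ conjunct1[OF \<delta>_finite[OF assms, of j]]]) auto

text \<open>Additivity of the sum over degrees rests on the finiteness of the support of \<open>\<delta> y\<close>, which bounds the
  support of the summands independently of \<open>x\<close>.\<close>

lemma ad_cobracket_linear_left:
  assumes y: "y \<in> L"
  shows "linear_on fscale L (*) (\<lambda>x. ad_cobracket x y j \<phi> c \<psi> d)"
proof (rule linear_onI)
  note T = \<delta>_bitensor[OF y]
  fix x x' assume x: "x \<in> L" and x': "x' \<in> L"
  have "\<delta> y q j (\<lambda>u v. pairing \<phi> c (br (x + x') u) * pairing \<psi> d v) =
      \<delta> y q j (\<lambda>u v. pairing \<phi> c (br x u) * pairing \<psi> d v) + \<delta> y q j (\<lambda>u v. pairing \<phi> c (br x' u) * pairing \<psi> d v)" for q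
  proof -
    have "\<delta> y q j (\<lambda>u v. pairing \<phi> c (br (x + x') u) * pairing \<psi> d v) =
        \<delta> y q j (\<lambda>u v. pairing \<phi> c (br x u) * pairing \<psi> d v + pairing \<phi> c (br x' u) * pairing \<psi> d v)"
    proof (rule bitensor_cong[OF T ad_cobracket_form[OF fun_space.subspace_add[OF subspace_L x x']]
            bilinear_on_add[OF ad_cobracket_form[OF x] ad_cobracket_form[OF x']]])
      fix u v assume "u \<in> GL q"
      then have "u \<in> L" using GL_subset by blast
      from linear_onD_add[OF br_linear(2)[OF this] x x']
      show "pairing \<phi> c (br (x + x') u) * pairing \<psi> d v = pairing \<phi> c (br x u) * pairing \<psi> d v + pairing \<phi> c (br x' u) * pairing \<psi> d v"
        by (simp add: pairing_def distrib_right)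
    qed
    then show ?thesis using bitensor_add[OF T ad_cobracket_form[OF x] ad_cobracket_form[OF x']] by simp
  qed
  then show "ad_cobracket (x + x') y j \<phi> c \<psi> d = ad_cobracket x y j \<phi> c \<psi> d + ad_cobracket x' y j \<phi> c \<psi> d"
    unfolding ad_cobracket_def by (simp only: Sum_any.distrib[OF ad_cobracket_support[OF y] ad_cobracket_support[OF y]])
next
  note T = \<delta>_bitensor[OF y]
  fix k x assume x: "x \<in> L"
  have "\<delta> y q j (\<lambda>u v. pairing \<phi> c (br (fscale k x) u) * pairing \<psi> d v) =
      k * \<delta> y q j (\<lambda>u v. pairing \<phi> c (br x u) * pairing \<psi> d v)" for q
  proof -
    have "\<delta> y q j (\<lambda>u v. pairing \<phi> c (br (fscale k x) u) * pairing \<psi> d v) =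
        \<delta> y q j (\<lambda>u v. k * (pairing \<phi> c (br x u) * pairing \<psi> d v))"
    proof (rule bitensor_cong[OF T ad_cobracket_form[OF fun_space.subspace_scale[OF subspace_L x]]
            bilinear_on_scale[OF ad_cobracket_form[OF x]]])
      fix u v assume "u \<in> GL q"
      then have "u \<in> L" using GL_subset by blast
      from linear_onD_scale[OF br_linear(2)[OF this] x]
      show "pairing \<phi> c (br (fscale k x) u) * pairing \<psi> d v = k * (pairing \<phi> c (br x u) * pairing \<psi> d v)"
        by (simp add: pairing_def fscale_apply mult.assoc)
    qed
    then show ?thesis using bitensor_scale[OF T ad_cobracket_form[OF x]] by simp
  qed
  then show "ad_cobracket (fscale k x) y j \<phi> c \<psi> d = k * ad_cobracket x y j \<phi> c \<psi> d"
    unfolding ad_cobracket_def by (simp only: Sum_any_right_distrib[OF ad_cobracket_support[OF y]])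
qed

lemma ad_cobracket_linear_right: "linear_on fscale L (*) (\<lambda>y. ad_cobracket x y j \<phi> c \<psi> d)"
proof (rule linear_onI)
  fix y y' assume y: "y \<in> L" and y': "y' \<in> L"
  show "ad_cobracket x (y + y') j \<phi> c \<psi> d = ad_cobracket x y j \<phi> c \<psi> d + ad_cobracket x y' j \<phi> c \<psi> d"
    unfolding ad_cobracket_def \<delta>_add[OF y y'] plus_fun_apply
    by (rule Sum_any.distrib[OF ad_cobracket_support[OF y] ad_cobracket_support[OF y']])
next
  fix k y assume y: "y \<in> L"
  show "ad_cobracket x (fscale k y) j \<phi> c \<psi> d = k * ad_cobracket x y j \<phi> c \<psi> d"
    unfolding ad_cobracket_def \<delta>_scale[OF y] fscale_apply
    by (rule Sum_any_right_distrib[OF ad_cobracket_support[OF y], symmetric])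
qed

lemma ad_cobracket_tp:
  assumes b: "b \<in> GB p" and y: "y \<in> L" and \<phi>: "\<phi> \<in> dualA" and \<psi>: "\<psi> \<in> dualA"
    and c: "c \<in> GB (- m - i)" and d: "d \<in> GB (- m - j)"
  shows "ad_cobracket (tp a b) y j \<phi> c \<psi> d =
    dual_bracket (\<phi> \<circ> Lstar a) (dia b c) \<psi> d y + dual_bracket (\<phi> \<circ> Rmul a) (dia c b) \<psi> d y"
proof -
  note T = \<delta>_bitensor[OF y]
  let ?f = "pairing (\<phi> \<circ> Lstar a) (dia b c)" and ?g = "pairing (\<phi> \<circ> Rmul a) (dia c b)"
  have q: "- m - (i - p) = p + (- m - i)" "- m - (i - p) = (- m - i) + p" by simp_all
  have bc: "dia b c \<in> GB (- m - (i - p))" unfolding q(1) by (rule dia_degree[OF b c])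
  have cb: "dia c b \<in> GB (- m - (i - p))" unfolding q(2) by (rule dia_degree[OF c b])
  have fg: "\<delta> y q j (\<lambda>u v. pairing \<phi> c (br (tp a b) u) * pairing \<psi> d v) =
      \<delta> y q j (\<lambda>u v. ?f u * pairing \<psi> d v) + \<delta> y q j (\<lambda>u v. ?g u * pairing \<psi> d v)" for q
  proof -
    have bi: "bilinear_on fscale L fscale L (*) (\<lambda>u v. ?f u * pairing \<psi> d v)"
      "bilinear_on fscale L fscale L (*) (\<lambda>u v. ?g u * pairing \<psi> d v)"
      by (intro bilinear_on_prod pairing_linear)+
    have "\<delta> y q j (\<lambda>u v. pairing \<phi> c (br (tp a b) u) * pairing \<psi> d v) =
        \<delta> y q j (\<lambda>u v. ?f u * pairing \<psi> d v + ?g u * pairing \<psi> d v)"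
    proof (rule bitensor_cong[OF T ad_cobracket_form[OF tp_in(1)] bilinear_on_add[OF bi]])
      fix u v assume "u \<in> GL q"
      then have "u \<in> L" using GL_subset by blast
      from pairing_br[OF \<phi> this]
      show "pairing \<phi> c (br (tp a b) u) * pairing \<psi> d v = ?f u * pairing \<psi> d v + ?g u * pairing \<psi> d v"
        by (simp add: distrib_right)
    qed
    then show ?thesis using bitensor_add[OF T bi] by simp
  qed
  have z: "\<delta> y q j (\<lambda>u v. ?f u * pairing \<psi> d v) + \<delta> y q j (\<lambda>u v. ?g u * pairing \<psi> d v) = 0" if q: "q \<noteq> i - p" for q
  proof -
    have "?f u = 0" "?g u = 0" if "u \<in> GL q" for u
      using pairing_degree[OF comp_dualA(1)[OF \<phi>] bc that] pairing_degree[OF comp_dualA(2)[OF \<phi>] cb that] q by simp_all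
    then have "\<delta> y q j (\<lambda>u v. ?f u * pairing \<psi> d v) = 0" "\<delta> y q j (\<lambda>u v. ?g u * pairing \<psi> d v) = 0"
      by (intro bitensor_vanish[OF T] bilinear_on_prod pairing_linear; simp)+
    then show ?thesis by simp
  qed
  have "ad_cobracket (tp a b) y j \<phi> c \<psi> d =
      \<delta> y (i - p) j (\<lambda>u v. ?f u * pairing \<psi> d v) + \<delta> y (i - p) j (\<lambda>u v. ?g u * pairing \<psi> d v)"
    unfolding ad_cobracket_def fg by (rule Sum_any_single) (rule z)
  then show ?thesis
    using cobracket_eval[OF y bc d comp_dualA(1)[OF \<phi>] \<psi>] cobracket_eval[OF y cb d comp_dualA(2)[OF \<phi>] \<psi>] by simp
qed

lemma graded_part_br_linear: "x \<in> L \<Longrightarrow> linear_on fscale L fscale (\<lambda>u. graded_part fscale GL i (br x u))"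
  using graded_part_linear[OF L_graded, of i] br_linear(1)[of x] br_in[of x] by (simp add: linear_on_def)

lemma graded_part_br_image:
  assumes "x \<in> L" "V \<subseteq> L"
  shows "(\<lambda>u. graded_part fscale GL i (br x u)) ` V \<subseteq> GL i" "(\<lambda>u. graded_part fscale GL i (br x u)) ` L \<subseteq> L"
  using graded_part_in[OF L_graded br_in[OF assms(1)]] assms(2) GL_subset by blast+

lemma pairing_graded_part:
  assumes "\<phi> \<in> dualA" "c \<in> GB (- m - i)" "z \<in> L"
  shows "pairing \<phi> c (graded_part fscale GL i z) = pairing \<phi> c z"
  using pairing_span_other[OF graded_part_rest[OF L_graded assms(3)] assms(1,2)] by (simp add: pairing_diff)

lemma id_linear: "linear_on fscale L fscale id"
  by (simp add: linear_on_def)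

lemma ad_terms_bitensor:
  assumes x: "x \<in> L" and y: "y \<in> L"
  shows "bitensor_on fscale L fscale L (GL i) (GL j) (cmap_id_term fscale L GL (br x) (\<delta> y) i j q)"
    and "bitensor_on fscale L fscale L (GL i) (GL j) (cid_map_term fscale L GL (br x) (\<delta> y) i j q)"
  unfolding cmap_id_term_def cid_map_term_def
  by (rule bitensor_on_map[OF \<delta>_bitensor[OF y]];
      simp add: graded_part_br_linear[OF x] graded_part_br_image[OF x GL_subset] id_linear)+

lemma ad_terms_finite:
  assumes x: "x \<in> L" and y: "y \<in> L"
  shows "finitely_many (cmap_id_term fscale L GL (br x) (\<delta> y) i j)"
    and "finitely_many (cid_map_term fscale L GL (br x) (\<delta> y) i j)"
proof -
  have 1: "cmap_id_term fscale L GL (br x) (\<delta> y) i j q = 0" if "\<delta> y q j = 0" for q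
    by (rule ext) (simp add: cmap_id_term_def tensor_map_def that)
  have 2: "cid_map_term fscale L GL (br x) (\<delta> y) i j q = 0" if "\<delta> y i q = 0" for q
    by (rule ext) (simp add: cid_map_term_def tensor_map_def that)
  show "finitely_many (cmap_id_term fscale L GL (br x) (\<delta> y) i j)"
    unfolding finitely_many_def
    by (rule finite_subset[OF _ conjunct1[OF \<delta>_finite[OF y, of j]]]) (use 1 in blast)
  show "finitely_many (cid_map_term fscale L GL (br x) (\<delta> y) i j)"
    unfolding finitely_many_def
    by (rule finite_subset[OF _ conjunct2[OF \<delta>_finite[OF y, of i]]]) (use 2 in blast)
qed

lemma cmap_eval:
  assumes x: "x \<in> L" and y: "y \<in> L" and \<phi>: "\<phi> \<in> dualA" and c: "c \<in> GB (- m - i)"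
  shows "cmap_id fscale L GL (br x) (\<delta> y) i j (\<lambda>u v. pairing \<phi> c u * pairing \<psi> d v) = ad_cobracket x y j \<phi> c \<psi> d"
proof -
  have bp: "bilinear_on fscale L fscale L (*) (\<lambda>u v. pairing \<phi> c u * pairing \<psi> d v)"
    by (intro bilinear_on_prod pairing_linear)
  have "cmap_id_term fscale L GL (br x) (\<delta> y) i j q (\<lambda>u v. pairing \<phi> c u * pairing \<psi> d v) =
      \<delta> y q j (\<lambda>u v. pairing \<phi> c (br x u) * pairing \<psi> d v)" for q
  proof -
    have "\<delta> y q j (\<lambda>u v. pairing \<phi> c (graded_part fscale GL i (br x u)) * pairing \<psi> d (id v)) =
        \<delta> y q j (\<lambda>u v. pairing \<phi> c (br x u) * pairing \<psi> d v)"
    proof (rule bitensor_cong[OF \<delta>_bitensor[OF y] bilinear_on_comp[OF bp graded_part_br_linear[OF x]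
            graded_part_br_image(2)[OF x subset_refl] id_linear] ad_cobracket_form[OF x]])
      fix u v assume "u \<in> GL q"
      then have "u \<in> L" using GL_subset by blast
      from pairing_graded_part[OF \<phi> c br_in[OF x this]]
      show "pairing \<phi> c (graded_part fscale GL i (br x u)) * pairing \<psi> d (id v) = pairing \<phi> c (br x u) * pairing \<psi> d v" by simp
    qed simp
    then show ?thesis using bp by (simp add: cmap_id_term_def tensor_map_def)
  qed
  then show ?thesis
    unfolding cmap_id_def Sum_any_apply[OF ad_terms_finite(1)[OF x y]] ad_cobracket_def by simp
qed

text \<open>By antisymmetry of \<open>\<delta>\<close>, the operator \<open>id \<otimes> ad x\<close> is reduced to \<open>ad x \<otimes> id\<close>.\<close>

lemma cid_eval:
  assumes x: "x \<in> L" and y: "y \<in> L" and \<psi>: "\<psi> \<in> dualA" and d: "d \<in> GB (- m - j)"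
  shows "cid_map fscale L GL (br x) (\<delta> y) i j (\<lambda>u v. pairing \<phi> c u * pairing \<psi> d v) = - ad_cobracket x y i \<psi> d \<phi> c"
proof -
  have bp: "bilinear_on fscale L fscale L (*) (\<lambda>u v. pairing \<phi> c u * pairing \<psi> d v)"
    by (intro bilinear_on_prod pairing_linear)
  have "cid_map_term fscale L GL (br x) (\<delta> y) i j q (\<lambda>u v. pairing \<phi> c u * pairing \<psi> d v) =
      - \<delta> y q i (\<lambda>u v. pairing \<psi> d (br x u) * pairing \<phi> c v)" for q
  proof -
    have "\<delta> y i q (\<lambda>u v. pairing \<phi> c (id u) * pairing \<psi> d (graded_part fscale GL j (br x v))) =
        \<delta> y i q (\<lambda>u v. pairing \<phi> c u * pairing \<psi> d (br x v))"
    proof (rule bitensor_cong[OF \<delta>_bitensor[OF y] bilinear_on_comp[OF bp id_linear _ graded_part_br_linear[OF x]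
            graded_part_br_image(2)[OF x subset_refl]] bilinear_on_prod[OF pairing_linear pairing_br_linear[OF x]]])
      fix u v assume "v \<in> GL q"
      then have "v \<in> L" using GL_subset by blast
      from pairing_graded_part[OF \<psi> d br_in[OF x this]]
      show "pairing \<phi> c (id u) * pairing \<psi> d (graded_part fscale GL j (br x v)) = pairing \<phi> c u * pairing \<psi> d (br x v)" by simp
    qed simp
    also have "\<dots> = - \<delta> y q i (\<lambda>u v. pairing \<psi> d (br x u) * pairing \<phi> c v)"
      unfolding \<delta>_antisym[OF y, of i q] by (simp add: tensor_flip_def mult.commute)
    finally show ?thesis using bp by (simp add: cid_map_term_def tensor_map_def)
  qed
  then show ?thesis
    unfolding cid_map_def Sum_any_apply[OF ad_terms_finite(2)[OF x y]] ad_cobracket_def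
    by (simp add: Sum_any.expand_set sum_negf)
qed

text \<open>The difference of the two sides of the cocycle condition at \<open>(\<phi> \<otimes> c) \<otimes> (\<psi> \<otimes> d)\<close> in bidegree \<open>(i, j)\<close>; the
  signs of the terms for \<open>id \<otimes> ad\<close> are those of \<open>cid_eval\<close>.\<close>

definition cocycle_defect :: "('k, 'a, 'b) tensor \<Rightarrow> ('k, 'a, 'b) tensor \<Rightarrow> int \<Rightarrow> int \<Rightarrow>
    ('a \<Rightarrow> 'k) \<Rightarrow> 'b \<Rightarrow> ('a \<Rightarrow> 'k) \<Rightarrow> 'b \<Rightarrow> 'k"
  where "cocycle_defect x y i j \<phi> c \<psi> d = dual_bracket \<phi> c \<psi> d (br x y) -
    (ad_cobracket x y j \<phi> c \<psi> d - ad_cobracket x y i \<psi> d \<phi> c - (ad_cobracket y x j \<phi> c \<psi> d - ad_cobracket y x i \<psi> d \<phi> c))"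

lemma dual_bracket_br_linear:
  "x \<in> L \<Longrightarrow> linear_on fscale L (*) (\<lambda>y. dual_bracket \<phi> c \<psi> d (br x y))"
  "y \<in> L \<Longrightarrow> linear_on fscale L (*) (\<lambda>x. dual_bracket \<phi> c \<psi> d (br x y))"
  using br_linear(1)[of x] br_linear(2)[of y]
  by (auto simp: linear_on_def dual_bracket_def pairing_def fscale_apply algebra_simps)

lemma linear_on_diff:
  "linear_on s U (*) f \<Longrightarrow> linear_on s U (*) g \<Longrightarrow> linear_on s U (*) (\<lambda>x. f x - g x)"
  for f :: "'v::ab_group_add \<Rightarrow> 'f::field"
  by (auto simp: linear_on_def algebra_simps)

lemma cocycle_defect_zero:
  assumes base: "\<And>a b p a' b' p'. b \<in> GB p \<Longrightarrow> b' \<in> GB p' \<Longrightarrow> cocycle_defect (tp a b) (tp a' b') i j \<phi> c \<psi> d = 0"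
    and x: "x \<in> L" and y: "y \<in> L"
  shows "cocycle_defect x y i j \<phi> c \<psi> d = 0"
proof (rule L_linear_zero[where h = "\<lambda>x. cocycle_defect x y i j \<phi> c \<psi> d", OF _ module_mult _ x])
  show "linear_on fscale L (*) (\<lambda>x. cocycle_defect x y i j \<phi> c \<psi> d)"
    unfolding cocycle_defect_def
    by (intro linear_on_diff dual_bracket_br_linear ad_cobracket_linear_left ad_cobracket_linear_right y)
  fix a b p assume b: "b \<in> GB p"
  show "cocycle_defect (tp a b) y i j \<phi> c \<psi> d = 0"
  proof (rule L_linear_zero[where h = "\<lambda>y. cocycle_defect (tp a b) y i j \<phi> c \<psi> d", OF _ module_mult _ y])
    show "linear_on fscale L (*) (\<lambda>y. cocycle_defect (tp a b) y i j \<phi> c \<psi> d)"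
      unfolding cocycle_defect_def
      by (intro linear_on_diff dual_bracket_br_linear ad_cobracket_linear_left ad_cobracket_linear_right tp_in(1))
    show "cocycle_defect (tp a b) (tp a' b') i j \<phi> c \<psi> d = 0" if "b' \<in> GB p'" for a' b' p'
      by (rule base[OF b that])
  qed
qed

abbreviation "ad_sum x y i j \<equiv>
  cmap_id fscale L GL (br x) (\<delta> y) i j + cid_map fscale L GL (br x) (\<delta> y) i j"

lemma cocycle_eval:
  assumes x: "x \<in> L" and y: "y \<in> L" and h: "\<phi> \<in> dualA" "\<psi> \<in> dualA" "c \<in> GB (- m - i)" "d \<in> GB (- m - j)"
  shows "(\<delta> (br x y) i j - (ad_sum x y i j - ad_sum y x i j))
      (\<lambda>u v. pairing \<phi> c u * pairing \<psi> d v) = cocycle_defect x y i j \<phi> c \<psi> d"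
  using cobracket_eval[OF br_in[OF x y] h(3,4,1,2)] cmap_eval[OF x y h(1,3), of j \<psi> d] cmap_eval[OF y x h(1,3), of j \<psi> d]
    cid_eval[OF x y h(2,4), of i \<phi> c] cid_eval[OF y x h(2,4), of i \<phi> c]
  by (simp add: cocycle_defect_def)

lemma cocycle_iff:
  "(\<forall>x\<in>L. \<forall>y\<in>L. \<delta> (br x y) =
       (cmap_id fscale L GL (br x) (\<delta> y) + cid_map fscale L GL (br x) (\<delta> y)) -
       (cmap_id fscale L GL (br y) (\<delta> x) + cid_map fscale L GL (br y) (\<delta> x))) \<longleftrightarrow>
   (\<forall>i j. \<forall>\<phi>\<in>dualA. \<forall>\<psi>\<in>dualA. \<forall>c\<in>GB (- m - i). \<forall>d\<in>GB (- m - j). \<forall>a b p a' b' p'.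
      b \<in> GB p \<longrightarrow> b' \<in> GB p' \<longrightarrow> cocycle_defect (tp a b) (tp a' b') i j \<phi> c \<psi> d = 0)" (is "?l \<longleftrightarrow> ?r")
proof
  assume l: ?l
  show ?r
  proof (intro allI ballI impI)
    fix i j \<phi> \<psi> c d a b a' b'
    assume h: "\<phi> \<in> dualA" "\<psi> \<in> dualA" "c \<in> GB (- m - i)" "d \<in> GB (- m - j)"
    have "\<delta> (br (tp a b) (tp a' b')) i j =
       (cmap_id fscale L GL (br (tp a b)) (\<delta> (tp a' b')) + cid_map fscale L GL (br (tp a b)) (\<delta> (tp a' b'))) i j -
       (cmap_id fscale L GL (br (tp a' b')) (\<delta> (tp a b)) + cid_map fscale L GL (br (tp a' b')) (\<delta> (tp a b))) i j"
      using l tp_in(1) by simp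
    then show "cocycle_defect (tp a b) (tp a' b') i j \<phi> c \<psi> d = 0"
      using cocycle_eval[where x = "tp a b" and y = "tp a' b'", OF tp_in(1) tp_in(1) h] by simp
  qed
next
  assume r: ?r
  show ?l
  proof (intro ballI ext[of "\<delta> _"] ext[of "\<delta> _ _"])
    fix x y i j assume x: "x \<in> L" and y: "y \<in> L"
    have bt: "bitensor_on fscale L fscale L (GL i) (GL j) (ad_sum x y i j)"
      if x: "x \<in> L" and y: "y \<in> L" for x y
      unfolding cmap_id_def cid_map_def Sum_any.expand_set
      using ad_terms_finite[OF x y] unfolding finitely_many_def
      by (intro bitensor_on_plus bitensor_on_sum ad_terms_bitensor x y)
    have "\<delta> (br x y) i j - (ad_sum x y i j - ad_sum y x i j) = 0"
    proof (rule L2_eq_zero)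
      show "bitensor_on fscale L fscale L (GL i) (GL j) (\<delta> (br x y) i j - (ad_sum x y i j - ad_sum y x i j))"
        by (intro bitensor_on_minus \<delta>_bitensor br_in bt x y)
      fix \<phi> c \<psi> d assume h: "\<phi> \<in> dualA" "\<psi> \<in> dualA" "c \<in> GB (- m - i)" "d \<in> GB (- m - j)"
      show "(\<delta> (br x y) i j - (ad_sum x y i j -
        ad_sum y x i j)) (\<lambda>u v. pairing \<phi> c u * pairing \<psi> d v) = 0"
        unfolding cocycle_eval[OF x y h]
        by (rule cocycle_defect_zero[OF _ x y]) (use r h in blast)
    qed
    then show "\<delta> (br x y) i j = ((cmap_id fscale L GL (br x) (\<delta> y) + cid_map fscale L GL (br x) (\<delta> y)) -
       (cmap_id fscale L GL (br y) (\<delta> x) + cid_map fscale L GL (br y) (\<delta> x))) i j"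
      by (simp add: fun_eq_iff)
  qed
qed

text \<open>The defects in the three compatibility conditions of a Novikov bialgebra, evaluated at \<open>\<phi> \<otimes> \<psi>\<close>; the
  identification is made in \<open>compat_iff\<close>.\<close>

definition derivation_defect :: "'a \<Rightarrow> 'a \<Rightarrow> ('a \<Rightarrow> 'k) \<Rightarrow> ('a \<Rightarrow> 'k) \<Rightarrow> 'k"
  where "derivation_defect a a' \<phi> \<psi> = dual_prod \<phi> \<psi> (circ a a') - dual_prod (\<phi> \<circ> Rmul a') \<psi> a -
    (dual_prod \<phi> (\<psi> \<circ> Lstar a) a' + dual_prod (\<psi> \<circ> Lstar a) \<phi> a')"

definition left_defect :: "'a \<Rightarrow> 'a \<Rightarrow> ('a \<Rightarrow> 'k) \<Rightarrow> ('a \<Rightarrow> 'k) \<Rightarrow> 'k"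
  where "left_defect a a' \<phi> \<psi> = dual_prod (\<phi> \<circ> Lstar a) \<psi> a' - dual_prod (\<psi> \<circ> Lstar a) \<phi> a' -
    (dual_prod (\<phi> \<circ> Lstar a') \<psi> a - dual_prod (\<psi> \<circ> Lstar a') \<phi> a)"

definition right_defect :: "'a \<Rightarrow> 'a \<Rightarrow> ('a \<Rightarrow> 'k) \<Rightarrow> ('a \<Rightarrow> 'k) \<Rightarrow> 'k"
  where "right_defect a a' \<phi> \<psi> =
    dual_prod \<phi> (\<psi> \<circ> Rmul a) a' + dual_prod (\<psi> \<circ> Rmul a) \<phi> a' - (dual_prod (\<phi> \<circ> Rmul a) \<psi> a' + dual_prod \<psi> (\<phi> \<circ> Rmul a) a') -
    (dual_prod \<phi> (\<psi> \<circ> Rmul a') a + dual_prod (\<psi> \<circ> Rmul a') \<phi> a - (dual_prod (\<phi> \<circ> Rmul a') \<psi> a + dual_prod \<psi> (\<phi> \<circ> Rmul a') a))"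

lemma dual_bracket_tp: "dual_bracket \<phi> c \<psi> d (tp a b) = dual_prod \<phi> \<psi> a * form b (dia c d) - dual_prod \<psi> \<phi> a * form b (dia d c)"
  unfolding dual_bracket_def pairing_tp[OF dual_prod_closed] ..

text \<open>The four elements \<open>b, b', c, d\<close> give six symmetric values, one for each pair of them.  The coefficients at
  the four mixed pairs are, up to sign, the first defect with its arguments exchanged in all ways,
  and those at \<open>{b, b'}\<close> and \<open>{c, d}\<close> are the other two defects.\<close>

lemma cocycle_defect_tp:
  assumes b: "b \<in> GB p" and b': "b' \<in> GB p'" and \<phi>: "\<phi> \<in> dualA" and \<psi>: "\<psi> \<in> dualA"
    and c: "c \<in> GB (- m - i)" and d: "d \<in> GB (- m - j)"
  shows "cocycle_defect (tp a b) (tp a' b') i j \<phi> c \<psi> d =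
    derivation_defect a a' \<phi> \<psi> * form b' (dia b (dia c d)) - derivation_defect a a' \<psi> \<phi> * form b' (dia b (dia d c)) -
    derivation_defect a' a \<phi> \<psi> * form b (dia b' (dia c d)) + derivation_defect a' a \<psi> \<phi> * form b (dia b' (dia d c)) +
    left_defect a a' \<phi> \<psi> * form c (dia b (dia b' d)) - right_defect a a' \<phi> \<psi> * form b (dia c (dia d b'))"
proof -
  let ?pr = "form b' (dia b (dia c d))" and ?ps = "form b' (dia b (dia d c))"
  let ?p'r = "form b (dia b' (dia c d))" and ?p's = "form b (dia b' (dia d c))"
  let ?pp = "form c (dia b (dia b' d))" and ?rs = "form b (dia c (dia d b'))"
  note lc = form_left_commute and sw = form_swap and nest = form_left_nested
  \<comment> \<open>The expansions produce further arrangements of the six values; here each is brought to its representative.\<close>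
  have sp: "form c (dia b (dia d b')) = ?ps" "form d (dia b (dia c b')) = ?pr"
    "form c (dia b' (dia d b)) = ?p's" "form d (dia b' (dia c b)) = ?p'r"
    "form d (dia b (dia b' c)) = ?pp" "form c (dia b' (dia b d)) = ?pp" "form d (dia b' (dia b c)) = ?pp"
    "form b' (dia c (dia d b)) = ?rs" "form b (dia d (dia c b')) = ?rs" "form b' (dia d (dia c b)) = ?rs"
    "form b (dia c (dia b' d)) = ?p'r" "form b (dia d (dia b' c)) = ?p's"
    "form b' (dia c (dia b d)) = ?pr" "form b' (dia d (dia b c)) = ?ps"
    by (metis lc sw)+
  have 1: "dual_bracket \<phi> c \<psi> d (br (tp a b) (tp a' b')) =
      dual_prod \<phi> \<psi> (circ a a') * ?pr - dual_prod \<psi> \<phi> (circ a a') * ?ps -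
      (dual_prod \<phi> \<psi> (circ a' a) * ?p'r - dual_prod \<psi> \<phi> (circ a' a) * ?p's)"
  proof -
    have "dual_bracket \<phi> c \<psi> d (br (tp a b) (tp a' b')) =
        dual_bracket \<phi> c \<psi> d (tp (circ a a') (dia b b')) - dual_bracket \<phi> c \<psi> d (tp (circ a' a) (dia b' b))"
      unfolding br by (simp add: dual_bracket_def pairing_diff)
    then show ?thesis unfolding dual_bracket_tp form_prod_prod .
  qed
  have 2: "ad_cobracket (tp a b) (tp a' b') j \<phi> c \<psi> d =
      dual_prod (\<phi> \<circ> Lstar a) \<psi> a' * (- ?ps - ?pp) - dual_prod \<psi> (\<phi> \<circ> Lstar a) a' * ?ps +
      (dual_prod (\<phi> \<circ> Rmul a) \<psi> a' * (- ?rs - ?p'r) - dual_prod \<psi> (\<phi> \<circ> Rmul a) a' * ?rs)"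
    unfolding ad_cobracket_tp[OF b tp_in(1) \<phi> \<psi> c d] dual_bracket_tp nest sp ..
  have 3: "ad_cobracket (tp a b) (tp a' b') i \<psi> d \<phi> c =
      dual_prod (\<psi> \<circ> Lstar a) \<phi> a' * (- ?pr - ?pp) - dual_prod \<phi> (\<psi> \<circ> Lstar a) a' * ?pr +
      (dual_prod (\<psi> \<circ> Rmul a) \<phi> a' * (- ?rs - ?p's) - dual_prod \<phi> (\<psi> \<circ> Rmul a) a' * ?rs)"
    unfolding ad_cobracket_tp[OF b tp_in(1) \<psi> \<phi> d c] dual_bracket_tp nest sp ..
  have 4: "ad_cobracket (tp a' b') (tp a b) j \<phi> c \<psi> d =
      dual_prod (\<phi> \<circ> Lstar a') \<psi> a * (- ?p's - ?pp) - dual_prod \<psi> (\<phi> \<circ> Lstar a') a * ?p's +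
      (dual_prod (\<phi> \<circ> Rmul a') \<psi> a * (- ?rs - ?pr) - dual_prod \<psi> (\<phi> \<circ> Rmul a') a * ?rs)"
    unfolding ad_cobracket_tp[OF b' tp_in(1) \<phi> \<psi> c d] dual_bracket_tp nest sp ..
  have 5: "ad_cobracket (tp a' b') (tp a b) i \<psi> d \<phi> c =
      dual_prod (\<psi> \<circ> Lstar a') \<phi> a * (- ?p'r - ?pp) - dual_prod \<phi> (\<psi> \<circ> Lstar a') a * ?p'r +
      (dual_prod (\<psi> \<circ> Rmul a') \<phi> a * (- ?rs - ?ps) - dual_prod \<phi> (\<psi> \<circ> Rmul a') a * ?rs)"
    unfolding ad_cobracket_tp[OF b' tp_in(1) \<psi> \<phi> d c] dual_bracket_tp nest sp ..
  show ?thesis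
    unfolding cocycle_defect_def 1 2 3 4 5 derivation_defect_def left_defect_def right_defect_def by (simp add: algebra_simps)
qed

section \<open>The compatibility conditions of a Novikov bialgebra\<close>

lemma tensor_map_prod:
  assumes \<phi>: "\<phi> \<in> dualA" and \<psi>: "\<psi> \<in> dualA"
  shows "tensor_map sA UNIV f g T (\<lambda>x y. \<phi> x * \<psi> y) = T (\<lambda>x y. (\<phi> \<circ> f) x * (\<psi> \<circ> g) y)"
  using bilinear_on_prod[of sA UNIV \<phi> sA UNIV \<psi>] \<phi> \<psi> by (simp add: tensor_map_def)

lemma tensor_map_bitensor:
  assumes "bitensor_on sA UNIV sA UNIV UNIV UNIV T" "linear_on sA UNIV sA f" "linear_on sA UNIV sA g"
  shows "bitensor_on sA UNIV sA UNIV UNIV UNIV (tensor_map sA UNIV f g T)"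
  by (rule bitensor_on_map[OF assms(1,2) _ _ assms(3)]) auto

lemma A2_eq_iff:
  assumes "bitensor_on sA UNIV sA UNIV UNIV UNIV T" "bitensor_on sA UNIV sA UNIV UNIV UNIV T'"
  shows "T = T' \<longleftrightarrow> (\<forall>\<phi>\<in>dualA. \<forall>\<psi>\<in>dualA. T (\<lambda>x y. \<phi> x * \<psi> y) - T' (\<lambda>x y. \<phi> x * \<psi> y) = 0)"
proof
  assume r: "\<forall>\<phi>\<in>dualA. \<forall>\<psi>\<in>dualA. T (\<lambda>x y. \<phi> x * \<psi> y) - T' (\<lambda>x y. \<phi> x * \<psi> y) = 0"
  have "T - T' = 0"
    by (rule A2_eq_zero[OF bitensor_on_minus[OF assms]]) (use r in simp)
  then show "T = T'" by (rule right_minus_eq[THEN iffD1])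
qed simp

lemma id_linear_A: "linear_on sA UNIV sA id"
  by (simp add: linear_on_def)

lemma flip_eval: "tensor_flip T (\<lambda>x y. \<phi> x * \<psi> y) = T (\<lambda>x y. \<psi> x * \<phi> y)" for T :: "('k, 'v, 'v) tensor"
  by (simp add: tensor_flip_def mult.commute)

lemma compat_iff:
  shows "DA (circ a a') = tensor_map sA UNIV (Rmul a') id (DA a) +
           tensor_map sA UNIV id (Lstar a) (DA a' + tensor_flip (DA a')) \<longleftrightarrow>
         (\<forall>\<phi>\<in>dualA. \<forall>\<psi>\<in>dualA. derivation_defect a a' \<phi> \<psi> = 0)" (is "?p1 \<longleftrightarrow> _")
    and "tensor_map sA UNIV (Lstar a) id (DA a') - tensor_map sA UNIV id (Lstar a) (tensor_flip (DA a')) =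
         tensor_map sA UNIV (Lstar a') id (DA a) - tensor_map sA UNIV id (Lstar a') (tensor_flip (DA a)) \<longleftrightarrow>
         (\<forall>\<phi>\<in>dualA. \<forall>\<psi>\<in>dualA. left_defect a a' \<phi> \<psi> = 0)" (is "?p2 \<longleftrightarrow> _")
    and "tensor_map sA UNIV id (Rmul a) (DA a' + tensor_flip (DA a')) - tensor_map sA UNIV (Rmul a) id (DA a' + tensor_flip (DA a')) =
         tensor_map sA UNIV id (Rmul a') (DA a + tensor_flip (DA a)) - tensor_map sA UNIV (Rmul a') id (DA a + tensor_flip (DA a)) \<longleftrightarrow>
         (\<forall>\<phi>\<in>dualA. \<forall>\<psi>\<in>dualA. right_defect a a' \<phi> \<psi> = 0)" (is "?p3 \<longleftrightarrow> _")
proof -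
  note bt = DA_bitensor tensor_map_bitensor bitensor_on_plus bitensor_on_minus bitensor_on_flip
    id_linear_A Lstar_linear Rmul_linear
  show "?p1 \<longleftrightarrow> (\<forall>\<phi>\<in>dualA. \<forall>\<psi>\<in>dualA. derivation_defect a a' \<phi> \<psi> = 0)"
    by (subst A2_eq_iff, (intro bt)+, intro ball_cong refl)
      (simp add: tensor_map_prod flip_eval derivation_defect_def dual_prod_def algebra_simps del: mem_Collect_eq o_apply)
  show "?p2 \<longleftrightarrow> (\<forall>\<phi>\<in>dualA. \<forall>\<psi>\<in>dualA. left_defect a a' \<phi> \<psi> = 0)"
    by (subst A2_eq_iff, (intro bt)+, intro ball_cong refl)
      (simp add: tensor_map_prod flip_eval left_defect_def dual_prod_def del: mem_Collect_eq o_apply)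
  show "?p3 \<longleftrightarrow> (\<forall>\<phi>\<in>dualA. \<forall>\<psi>\<in>dualA. right_defect a a' \<phi> \<psi> = 0)"
    by (subst A2_eq_iff, (intro bt)+, intro ball_cong refl)
      (simp add: tensor_map_prod flip_eval right_defect_def dual_prod_def del: mem_Collect_eq o_apply)
qed

lemma novikov_bialgebra_iff:
  "novikov_bialgebra sA circ DA \<longleftrightarrow>
    novikov_on UNIV circ \<and> novikov_on dualA dual_prod \<and>
    (\<forall>a a'. \<forall>\<phi>\<in>dualA. \<forall>\<psi>\<in>dualA. derivation_defect a a' \<phi> \<psi> = 0 \<and> left_defect a a' \<phi> \<psi> = 0 \<and> right_defect a a' \<phi> \<psi> = 0)"
proof -
  have alg: "novikov_algebra sA circ \<longleftrightarrow> novikov_on UNIV circ"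
    using A.vector_space_axioms circ by (auto simp: novikov_algebra_def novikov_on_def)
  have f: "(\<lambda>x. circ x a) = Rmul a" "(\<lambda>x. circ a x + circ x a) = Lstar a" for a
    by (auto simp: Rmul_def Lstar_def)
  show ?thesis
    unfolding novikov_bialgebra_def Let_def alg novikov_coalgebra_iff f compat_iff by (simp only: ball_conj_distrib all_conj_distrib)
qed

section \<open>Both implications\<close>

text \<open>The scalar form of the definition: Jacobi for \<open>A \<otimes> B\<close>, Jacobi for \<open>A\<^sup>* \<otimes> B\<close>, and the cocycle condition.\<close>

lemma lie_bialgebra_iff:
  "completed_lie_bialgebra fscale L GL br \<delta> \<longleftrightarrow>
    (\<forall>a1 b1 a2 b2 a3 b3 \<beta>. bilinear_on sA UNIV sB UNIV (*) \<beta> \<longrightarrow> jacobi_sum circ dia \<beta> a1 b1 a2 b2 a3 b3 = 0) \<and>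
    (\<forall>x\<in>L. \<forall>\<phi>\<in>dualA. \<forall>\<psi>\<in>dualA. \<forall>\<chi>\<in>dualA. \<forall>i j k. \<forall>c\<in>GB i. \<forall>d\<in>GB j. \<forall>e\<in>GB k.
       jacobi_sum dual_prod dia (\<lambda>\<phi> c. pairing \<phi> c x) \<phi> c \<psi> d \<chi> e = 0) \<and>
    (\<forall>i j. \<forall>\<phi>\<in>dualA. \<forall>\<psi>\<in>dualA. \<forall>c\<in>GB (- m - i). \<forall>d\<in>GB (- m - j). \<forall>a b p a' b' p'.
      b \<in> GB p \<longrightarrow> b' \<in> GB p' \<longrightarrow> cocycle_defect (tp a b) (tp a' b') i j \<phi> c \<psi> d = 0)"
  unfolding completed_lie_bialgebra_def lie_algebra_iff completed_lie_coalgebra_iff cocycle_iff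
  using ad_terms_finite by simp

lemma dualA_subspace: "fun_space.subspace dualA"
  by (rule fun_space.subspaceI) (auto simp: linear_on_def fscale_apply algebra_simps)

lemma bialgebra_imp_lie_bialgebra:
  assumes N: "novikov_bialgebra sA circ DA"
  shows "completed_lie_bialgebra fscale L GL br \<delta>"
  unfolding lie_bialgebra_iff
proof (intro conjI allI ballI impI)
  have n: "novikov_on UNIV circ" "novikov_on dualA dual_prod"
    and K: "\<And>a a' \<phi> \<psi>. \<phi> \<in> dualA \<Longrightarrow> \<psi> \<in> dualA \<Longrightarrow> derivation_defect a a' \<phi> \<psi> = 0 \<and> left_defect a a' \<phi> \<psi> = 0 \<and> right_defect a a' \<phi> \<psi> = 0"
    using N[unfolded novikov_bialgebra_iff] by simp_all
  show "jacobi_sum circ dia \<beta> a1 b1 a2 b2 a3 b3 = 0" if "bilinear_on sA UNIV sB UNIV (*) \<beta>" for \<beta> a1 b1 a2 b2 a3 b3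
    by (rule novikov_jacobi[OF modules(1) subspace_UNIV(1) _ n(1) B_right_novikov that]) simp_all
  show "jacobi_sum dual_prod dia (\<lambda>\<phi> c. pairing \<phi> c x) \<phi> c \<psi> d \<chi> e = 0"
    if "x \<in> L" "\<phi> \<in> dualA" "\<psi> \<in> dualA" "\<chi> \<in> dualA" for x \<phi> c \<psi> d \<chi> e
    by (rule novikov_jacobi[OF modules(3) dualA_subspace dual_prod_closed n(2) B_right_novikov pairing_bilinear[OF that(1)] that(2-4)])
  show "cocycle_defect (tp a b) (tp a' b') i j \<phi> c \<psi> d = 0"
    if "\<phi> \<in> dualA" "\<psi> \<in> dualA" "c \<in> GB (- m - i)" "d \<in> GB (- m - j)" "b \<in> GB p" "b' \<in> GB p'"
    for i j \<phi> \<psi> c d a b p a' b' p'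
    unfolding cocycle_defect_tp[OF that(5,6,1,2,3,4)] using K that(1,2) by simp
qed

lemma dualA_separates:
  assumes "\<And>\<phi>. \<phi> \<in> dualA \<Longrightarrow> \<phi> x = \<phi> y"
  shows "x = y"
proof (rule ccontr)
  assume "x \<noteq> y"
  then obtain f where f: "linear_on sA UNIV (*) f" "f (x - y) \<noteq> 0"
    using separating_functional[OF A.vector_space_axioms, of "x - y"] by auto
  then show False using assms[of f] linear_onD_diff[OF f(1), of x y] by simp
qed

text \<open>Here \<open>D\<close> is the cocycle condition at \<open>a t\<^sup>p, a' t\<^sup>p\<^sup>'\<close> and \<open>\<phi> t\<^sup>r, \<psi> t\<^sup>s\<close>, in which the six symmetric values are
  products of two exponents.  The form forces the exponents to have sum \<open>1\<close>.\<close>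

lemma lie_bialgebra_imp_bialgebra:
  assumes t: "laurent_basis sB dia form t" and tG: "\<And>i. t i \<in> GB (i - 1)"
    and Lie: "completed_lie_bialgebra fscale L GL br \<delta>"
  shows "novikov_bialgebra sA circ DA"
  unfolding novikov_bialgebra_iff
proof (intro conjI allI ballI)
  note Lie' = Lie[unfolded lie_bialgebra_iff]
  have tG': "t i \<in> GB (- m - (- m - (i - 1)))" for i using tG[of i] by simp
  have J: "jacobi_sum circ dia (\<lambda>x y. \<phi> x * form y (t n)) a (t i) b (t j) c (t k) = 0"
    if "\<phi> \<in> dualA" for \<phi> a b c i j k n
    by (rule Lie'[THEN conjunct1, rule_format, OF pairing_form[OF that]])
  show "novikov_on UNIV circ"
    unfolding novikov_on_def
  proof (intro ballI conjI)
    fix a b c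
    show "circ (circ a b) c = circ (circ a c) b"
      by (rule dualA_separates) (rule laurent_jacobi_novikov(1)[OF t J])
    show "circ (circ a b) c - circ a (circ b c) = circ (circ b a) c - circ b (circ a c)"
    proof (rule dualA_separates)
      fix \<phi> assume \<phi>: "\<phi> \<in> dualA"
      have "\<phi> (x - y) = \<phi> x - \<phi> y" for x y
        using linear_onD_diff[OF dualA_linear[OF \<phi>]] by simp
      then show "\<phi> (circ (circ a b) c - circ a (circ b c)) = \<phi> (circ (circ b a) c - circ b (circ a c))"
        using laurent_jacobi_novikov(2)[OF t J[OF \<phi>]] by simp
    qed
  qed
  have J': "jacobi_sum dual_prod dia (\<lambda>\<phi> y. \<phi> a * form y (t n)) \<phi> (t i) \<psi> (t j) \<chi> (t k) = 0"
    if "\<phi> \<in> dualA" "\<psi> \<in> dualA" "\<chi> \<in> dualA" for \<phi> \<psi> \<chi> a i j k n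
  proof -
    have "jacobi_sum dual_prod dia (\<lambda>\<phi> c. pairing \<phi> c (tp a (t n))) \<phi> (t i) \<psi> (t j) \<chi> (t k) = 0"
      by (rule Lie'[THEN conjunct2, THEN conjunct1, rule_format, OF tp_in(1) that tG tG tG])
    then show ?thesis
      unfolding jacobi_sum_def nested_bracket_def pairing_tp[OF dual_prod_closed] form_sym[of "t n"] .
  qed
  show "novikov_on dualA dual_prod"
    unfolding novikov_on_def
  proof (intro ballI conjI ext)
    fix \<phi> \<psi> \<chi> a assume h: "\<phi> \<in> dualA" "\<psi> \<in> dualA" "\<chi> \<in> dualA"
    show "dual_prod (dual_prod \<phi> \<psi>) \<chi> a = dual_prod (dual_prod \<phi> \<chi>) \<psi> a"
      by (rule laurent_jacobi_novikov(1)[where h = "\<lambda>\<phi>. \<phi> a", OF t J'[OF h]])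
    show "(dual_prod (dual_prod \<phi> \<psi>) \<chi> - dual_prod \<phi> (dual_prod \<psi> \<chi>)) a = (dual_prod (dual_prod \<psi> \<phi>) \<chi> - dual_prod \<psi> (dual_prod \<phi> \<chi>)) a"
      using laurent_jacobi_novikov(2)[where h = "\<lambda>\<phi>. \<phi> a", OF t J'[OF h]] by simp
  qed
  fix a a' \<phi> \<psi> assume h: "\<phi> \<in> dualA" "\<psi> \<in> dualA"
  have D: "derivation_defect a a' \<phi> \<psi> * of_int (p * r) - derivation_defect a a' \<psi> \<phi> * of_int (p * s) -
    derivation_defect a' a \<phi> \<psi> * of_int (p' * r) + derivation_defect a' a \<psi> \<phi> * of_int (p' * s) +
    left_defect a a' \<phi> \<psi> * of_int (p * p') - right_defect a a' \<phi> \<psi> * of_int (r * s) = 0"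
    if sum: "p + p' + r + s = 1" for p p' r s
  proof -
    have N: "form (t v) (dia (t u) (dia (t w) (t z))) = of_int (u * w)" if "u + w + z + v = 1" for u v w z
      unfolding form_sym[of "t v"] laurent_nested(1)[OF t] using that by simp
    have "cocycle_defect (tp a (t p)) (tp a' (t p')) (- m - (r - 1)) (- m - (s - 1)) \<phi> (t r) \<psi> (t s) = 0"
      by (rule Lie'[THEN conjunct2, THEN conjunct2, rule_format, OF h tG' tG' tG tG])
    then show ?thesis
      unfolding cocycle_defect_tp[OF tG tG h tG' tG'] using sum by (simp add: N)
  qed
  \<comment> \<open>With one exponent 0 and the others 1, 1 and -1, only three of the six values are nonzero, one equal to 1 and two equal to -1.  Adding two such relations leaves twice a single defect.\<close>
  have D1: "derivation_defect a' a \<phi> \<psi> - derivation_defect a a' \<phi> \<psi> + left_defect a a' \<phi> \<psi> = 0"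
    using D[of 1 1 "-1" 0] by (simp add: algebra_simps)
  have D2: "derivation_defect a a' \<phi> \<psi> + derivation_defect a' a \<phi> \<psi> - left_defect a a' \<phi> \<psi> = 0"
    using D[of 1 "-1" 1 0] by (simp add: algebra_simps)
  have D3: "- derivation_defect a a' \<phi> \<psi> = derivation_defect a' a \<phi> \<psi> + left_defect a a' \<phi> \<psi>"
    using D[of "-1" 1 1 0] by (simp add: algebra_simps)
  have "2 * derivation_defect a a' \<phi> \<psi> = 0" using D1 D3 by algebra
  then show "derivation_defect a a' \<phi> \<psi> = 0" by simp
  have "2 * left_defect a a' \<phi> \<psi> = 0" using D2 D3 by algebra
  then show "left_defect a a' \<phi> \<psi> = 0" by simp
  have D4: "derivation_defect a a' \<phi> \<psi> + derivation_defect a a' \<psi> \<phi> + right_defect a a' \<phi> \<psi> = 0"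
    using D[of 1 0 1 "-1"] by (simp add: algebra_simps)
  have D5: "derivation_defect a a' \<phi> \<psi> + derivation_defect a a' \<psi> \<phi> - right_defect a a' \<phi> \<psi> = 0"
    using D[of 1 0 "-1" 1] by (simp add: algebra_simps)
  have "2 * right_defect a a' \<phi> \<psi> = 0" using D4 D5 by algebra
  then show "right_defect a a' \<phi> \<psi> = 0" by simp
qed

end

theorem theorem2p23:
  fixes sA :: "'k::field_char_0 \<Rightarrow> 'a::ab_group_add \<Rightarrow> 'a"
    and basisA :: "'a set"
    and circ :: "'a \<Rightarrow> 'a \<Rightarrow> 'a"
    and DA :: "'a \<Rightarrow> ('k, 'a, 'a) tensor"
    and sB :: "'k \<Rightarrow> 'b::ab_group_add \<Rightarrow> 'b"
    and GB :: "int \<Rightarrow> 'b set"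
    and dia :: "'b \<Rightarrow> 'b \<Rightarrow> 'b"
    and form :: "'b \<Rightarrow> 'b \<Rightarrow> 'k"
    and DB :: "'b \<Rightarrow> ('k, 'b) ctensor"
    and br :: "('k, 'a, 'b) tensor \<Rightarrow> ('k, 'a, 'b) tensor \<Rightarrow> ('k, 'a, 'b) tensor"
    and \<delta> :: "('k, 'a, 'b) tensor \<Rightarrow> ('k, ('k, 'a, 'b) tensor) ctensor"
  assumes A_fin_dim: "finite_dimensional_vector_space sA basisA"
    and circ: "bilinear_on sA UNIV sA UNIV sA circ"
    and DA_linear: "linear_on sA UNIV fscale DA"
    and DA_range: "\<And>a. DA a \<in> tensor_space sA UNIV sA UNIV"
    and B: "quadratic_graded_right_novikov_algebra sB GB dia form"
    and DB_linear: "linear_on sB UNIV cscale DB"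
    and DB_range: "\<And>a. DB a \<in> completed_square sB UNIV GB"
    and DB: "\<And>a b c. cpairing form (DB a) b c = form a (dia b c)"
    and br_bilinear: "bilinear_on fscale (aff_space sA sB) fscale (aff_space sA sB) fscale br"
    and br: "\<And>a1 b1 a2 b2. br (aff_tensor sA sB a1 b1) (aff_tensor sA sB a2 b2) =
               aff_tensor sA sB (circ a1 a2) (dia b1 b2) - aff_tensor sA sB (circ a2 a1) (dia b2 b1)"
    and \<delta>_linear: "linear_on fscale (aff_space sA sB) cscale \<delta>"
    and \<delta>: "\<And>a b. \<delta> (aff_tensor sA sB a b) =
               bullet sA sB (DA a) (DB b) - cflip (bullet sA sB (DA a) (DB b))"
  shows "(novikov_bialgebra sA circ DA \<longrightarrow>
            completed_lie_bialgebra fscale (aff_space sA sB) (aff_grading sA sB GB) br \<delta>) \<and>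
         (is_laurent_algebra sB GB dia form \<longrightarrow>
            completed_lie_bialgebra fscale (aff_space sA sB) (aff_grading sA sB GB) br \<delta> \<longrightarrow>
            novikov_bialgebra sA circ DA)"
proof -
  have "\<exists>m. \<forall>i j. i + j + m \<noteq> 0 \<longrightarrow> (\<forall>x\<in>GB i. \<forall>y\<in>GB j. form x y = 0)"
    using B by (simp add: quadratic_graded_right_novikov_algebra_def)
  then obtain m where m: "\<forall>i j. i + j + m \<noteq> 0 \<longrightarrow> (\<forall>x\<in>GB i. \<forall>y\<in>GB j. form x y = 0)"
    by (rule exE)
  interpret affinization sA basisA circ DA sB GB dia form DB br \<delta> m
    by (rule affinization.intro[OF A_fin_dim circ DA_linear DA_range B _ DB_range DB br_bilinear br
          \<delta>_linear \<delta>]) (use m in simp)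
  show ?thesis
  proof (intro conjI impI)
    show "completed_lie_bialgebra fscale L GL br \<delta>" if "novikov_bialgebra sA circ DA"
      by (rule bialgebra_imp_lie_bialgebra[OF that])
  next
    assume "is_laurent_algebra sB GB dia form" and Lie: "completed_lie_bialgebra fscale L GL br \<delta>"
    then obtain \<phi> :: "(int \<Rightarrow>\<^sub>0 'k) \<Rightarrow> 'b" where \<phi>:
      "\<forall>i. GB i = module.span sB {\<phi> (Poly_Mapping.single (i + 1) 1)}"
      "\<forall>i j. dia (\<phi> (Poly_Mapping.single i 1)) (\<phi> (Poly_Mapping.single j 1)) =
         sB (of_int i) (\<phi> (Poly_Mapping.single (i + j - 1) 1))"
      "\<forall>i j. form (\<phi> (Poly_Mapping.single i 1)) (\<phi> (Poly_Mapping.single j 1)) = (if i + j + 1 = 0 then 1 else 0)"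
      unfolding is_laurent_algebra_def Let_def by blast
    define t where "t i = \<phi> (Poly_Mapping.single i 1)" for i
    have "bilinear_on sB UNIV sB UNIV sB dia"
      using B_right_novikov by (simp add: right_novikov_algebra_def)
    then have "laurent_basis sB dia form t"
      using \<phi>(2,3) form_bilinear by (simp add: laurent_basis_def t_def)
    moreover have "t i \<in> GB (i - 1)" for i
      using \<phi>(1) by (simp add: t_def B.span_base)
    ultimately show "novikov_bialgebra sA circ DA"
      by (rule lie_bialgebra_imp_bialgebra[OF _ _ Lie])
  qed
qed

end
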